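(* Let $m\ge1$, $0=b_0<b_1<\cdots<b_m=a$, $T>0$, $\rho\ge0$, let $\gamma_1,\dots,\gamma_m$ be positive constants and let $\gamma(x)=\gamma_j$ for $b_{j-1}<x<b_j$, $j=1,\dots,m$. Let $u=u(x,t)$ be an arbitrary solution (in the sense given in the context) of $$u_t=(\gamma u_x)_x\ \text{ in } ]0,a[\,\times\,]0,T[,\qquad \gamma_mu_x(a,t)+\rho\,u(a,t)=0\ \text{ for } t\in\,]0,T[,\qquad u(x,0)=0\ \text{ in } ]0,a[ .$$ Let $M>0$ satisfy $$M\ge 2\left(\frac{b_1}{\sqrt{\gamma_1}}+\sum_{j=1}^{m-1}\frac{b_{j+1}-b_j}{\sqrt{\gamma_{j+1}}}\right)$$ and let $c$ be an arbitrary positive number satisfying $Mc<T$. For $\tau>c^{-2}$ let $z=-c\tau\bigl(1+i\sqrt{1-\tfrac1{c^2\tau}}\bigr)$. Assume that there exist a positive constant $C$, a positive number $\tau_0$ ($>c^{-2}$) and a real number $\mu$ such that, for all $\tau>\tau_0$, $$C\,\tau^{\mu}\le\left|\int_0^Te^{-z^2t}u_x(0,t)\,dt\right| .$$ Then, with $I_c(\tau)$ the indicator function defined in the context, $$\lim_{\tau\to\infty}\frac{\log|I_c(\tau)|}{\tau}=-2c\left(\frac{b_1}{\sqrt{\gamma_1}}+\sum_{j=1}^{m-1}\frac{b_{j+1}-b_j}{\sqrt{\gamma_{j+1}}}\right).$$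
   Context: Solutions are understood in a variational sense: $u\in L^2(0,T;H^1(]0,a[))$, $u_t\in L^2(0,T;(H^1(]0,a[))')$, $u_x(0,t),u_x(a,t)\in L^2(0,T)$, and for all $\varphi\in H^1(]0,a[)$ and a.e. $t$, $\langle u_t,\varphi\rangle+\int_0^a\gamma u_x\varphi'\,dx+\rho u(a,t)\varphi(a)=-\gamma_1u_x(0,t)\varphi(0)$, with $u(\cdot,0)=0$. The function $\Psi$: set $z_j=z/\sqrt{\gamma_j}$, and let $\tilde\gamma$ on $\mathbf R$ be $\gamma_1$ for $x<b_1$, $\gamma_j$ for $b_{j-1}<x<b_j$ ($2\le j\le m-1$), $\gamma_m$ for $x>b_{m-1}$ (for $m=1$, $\tilde\gamma\equiv\gamma_1$). There is a number $C(c;\gamma_1,\dots,\gamma_m)>c^{-2}$ such that for every $\tau>C(c;\gamma_1,\dots,\gamma_m)$ there are unique complex numbers $B_1,A_2,B_2,\dots,A_{m-1},B_{m-1},A_m$ such that, with $A_1=1$ and $B_m=0$, the function $\Psi$ equal to $A_je^{xz_j}+B_je^{-xz_j}$ on the $j$-th layer (the layers being $x<b_1$; $b_{j-1}<x<b_j$ for $2\le j\le m-1$; $x>b_{m-1}$) satisfies $(\tilde\gamma\Psi')'-z^2\Psi=0$ in $\mathbf R$ in the weak sense (that is, $\Psi$ and $\tilde\gamma\Psi'$ are continuous across each $b_j$, $1\le j\le m-1$). For $m=1$, $\Psi(x)=e^{xz_1}$. Indicator function: with $v(x,t)=e^{-z^2t}\Psi(x)$, for $\tau>C(c;\gamma_1,\dots,\gamma_m)$,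 $$I_c(\tau)=\int_0^T\bigl(-\gamma_1v_x(0,t)u(0,t)+\gamma_1u_x(0,t)v(0,t)\bigr)\,dt .$$ *)

theory Defs
  imports "HOL-Analysis.Analysis"
begin

text \<open>
  Functions are complex-valued throughout. Real-valued solutions are included, and all pairings
  are bilinear (no complex conjugation). \<open>S\<close> is always a bounded open interval.
\<close>

subsection \<open>Lebesgue and Sobolev spaces on an interval\<close>

definition L2 :: "real set \<Rightarrow> (real \<Rightarrow> complex) set" where
  "L2 S = {f. f \<in> borel_measurable (lebesgue_on S) \<and>
              integrable (lebesgue_on S) (\<lambda>x. (cmod (f x))\<^sup>2)}"

definition L2_norm :: "real set \<Rightarrow> (real \<Rightarrow> complex) \<Rightarrow> real" where
  "L2_norm S f = sqrt (\<integral>x. (cmod (f x))\<^sup>2 \<partial>lebesgue_on S)"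

text \<open>Compactly supported \<open>C\<^sup>1\<close> functions; as in Brezis' treatment of \<open>W\<^sup>1\<^sup>,\<^sup>p\<close> of an interval, they serve
  as test functions.\<close>

definition test_function :: "real set \<Rightarrow> (real \<Rightarrow> real) \<Rightarrow> bool" where
  "test_function S \<theta> \<longleftrightarrow> \<theta> C1_differentiable_on UNIV \<and>
     compact (closure {x. \<theta> x \<noteq> 0}) \<and> closure {x. \<theta> x \<noteq> 0} \<subseteq> S"

definition has_weak_deriv :: "real set \<Rightarrow> (real \<Rightarrow> complex) \<Rightarrow> (real \<Rightarrow> complex) \<Rightarrow> bool" where
  "has_weak_deriv S f g \<longleftrightarrow> (\<forall>\<theta>. test_function S \<theta> \<longrightarrow>
     (\<integral>x. f x * of_real (deriv \<theta> x) \<partial>lebesgue_on S) =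
     - (\<integral>x. g x * of_real (\<theta> x) \<partial>lebesgue_on S))"

definition H1 :: "real set \<Rightarrow> (real \<Rightarrow> complex) set" where
  "H1 S = {f \<in> L2 S. \<exists>g \<in> L2 S. has_weak_deriv S f g}"

text \<open>The weak derivative is determined almost everywhere.\<close>

definition weak_deriv :: "real set \<Rightarrow> (real \<Rightarrow> complex) \<Rightarrow> real \<Rightarrow> complex" where
  "weak_deriv S f = (SOME g. g \<in> L2 S \<and> has_weak_deriv S f g)"

definition H1_norm :: "real set \<Rightarrow> (real \<Rightarrow> complex) \<Rightarrow> real" where
  "H1_norm S f = sqrt ((L2_norm S f)\<^sup>2 + (L2_norm S (weak_deriv S f))\<^sup>2)"

text \<open>Value at a point of the closed interval of the continuous representative of an \<open>H\<^sup>1\<close> function.\<close>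

definition trace_at :: "real set \<Rightarrow> (real \<Rightarrow> complex) \<Rightarrow> real \<Rightarrow> complex" where
  "trace_at S f = (SOME h. continuous_on (closure S) h \<and> (AE x in lebesgue_on S. h x = f x))"

definition H1_dual :: "real set \<Rightarrow> ((real \<Rightarrow> complex) \<Rightarrow> complex) set" where
  "H1_dual S = {l. (\<forall>f\<in>H1 S. \<forall>g\<in>H1 S. l (\<lambda>x. f x + g x) = l f + l g) \<and>
                   (\<forall>k. \<forall>f\<in>H1 S. l (\<lambda>x. k * f x) = k * l f) \<and>
                   (\<exists>K. \<forall>f\<in>H1 S. cmod (l f) \<le> K * H1_norm S f)}"

definition H1_dual_norm :: "real set \<Rightarrow> ((real \<Rightarrow> complex) \<Rightarrow> complex) \<Rightarrow> real" where
  "H1_dual_norm S l = (SUP f\<in>{f \<in> H1 S. H1_norm S f \<le> 1}. cmod (l f))"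


subsection \<open>Vector-valued functions of time\<close>

text \<open>\<open>L\<^sup>2(0,T;V)\<close> in the sense of Bochner, for a space of functions \<open>V\<close> with (semi)norm \<open>N\<close>:
  strong measurability is approximation almost everywhere by simple functions.\<close>

definition simple_in :: "real \<Rightarrow> 'v set \<Rightarrow> (real \<Rightarrow> 'v) \<Rightarrow> bool" where
  "simple_in T V s \<longleftrightarrow> finite (s ` {0<..<T}) \<and> s ` {0<..<T} \<subseteq> V \<and>
     (\<forall>h. {t \<in> {0<..<T}. s t = h} \<in> sets lebesgue)"

definition bochner_L2 :: "real \<Rightarrow> 'v::minus set \<Rightarrow> ('v \<Rightarrow> real) \<Rightarrow> (real \<Rightarrow> 'v) \<Rightarrow> bool" where
  "bochner_L2 T V N u \<longleftrightarrow>
     (AE t in lebesgue_on {0<..<T}. u t \<in> V) \<and>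
     (\<exists>s. (\<forall>n::nat. simple_in T V (s n)) \<and>
          (AE t in lebesgue_on {0<..<T}. (\<lambda>n. N (u t - s n t)) \<longlonglongrightarrow> 0)) \<and>
     integrable (lebesgue_on {0<..<T}) (\<lambda>t. (N (u t))\<^sup>2)"

text \<open>\<open>u\<^sub>t = u'\<close> as distributions on \<open>]0,T[\<close> with values in the dual of \<open>H\<^sup>1(S)\<close>, where \<open>H\<^sup>1(S)\<close> is
  embedded in its dual through the \<open>L\<^sup>2\<close> pairing. The identity of functionals is tested on every
  \<open>\<phi>\<close>.\<close>

definition has_time_deriv ::
  "real set \<Rightarrow> real \<Rightarrow> (real \<Rightarrow> real \<Rightarrow> complex) \<Rightarrow> (real \<Rightarrow> (real \<Rightarrow> complex) \<Rightarrow> complex) \<Rightarrow> bool" where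
  "has_time_deriv S T u ut \<longleftrightarrow> (\<forall>\<phi>\<in>H1 S. \<forall>\<theta>. test_function {0<..<T} \<theta> \<longrightarrow>
     (\<integral>t. (\<integral>x. u t x * \<phi> x \<partial>lebesgue_on S) * of_real (deriv \<theta> t) \<partial>lebesgue_on {0<..<T}) =
     - (\<integral>t. ut t \<phi> * of_real (\<theta> t) \<partial>lebesgue_on {0<..<T}))"

text \<open>\<open>u(\<cdot>,0) = 0\<close>, for the representative of \<open>u\<close> in \<open>C([0,T];L\<^sup>2(S))\<close>.\<close>

definition initially_zero :: "real set \<Rightarrow> real \<Rightarrow> (real \<Rightarrow> real \<Rightarrow> complex) \<Rightarrow> bool" where
  "initially_zero S T u \<longleftrightarrow> (\<exists>w.
     (\<forall>t\<in>{0..T}. w t \<in> L2 S) \<and>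
     (\<forall>t\<in>{0..T}. ((\<lambda>s. L2_norm S (w s - w t)) \<longlongrightarrow> 0) (at t within {0..T})) \<and>
     (AE t in lebesgue_on {0<..<T}. AE x in lebesgue_on S. w t x = u t x) \<and>
     (AE x in lebesgue_on S. w 0 x = 0))"


subsection \<open>The heat equation in a layered rod\<close>

text \<open>The value at the interfaces, here 0, is immaterial.\<close>

definition conductivity :: "nat \<Rightarrow> (nat \<Rightarrow> real) \<Rightarrow> (nat \<Rightarrow> real) \<Rightarrow> real \<Rightarrow> real" where
  "conductivity m b \<gamma> x = (\<Sum>j=1..m. \<gamma> j * indicator {b (j - 1)<..<b j} x)"

text \<open>\<open>u t\<close> is the function \<open>x \<mapsto> u(x,t)\<close>, and \<open>g0\<close>, \<open>ga\<close> are the fluxes \<open>u\<^sub>x(0,t)\<close>, \<open>u\<^sub>x(a,t)\<close>. For a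
  variational solution these are not pointwise boundary values: given \<open>u\<close>, they are determined
  almost everywhere by the weak formulation (take \<open>\<phi>(0) = 1\<close>) and by the condition at \<open>a\<close>.\<close>

definition heat_solution ::
  "nat \<Rightarrow> (nat \<Rightarrow> real) \<Rightarrow> (nat \<Rightarrow> real) \<Rightarrow> real \<Rightarrow> real \<Rightarrow> real \<Rightarrow>
   (real \<Rightarrow> real \<Rightarrow> complex) \<Rightarrow> (real \<Rightarrow> complex) \<Rightarrow> (real \<Rightarrow> complex) \<Rightarrow> bool" where
  "heat_solution m b \<gamma> a \<rho> T u g0 ga \<longleftrightarrow> (let S = {0<..<a} in
     bochner_L2 T (H1 S) (H1_norm S) u \<and>
     g0 \<in> L2 {0<..<T} \<and> ga \<in> L2 {0<..<T} \<and>
     (\<exists>ut. bochner_L2 T (H1_dual S) (H1_dual_norm S) ut \<and> has_time_deriv S T u ut \<and>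
        (\<forall>\<phi>\<in>H1 S. AE t in lebesgue_on {0<..<T}.
           ut t \<phi>
           + (\<integral>x. of_real (conductivity m b \<gamma> x) * weak_deriv S (u t) x * weak_deriv S \<phi> x
                \<partial>lebesgue_on S)
           + of_real \<rho> * trace_at S (u t) a * trace_at S \<phi> a
           = - of_real (\<gamma> 1) * g0 t * trace_at S \<phi> 0)) \<and>
     (AE t in lebesgue_on {0<..<T}. of_real (\<gamma> m) * ga t + of_real \<rho> * trace_at S (u t) a = 0) \<and>
     initially_zero S T u)"


subsection \<open>The indicator function\<close>

definition layer :: "nat \<Rightarrow> (nat \<Rightarrow> real) \<Rightarrow> nat \<Rightarrow> real set" where
  "layer m b j = {x. (j = 1 \<or> b (j - 1) < x) \<and> (j = m \<or> x < b j)}"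

definition conductivity_ext :: "nat \<Rightarrow> (nat \<Rightarrow> real) \<Rightarrow> (nat \<Rightarrow> real) \<Rightarrow> real \<Rightarrow> real" where
  "conductivity_ext m b \<gamma> x = (\<Sum>j=1..m. \<gamma> j * indicator (layer m b j) x)"

definition z_of :: "real \<Rightarrow> real \<Rightarrow> complex" where
  "z_of c \<tau> = - of_real (c * \<tau>) * (1 + \<i> * of_real (sqrt (1 - 1 / (c\<^sup>2 * \<tau>))))"

text \<open>Continuity of \<open>\<gamma>\<Psi>'\<close> across \<open>b j\<close> is the existence of a common limit from both sides.\<close>

definition is_Psi ::
  "nat \<Rightarrow> (nat \<Rightarrow> real) \<Rightarrow> (nat \<Rightarrow> real) \<Rightarrow> complex \<Rightarrow> (real \<Rightarrow> complex) \<Rightarrow> bool" where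
  "is_Psi m b \<gamma> z \<Psi> \<longleftrightarrow>
     (\<exists>A B. A 1 = 1 \<and> B m = 0 \<and>
        (\<forall>j\<in>{1..m}. \<forall>x\<in>layer m b j.
           \<Psi> x = A j * exp (of_real x * (z / of_real (sqrt (\<gamma> j))))
               + B j * exp (- of_real x * (z / of_real (sqrt (\<gamma> j)))))) \<and>
     (\<forall>j\<in>{1..<m}. isCont \<Psi> (b j) \<and>
        (\<exists>l. ((\<lambda>x. of_real (conductivity_ext m b \<gamma> x) * vector_derivative \<Psi> (at x)) \<longlongrightarrow> l)
               (at (b j))))"

text \<open>Uniquely determined when \<open>z = z_of c \<tau>\<close> with \<open>\<tau>\<close> large.\<close>

definition Psi :: "nat \<Rightarrow> (nat \<Rightarrow> real) \<Rightarrow> (nat \<Rightarrow> real) \<Rightarrow> complex \<Rightarrow> real \<Rightarrow> complex" where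
  "Psi m b \<gamma> z = (THE \<Psi>. is_Psi m b \<gamma> z \<Psi>)"

definition v_fun ::
  "nat \<Rightarrow> (nat \<Rightarrow> real) \<Rightarrow> (nat \<Rightarrow> real) \<Rightarrow> complex \<Rightarrow> real \<Rightarrow> real \<Rightarrow> complex" where
  "v_fun m b \<gamma> z x t = exp (- z\<^sup>2 * of_real t) * Psi m b \<gamma> z x"

definition indicator_function ::
  "nat \<Rightarrow> (nat \<Rightarrow> real) \<Rightarrow> (nat \<Rightarrow> real) \<Rightarrow> real \<Rightarrow> real \<Rightarrow>
   (real \<Rightarrow> real \<Rightarrow> complex) \<Rightarrow> (real \<Rightarrow> complex) \<Rightarrow> real \<Rightarrow> real \<Rightarrow> complex" where
  "indicator_function m b \<gamma> a T u g0 c \<tau> = (let v = v_fun m b \<gamma> (z_of c \<tau>) in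
     \<integral>t. - of_real (\<gamma> 1) * vector_derivative (\<lambda>x. v x t) (at 0) * trace_at {0<..<a} (u t) 0
         + of_real (\<gamma> 1) * g0 t * v 0 t \<partial>lebesgue_on {0<..<T})"

end

theory Submission
  imports Defs "HOL-Real_Asymp.Real_Asymp"
begin

text \<open>
  Put \<open>s = z\<^sup>2\<close>, so that \<open>Re s = \<tau>\<close> and \<open>Re z = - c \<tau>\<close>, and let \<open>L\<close> be the travel time through the
  rod, the sum of the thicknesses of the layers divided by \<open>sqrt (\<gamma> j)\<close>. For every \<open>\<phi>\<close> with
  \<open>(\<gamma> \<phi>')' = s \<phi>\<close> and flux \<open>q = \<gamma> \<phi>'\<close>, testing the heat equation with \<open>e\<^sup>-\<^sup>s\<^sup>t \<phi>(x)\<close> leaves only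
  the value at time \<open>T\<close> and boundary terms (\<open>heat_solution_identity\<close>):
  \<open>e\<^sup>-\<^sup>s\<^sup>T \<integral> u(T) \<phi> + (q(a) + \<rho> \<phi>(a)) U(a) - q(0) U(0) = - \<gamma>\<^sub>1 \<phi>(0) G\<close>,
  where \<open>U(x) = \<integral> e\<^sup>-\<^sup>s\<^sup>t u(x,t) dt\<close> and \<open>G = \<integral> e\<^sup>-\<^sup>s\<^sup>t u\<^sub>x(0,t) dt\<close>.

  This is used twice. For \<open>\<phi> = \<Psi>\<close> it turns the indicator function into
  \<open>- (q(a) + \<rho> \<Psi>(a)) U(a)\<close> up to the term with \<open>e\<^sup>-\<^sup>s\<^sup>T\<close>. For the solution \<open>\<Theta>\<close> with \<open>\<Theta>(0) = 1\<close> and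
  \<open>\<Theta>'(0) = 0\<close> the unknown \<open>U(0)\<close> drops out, and \<open>U(a)\<close> is \<open>- \<gamma>\<^sub>1 G\<close> divided by \<open>q(a) + \<rho> \<Theta>(a)\<close>, again
  up to the term with \<open>e\<^sup>-\<^sup>s\<^sup>T\<close>. It remains to know that, up to factors bounded above and below,
  \<open>q(a) + \<rho> \<phi>(a)\<close> has size \<open>\<tau> e\<^sup>-\<^sup>c\<^sup>L\<^sup>\<tau>\<close> for \<open>\<Psi>\<close> and \<open>\<tau> e\<^sup>c\<^sup>L\<^sup>\<tau>\<close> for \<open>\<Theta>\<close>. Then \<open>\<bar>I\<^sub>c(\<tau>)\<bar>\<close> lies between multiples of
  \<open>\<tau>\<^sup>\<mu> e\<^sup>-\<^sup>2\<^sup>c\<^sup>L\<^sup>\<tau>\<close> and \<open>e\<^sup>-\<^sup>2\<^sup>c\<^sup>L\<^sup>\<tau>\<close>, since \<open>G\<close> is bounded and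
  at least a multiple of \<open>\<tau>\<^sup>\<mu>\<close> by hypothesis, and the terms with \<open>e\<^sup>-\<^sup>s\<^sup>T\<close> are negligible
  because \<open>2 c L < T\<close>.

  The sizes come from an elementary fact about one interface (\<open>transmission_dominance\<close>,
  \<open>transmission_bounds\<close>): a decaying part that dominates on its right also dominates on its
  left, a growing part that dominates on its left also dominates on its right, and the dominant
  amplitude changes by a bounded factor. Followed through the layers
  from right to left (\<open>decaying_bounds\<close>) this also shows that \<open>\<Psi>\<close> exists and is unique for all \<open>z\<close>
  with \<open>Re z < 0\<close> (\<open>Psi_coefficients\<close>); followed from left to right (\<open>growing_bounds\<close>) it controls
  \<open>\<Theta>\<close>.

  The identity rests on the one-dimensional Sobolev theory developed first: integration by parts for
  primitives of integrable functions, the lemma of du Bois-Reymond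
  (\<open>has_weak_deriv_imp_primitive\<close>), and traces. The same lemma, applied in time to
  \<open>t \<mapsto> \<integral> u(t) \<phi>\<close>, recovers the value at time \<open>T\<close> from the distributional time derivative.
\<close>

section \<open>Almost everywhere equality for Lebesgue measure on an interval\<close>

lemma lebesgue_on_AE_iff:
  fixes S :: "real set"
  assumes "S \<in> sets lebesgue"
  shows "(AE x in lebesgue_on S. P x) \<longleftrightarrow> (AE x in lebesgue. x \<in> S \<longrightarrow> P x)"
  using assms by (simp add: AE_restrict_space_iff)

lemma measurable_ident_lebesgue_on [measurable]: "(\<lambda>x::real. x) \<in> borel_measurable (lebesgue_on S)"
  using id_borel_measurable_lebesgue_on[of S] by (simp add: id_def)

lemma borel_measurable_lebesgue_on_AE:
  fixes f g :: "real \<Rightarrow> 'b::euclidean_space"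
  assumes S: "S \<in> sets lebesgue" and f: "f \<in> borel_measurable (lebesgue_on S)"
    and ae: "AE x in lebesgue_on S. f x = g x"
  shows "g \<in> borel_measurable (lebesgue_on S)"
proof -
  have "(\<lambda>x. if x \<in> S then f x else 0) \<in> borel_measurable lebesgue"
    using f S by (simp add: borel_measurable_if)
  moreover have "AE x in lebesgue. (if x \<in> S then f x else 0) = (if x \<in> S then g x else 0)"
    using ae unfolding lebesgue_on_AE_iff[OF S] by eventually_elim auto
  ultimately have "(\<lambda>x. if x \<in> S then g x else 0) \<in> borel_measurable lebesgue"
    by (rule borel_measurable_AE)
  then show ?thesis
    using S by (simp add: borel_measurable_if)
qed

lemma integrable_lebesgue_on_AE:
  fixes f g :: "real \<Rightarrow> 'b::euclidean_space"
  assumes S: "S \<in> sets lebesgue" and f: "integrable (lebesgue_on S) f"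
    and ae: "AE x in lebesgue_on S. f x = g x"
  shows "integrable (lebesgue_on S) g"
  using integrable_cong_AE_imp[OF f borel_measurable_lebesgue_on_AE[OF S _ ae]] f ae
  by (auto elim: eventually_mono)

text \<open>No measurability is needed here: the Lebesgue measure is complete, so that two functions that
  agree almost everywhere are measurable together.\<close>

lemma integral_lebesgue_on_cong_AE:
  fixes f g :: "real \<Rightarrow> 'b::euclidean_space"
  assumes S: "S \<in> sets lebesgue" and ae: "AE x in lebesgue_on S. f x = g x"
  shows "integral\<^sup>L (lebesgue_on S) f = integral\<^sup>L (lebesgue_on S) g"
proof (cases "f \<in> borel_measurable (lebesgue_on S)")
  case True
  then show ?thesis
    using integral_cong_AE[OF True borel_measurable_lebesgue_on_AE[OF S True ae] ae] by simp
next
  case False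
  have "AE x in lebesgue_on S. g x = f x"
    using ae by eventually_elim simp
  then have "g \<notin> borel_measurable (lebesgue_on S)"
    using borel_measurable_lebesgue_on_AE[OF S, of g f] False by blast
  then show ?thesis
    using False by (metis borel_measurable_integrable not_integrable_integral_eq)
qed

lemma finite_measure_lebesgue_on_interval: "finite_measure (lebesgue_on {0<..<a::real})"
  using lmeasurable_interval(2)[of 0 a]
  by (intro finite_measureI) (auto simp: emeasure_restrict_space fmeasurable_def)

lemma integrable_bounded_on_interval:
  fixes f :: "real \<Rightarrow> 'b::euclidean_space"
  assumes "f \<in> borel_measurable (lebesgue_on {0<..<a::real})"
    and "\<And>x. x \<in> {0<..<a} \<Longrightarrow> norm (f x) \<le> B"
  shows "integrable (lebesgue_on {0<..<a}) f"
proof -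
  interpret finite_measure "lebesgue_on {0<..<a}"
    by (rule finite_measure_lebesgue_on_interval)
  show ?thesis
    by (rule integrable_const_bound[where B = B]) (use assms in auto)
qed

lemma continuous_on_bound_interval:
  fixes f :: "real \<Rightarrow> 'b::euclidean_space"
  assumes "continuous_on {0..a} f"
  obtains B where "B > 0" "\<And>x. x \<in> {0..a} \<Longrightarrow> norm (f x) \<le> B"
proof -
  have "bounded (f ` {0..a})"
    by (rule compact_imp_bounded[OF compact_continuous_image[OF assms]]) auto
  then obtain B where "B > 0" "\<forall>y\<in>f ` {0..a}. norm y \<le> B"
    unfolding bounded_pos by auto
  then show ?thesis using that by auto
qed

lemma measurable_continuous_on_interval:
  fixes f :: "real \<Rightarrow> 'b::euclidean_space"
  assumes "continuous_on {0..a} f"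
  shows "f \<in> borel_measurable (lebesgue_on {0<..<a})"
  by (rule continuous_imp_measurable_on_sets_lebesgue[OF continuous_on_subset[OF assms]]) auto

lemma integrable_mult_continuous:
  fixes f g :: "real \<Rightarrow> complex"
  assumes f: "integrable (lebesgue_on {0<..<a}) f" and g: "continuous_on {0..a} g"
  shows "integrable (lebesgue_on {0<..<a}) (\<lambda>x. f x * g x)"
proof -
  obtain B where B: "B > 0" "\<And>x. x \<in> {0..a} \<Longrightarrow> norm (g x) \<le> B"
    using continuous_on_bound_interval[OF g] by blast
  note [measurable] = measurable_continuous_on_interval[OF g] borel_measurable_integrable[OF f]
  show ?thesis
  proof (rule Bochner_Integration.integrable_bound[of _ "\<lambda>x. B * norm (f x)"])
    show "AE x in lebesgue_on {0<..<a}. norm (f x * g x) \<le> norm (B * norm (f x))"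
      using B by (intro AE_I2) (auto simp: norm_mult abs_mult mult.commute[of B] intro!: mult_left_mono)
  qed (use f in auto)
qed

lemma AE_interval_eq_continuous:
  fixes f g :: "real \<Rightarrow> complex"
  assumes f: "continuous_on {0..a} f" and g: "continuous_on {0..a} g" and a: "0 < a"
    and ae: "AE x in lebesgue_on {0<..<a}. f x = g x"
    and x: "x \<in> {0..a}"
  shows "f x = g x"
proof -
  let ?C = "{x \<in> {0..a}. f x - g x = 0}"
  have cl: "closed ?C"
    using continuous_closed_preimage_constant[of "{0..a}" "\<lambda>x. f x - g x" 0] f g
    by (auto intro: continuous_on_diff)
  have "AE x \<in> {0<..<a} in lebesgue. x \<in> ?C"
    using ae unfolding lebesgue_on_AE_iff[OF lmeasurable_interval(2)[THEN fmeasurableD]]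
    by eventually_elim auto
  then have "{0<..<a} \<subseteq> ?C"
    using mem_closed_if_AE_lebesgue_open[OF open_greaterThanLessThan cl] by blast
  then have "closure {0<..<a} \<subseteq> ?C"
    using cl closure_minimal by blast
  then show ?thesis
    using x a by auto
qed

section \<open>Primitives of integrable functions\<close>

text \<open>\<open>F\<close> is absolutely continuous on \<open>[0,a]\<close> with derivative \<open>f\<close>. The integral over \<open>]0,x[\<close> is written
  as one over \<open>]0,a[\<close>, the form that Fubini's theorem needs.\<close>

definition is_primitive :: "real \<Rightarrow> (real \<Rightarrow> complex) \<Rightarrow> (real \<Rightarrow> complex) \<Rightarrow> bool" where
  "is_primitive a F f \<longleftrightarrow> integrable (lebesgue_on {0<..<a}) f \<and>
     (\<forall>x\<in>{0..a}. F x = F 0 + (\<integral>y. indicator {..<x} y *\<^sub>R f y \<partial>lebesgue_on {0<..<a}))"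

lemma is_primitiveD:
  assumes "is_primitive a F f" "x \<in> {0..a}"
  shows "(\<integral>y. indicator {..<x} y *\<^sub>R f y \<partial>lebesgue_on {0<..<a}) = F x - F 0"
  using assms unfolding is_primitive_def by (metis add_diff_cancel_left')

lemma is_primitive_integrable: "is_primitive a F f \<Longrightarrow> integrable (lebesgue_on {0<..<a}) f"
  by (simp add: is_primitive_def)

lemma integrable_indicator_lessThan:
  fixes f :: "real \<Rightarrow> complex"
  assumes f: "integrable (lebesgue_on {0<..<a}) f"
  shows "integrable (lebesgue_on {0<..<a}) (\<lambda>y. indicator {..<x} y *\<^sub>R f y)"
proof (rule Bochner_Integration.integrable_bound[OF f])
  have [measurable]: "f \<in> borel_measurable (lebesgue_on {0<..<a})"
    using f by simp
  show "(\<lambda>y. indicator {..<x} y *\<^sub>R f y) \<in> borel_measurable (lebesgue_on {0<..<a})"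
    by measurable
qed (auto simp: indicator_def)

lemma integral_indicator_lessThan:
  fixes f :: "real \<Rightarrow> complex"
  assumes f: "integrable (lebesgue_on {0<..<a}) f" and x: "x \<in> {0..a}"
  shows "f integrable_on {0..x}"
    and "(\<integral>y. indicator {..<x} y *\<^sub>R f y \<partial>lebesgue_on {0<..<a}) = integral {0..x} f"
proof -
  let ?h = "\<lambda>y. indicator {..<x} y *\<^sub>R f y"
  have ih: "integrable (lebesgue_on {0<..<a}) ?h"
    by (rule integrable_indicator_lessThan[OF f])
  have hi: "(?h has_integral integral\<^sup>L (lebesgue_on {0<..<a}) ?h) {0<..<a}"
    using has_integral_integral_lebesgue_on[OF ih] by auto
  have "((\<lambda>y. if y \<in> {0<..<x} then f y else 0) has_integral integral\<^sup>L (lebesgue_on {0<..<a}) ?h) {0<..<a}"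
    using has_integral_cong[THEN iffD1, OF _ hi, of "\<lambda>y. if y \<in> {0<..<x} then f y else 0"]
    by (auto simp: indicator_def)
  then have "(f has_integral integral\<^sup>L (lebesgue_on {0<..<a}) ?h) {0<..<x}"
    using x by (subst (asm) has_integral_restrict) auto
  then have "(f has_integral integral\<^sup>L (lebesgue_on {0<..<a}) ?h) {0..x}"
    by (simp add: has_integral_Icc_iff_Ioo)
  then show "f integrable_on {0..x}"
    "(\<integral>y. indicator {..<x} y *\<^sub>R f y \<partial>lebesgue_on {0<..<a}) = integral {0..x} f"
    by (auto simp: integral_unique has_integral_integrable)
qed

lemma is_primitive_continuous:
  assumes "is_primitive a F f" 
  shows "continuous_on {0..a} F"
proof (cases "0 \<le> a")
  case True
  have f: "integrable (lebesgue_on {0<..<a}) f" using assms by (simp add: is_primitive_def)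
  have "continuous_on {0..a} (\<lambda>x. F 0 + integral {0..x} f)"
    using True integral_indicator_lessThan(1)[OF f, of a]
    by (intro continuous_intros indefinite_integral_continuous_1) auto
  moreover have "F 0 + integral {0..x} f = F x" if "x \<in> {0..a}" for x
    using is_primitiveD[OF assms that] integral_indicator_lessThan(2)[OF f that] by simp
  ultimately show ?thesis
    by (rule continuous_on_eq)
qed auto

lemma is_primitive_integral:
  assumes "is_primitive a F f" "0 \<le> a"
  shows "F a = F 0 + integral\<^sup>L (lebesgue_on {0<..<a}) f"
proof -
  have "(\<integral>y. indicator {..<a} y *\<^sub>R f y \<partial>lebesgue_on {0<..<a}) = integral\<^sup>L (lebesgue_on {0<..<a}) f"
    by (rule Bochner_Integration.integral_cong) auto
  then show ?thesis using is_primitiveD[OF assms(1), of a] assms(2) by (simp add: algebra_simps)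
qed

lemma is_primitive_vector_derivative:
  fixes F f :: "real \<Rightarrow> complex"
  assumes f: "integrable (lebesgue_on {0<..<a}) f" and F: "continuous_on {0..a} F"
    and S: "finite S" and d: "\<And>x. x \<in> {0<..<a} - S \<Longrightarrow> (F has_vector_derivative f x) (at x)"
  shows "is_primitive a F f"
  unfolding is_primitive_def
proof (intro conjI ballI f)
  fix x assume x: "x \<in> {0..a}"
  have "(f has_integral (F x - F 0)) {0..x}"
    by (rule fundamental_theorem_of_calculus_interior_strong[OF S])
      (use x d in \<open>auto intro: continuous_on_subset[OF F]\<close>)
  then show "F x = F 0 + (\<integral>y. indicator {..<x} y *\<^sub>R f y \<partial>lebesgue_on {0<..<a})"
    using integral_indicator_lessThan(2)[OF f x] by (simp add: integral_unique)
qed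

lemma primitive_exists:
  assumes "integrable (lebesgue_on {0<..<a}) f" 
  shows "is_primitive a (\<lambda>x. c + (\<integral>y. indicator {..<x} y *\<^sub>R f y \<partial>lebesgue_on {0<..<a})) f"
proof -
  have "(\<integral>y. indicator {..<0} y *\<^sub>R f y \<partial>lebesgue_on {0<..<a}) = 
     (\<integral>y. 0 \<partial>lebesgue_on {0<..<a})"
    by (rule Bochner_Integration.integral_cong) auto
  then show ?thesis using assms by (simp add: is_primitive_def)
qed

text \<open>Integration by parts for absolutely continuous functions, from Fubini's theorem for
  \<open>f(x) g(y)\<close> on the triangle \<open>x < y\<close>.\<close>

theorem primitive_by_parts:
  assumes F: "is_primitive a F f" and G: "is_primitive a G g" and a: "0 \<le> a"
  shows "(\<integral>x. f x * G x \<partial>lebesgue_on {0<..<a}) + (\<integral>x. F x * g x \<partial>lebesgue_on {0<..<a})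
    = F a * G a - F 0 * G 0"
proof -
  let ?M = "lebesgue_on {0<..<a}"
  have f: "integrable ?M f" and g: "integrable ?M g" 
    using F G is_primitive_integrable by auto
  have [measurable]: "f \<in> borel_measurable ?M" "g \<in> borel_measurable ?M" 
    using f g by auto
  interpret finite_measure ?M by (rule finite_measure_lebesgue_on_interval)
  interpret pair_sigma_finite ?M ?M ..
  let ?k = "\<lambda>x y. indicator {..<y} x *\<^sub>R (f x * g y)"
  have prod: "integrable (?M \<Otimes>\<^sub>M ?M) (\<lambda>(x,y). f x * g y)"
  proof (rule Fubini_integrable)
    show "integrable ?M (\<lambda>x. \<integral>y. norm (case (x, y) of (x, y) \<Rightarrow> f x * g y) \<partial>?M)"
      using f by (auto simp: norm_mult)
  qed (use g in auto)
  have kk: "(\<lambda>(x,y). ?k x y) = (\<lambda>z. if fst z < snd z then f (fst z) * g (snd z) else 0)"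
    by (auto simp: fun_eq_iff indicator_def)
  have [measurable]: "(\<lambda>(x,y). ?k x y) \<in> borel_measurable (?M \<Otimes>\<^sub>M ?M)"
    unfolding kk by measurable
  have k: "integrable (?M \<Otimes>\<^sub>M ?M) (\<lambda>(x,y). ?k x y)"
    by (rule Bochner_Integration.integrable_bound[OF prod]) (auto simp: indicator_def)
  have eqF: "(\<integral>x. indicator {..<y} x *\<^sub>R f x \<partial>?M) = F y - F 0" if "y \<in> {0<..<a}" for y
    using is_primitiveD[OF F] that by auto
  have eqG: "(\<integral>y. indicator {..<x} y *\<^sub>R g y \<partial>?M) = G x - G 0" if "x \<in> {0<..<a}" for x
    using is_primitiveD[OF G] that by auto
  have cF: "continuous_on {0..a} F" and cG: "continuous_on {0..a} G" 
    using F G is_primitive_continuous by auto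
  have iFg: "integrable ?M (\<lambda>x. F x * g x)" and ifG: "integrable ?M (\<lambda>x. f x * G x)"
    using integrable_mult_continuous[OF g cF] integrable_mult_continuous[OF f cG]
    by (auto simp: mult.commute)
  have "(\<integral>y. (\<integral>x. ?k x y \<partial>?M) \<partial>?M) = (\<integral>y. (F y - F 0) * g y \<partial>?M)"
  proof (rule Bochner_Integration.integral_cong[OF refl])
    fix y assume "y \<in> space ?M"
    then have y: "y \<in> {0<..<a}" by simp
    have "(\<integral>x. ?k x y \<partial>?M) = (\<integral>x. (indicator {..<y} x *\<^sub>R f x) * g y \<partial>?M)"
      by simp
    also have "\<dots> = (F y - F 0) * g y"
      unfolding eqF[OF y, symmetric] by (rule integral_mult_left_zero)
    finally show "(\<integral>x. ?k x y \<partial>?M) = (F y - F 0) * g y" .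
  qed
  also have "\<dots> = (\<integral>x. F x * g x \<partial>?M) - F 0 * integral\<^sup>L ?M g"
    using iFg g by (simp add: left_diff_distrib)
  finally have 1: "(\<integral>y. (\<integral>x. ?k x y \<partial>?M) \<partial>?M) = (\<integral>x. F x * g x \<partial>?M) - F 0 * integral\<^sup>L ?M g" .
  have "(\<integral>x. (\<integral>y. ?k x y \<partial>?M) \<partial>?M) = (\<integral>x. f x * (G a - G x) \<partial>?M)"
  proof (rule Bochner_Integration.integral_cong[OF refl])
    fix x assume "x \<in> space ?M"
    then have x: "x \<in> {0<..<a}" by simp
    have "(\<integral>y. ?k x y \<partial>?M) = (\<integral>y. f x * (g y - indicator {..<x} y *\<^sub>R g y) \<partial>?M)"
    proof (rule integral_lebesgue_on_cong_AE)
      have "AE y in lebesgue. y \<noteq> x" 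
        by (rule AE_I'[of "{x}"]) auto
      then show "AE y in ?M. ?k x y = f x * (g y - indicator {..<x} y *\<^sub>R g y)"
        by (subst lebesgue_on_AE_iff) (auto elim!: eventually_mono simp: indicator_def)
    qed auto
    also have "\<dots> = f x * (integral\<^sup>L ?M g - (\<integral>y. indicator {..<x} y *\<^sub>R g y \<partial>?M))"
      unfolding integral_mult_right_zero
      by (subst Bochner_Integration.integral_diff[OF g integrable_indicator_lessThan[OF g]]) simp
    also have "\<dots> = f x * (G a - G x)"
      using eqG[OF x] is_primitive_integral[OF G a] by simp
    finally show "(\<integral>y. ?k x y \<partial>?M) = f x * (G a - G x)" .
  qed
  also have "\<dots> = G a * integral\<^sup>L ?M f - (\<integral>x. f x * G x \<partial>?M)"
    using ifG f by (simp add: right_diff_distrib)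
  finally have 2: "(\<integral>x. (\<integral>y. ?k x y \<partial>?M) \<partial>?M) = G a * integral\<^sup>L ?M f - (\<integral>x. f x * G x \<partial>?M)" .
  have "(\<integral>x. F x * g x \<partial>?M) - F 0 * integral\<^sup>L ?M g = G a * integral\<^sup>L ?M f - (\<integral>x. f x * G x \<partial>?M)"
    using Fubini_integral[OF k] 1 2 by simp
  then show ?thesis
    using is_primitive_integral[OF F a] is_primitive_integral[OF G a] 
    by (simp add: algebra_simps) 
qed

section \<open>Weak derivatives on an interval\<close>

lemma has_real_derivative_pos_part_square:
  "((\<lambda>y::real. (max 0 y)\<^sup>2) has_real_derivative 2 * max 0 x) (at x)"
proof (cases "x = 0")
  case True
  have "((\<lambda>y::real. (max 0 y)\<^sup>2 / y) \<longlongrightarrow> 0) (at 0)"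
  proof (rule Lim_null_comparison)
    show "\<forall>\<^sub>F y in at 0. norm ((max 0 y)\<^sup>2 / y) \<le> \<bar>y\<bar>"
      by (rule always_eventually) (auto simp: max_def power2_eq_square)
  qed (auto intro!: tendsto_eq_intros)
  then show ?thesis
    using True by (simp add: has_field_derivative_iff)
next
  case False
  show ?thesis
  proof (cases "x > 0")
    case True
    have "((\<lambda>y::real. y\<^sup>2) has_real_derivative 2 * x) (at x)"
      by (auto intro!: derivative_eq_intros)
    then have "((\<lambda>y::real. (max 0 y)\<^sup>2) has_real_derivative 2 * x) (at x)"
      by (rule has_field_derivative_transform_within_open[of _ _ _ "{0<..}"]) (use True in auto)
    then show ?thesis using True by simp
  next
    case neg: False
    have "((\<lambda>y::real. 0) has_real_derivative 0) (at x)"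
      by simp
    then have "((\<lambda>y::real. (max 0 y)\<^sup>2) has_real_derivative 0) (at x)"
      by (rule has_field_derivative_transform_within_open[of _ _ _ "{..<0}"]) (use neg False in auto)
    then show ?thesis using neg by simp
  qed
qed

lemma test_functionI:
  assumes "\<And>x. (\<theta> has_real_derivative \<theta>' x) (at x)" "continuous_on UNIV \<theta>'"
    and "\<And>x. x \<notin> {p..q} \<Longrightarrow> \<theta> x = 0" "{p..q} \<subseteq> S"
  shows "test_function S \<theta>"
proof -
  have "{x. \<theta> x \<noteq> 0} \<subseteq> {p..q}"
    using assms(3) by blast
  then have "closure {x. \<theta> x \<noteq> 0} \<subseteq> {p..q}"
    by (simp add: closure_minimal)
  moreover from this have "compact (closure {x. \<theta> x \<noteq> 0})"
    by (meson bounded_closed_interval bounded_subset closed_closure compact_eq_bounded_closed)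
  moreover have "\<theta> C1_differentiable_on UNIV"
    unfolding C1_differentiable_on_def
    using assms(1,2) by (auto simp flip: has_real_derivative_iff_has_vector_derivative)
  ultimately show ?thesis
    using assms(4) by (auto simp: test_function_def)
qed

lemma test_functionE:
  assumes "test_function {0<..<a} \<theta>" 
  obtains "\<And>x. (\<theta> has_real_derivative deriv \<theta> x) (at x)" "continuous_on UNIV (deriv \<theta>)"
     "\<And>x. x \<notin> {0<..<a} \<Longrightarrow> \<theta> x = 0"
proof -
  obtain D where D: "\<And>x. (\<theta> has_real_derivative D x) (at x)" "continuous_on UNIV D"
    using assms unfolding test_function_def C1_differentiable_on_def
    by (auto simp flip: has_real_derivative_iff_has_vector_derivative)
  then have "D = deriv \<theta>"
    by (intro ext) (metis DERIV_imp_deriv)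
  moreover have "\<theta> x = 0" if "x \<notin> {0<..<a}" for x
    using assms that closure_subset[of "{x. \<theta> x \<noteq> 0}"] unfolding test_function_def by blast
  ultimately show ?thesis using that D by blast
qed

text \<open>A nonnegative function that is positive exactly on \<open>]p,q[\<close>; the square makes it continuously
  differentiable.\<close>

definition bump :: "real \<Rightarrow> real \<Rightarrow> real \<Rightarrow> real" where
  "bump p q x = (max 0 ((x - p) * (q - x)))\<^sup>2"

lemma bump_derivative:
  "(bump p q has_real_derivative 2 * max 0 ((x - p) * (q - x)) * (p + q - 2 * x)) (at x)"
proof -
  have 1: "((\<lambda>x. (x - p) * (q - x)) has_real_derivative (p + q - 2 * x)) (at x)"
    by (auto intro!: derivative_eq_intros simp: algebra_simps)
  show ?thesis
    using DERIV_chain2[OF has_real_derivative_pos_part_square 1]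
    unfolding bump_def[abs_def] by simp
qed

lemma bump_nonneg: "bump p q x \<ge> 0"
  by (simp add: bump_def)

lemma bump_pos_iff: "p < q \<Longrightarrow> bump p q x > 0 \<longleftrightarrow> x \<in> {p<..<q}"
proof -
  assume "p < q"
  have "bump p q x > 0 \<longleftrightarrow> (x - p) * (q - x) > 0"
    unfolding bump_def zero_less_power2 by (simp only: max_def split: if_split) linarith
  also have "\<dots> \<longleftrightarrow> x \<in> {p<..<q}"
    using \<open>p < q\<close> by (auto simp: zero_less_mult_iff)
  finally show ?thesis .
qed

lemma bump_eq_0: "p < q \<Longrightarrow> x \<notin> {p<..<q} \<Longrightarrow> bump p q x = 0"
  using bump_pos_iff[of p q x] bump_nonneg[of p q x] by linarith

lemma test_function_bump:
  assumes "p < q" "0 < p" "q < a"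
  shows "test_function {0<..<a} (bump p q)"
  by (rule test_functionI[OF bump_derivative, of _ _ p q])
    (use assms bump_eq_0 in \<open>auto intro!: continuous_intros\<close>)

lemma continuous_on_bump: "continuous_on A (bump p q)"
  unfolding bump_def[abs_def] by (intro continuous_intros)

text \<open>As \<open>e\<close> decreases to 0, these test functions increase to the indicator function of \<open>]p,q[\<close>.\<close>

lemma test_function_bump_ratio:
  assumes "p < q" "0 < p" "q < a" "e > 0"
  shows "test_function {0<..<a} (\<lambda>x. bump p q x / (bump p q x + e))"
proof (rule test_functionI[of _ "\<lambda>x. e * (2 * max 0 ((x - p) * (q - x)) * (p + q - 2 * x)) / (bump p q x + e)\<^sup>2" p q])
  have nz: "bump p q x + e \<noteq> 0" for x
    using bump_nonneg[of p q x] assms by linarith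
  show "((\<lambda>x. bump p q x / (bump p q x + e)) has_real_derivative
     e * (2 * max 0 ((x - p) * (q - x)) * (p + q - 2 * x)) / (bump p q x + e)\<^sup>2) (at x)" for x
    using nz[of x] by (auto intro!: derivative_eq_intros bump_derivative simp: algebra_simps power2_eq_square)
  show "continuous_on UNIV (\<lambda>x. e * (2 * max 0 ((x - p) * (q - x)) * (p + q - 2 * x)) / (bump p q x + e)\<^sup>2)"
    using nz by (intro continuous_intros continuous_on_bump) auto
qed (use assms bump_eq_0 in auto)

text \<open>The fundamental lemma of the calculus of variations.\<close>

lemma AE_zero_if_integral_test_function:
  fixes k :: "real \<Rightarrow> complex"
  assumes k: "integrable (lebesgue_on {0<..<a}) k"
    and zero: "\<And>\<theta>. test_function {0<..<a} \<theta> \<Longrightarrow> (\<integral>x. k x * of_real (\<theta> x) \<partial>lebesgue_on {0<..<a}) = 0"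
  shows "AE x in lebesgue_on {0<..<a}. k x = 0"
proof -
  let ?M = "lebesgue_on {0<..<a}"
  have Ioo: "(\<integral>x. of_real (indicator {p<..<q} x) * k x \<partial>?M) = 0" if pq: "p < q" "0 < p" "q < a" for p q
  proof -
    let ?t = "\<lambda>n x. bump p q x / (bump p q x + 1 / real (Suc n))"
    have [measurable]: "k \<in> borel_measurable ?M" using k by simp
    have "(\<lambda>n. \<integral>x. k x * of_real (?t n x) \<partial>?M) \<longlonglongrightarrow> (\<integral>x. of_real (indicator {p<..<q} x) * k x \<partial>?M)"
    proof (rule integral_dominated_convergence[where w = "\<lambda>x. norm (k x)"])
      show "AE x in ?M. (\<lambda>n. k x * of_real (?t n x)) \<longlonglongrightarrow> of_real (indicator {p<..<q} x) * k x"
      proof (rule AE_I2)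
        fix x
        show "(\<lambda>n. k x * of_real (?t n x)) \<longlonglongrightarrow> of_real (indicator {p<..<q} x) * k x"
        proof (cases "x \<in> {p<..<q}")
          case True
          then have "bump p q x > 0" using pq bump_pos_iff by blast
          then have "(\<lambda>n. ?t n x) \<longlonglongrightarrow> bump p q x / (bump p q x + 0)"
            by (intro tendsto_intros lim_const_over_n LIMSEQ_Suc[OF lim_const_over_n]) auto
          then have "(\<lambda>n. k x * of_real (?t n x)) \<longlonglongrightarrow> k x * of_real 1"
            using \<open>bump p q x > 0\<close> by (intro tendsto_intros) auto
          then show ?thesis using True by simp
        qed (use bump_eq_0[OF \<open>p < q\<close>] in simp)
      qed
      show "AE x in ?M. norm (k x * of_real (?t n x)) \<le> norm (k x)" for n
      proof (rule AE_I2)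
        fix x
        have "\<bar>?t n x\<bar> \<le> 1" 
          using bump_nonneg[of p q x] by (simp add: divide_le_eq add_nonneg_pos)
        then show "norm (k x * of_real (?t n x)) \<le> norm (k x)"
          unfolding norm_mult norm_of_real using mult_left_mono[of "\<bar>?t n x\<bar>" 1 "norm (k x)"] by simp
      qed
      show "(\<lambda>x. k x * of_real (?t n x)) \<in> borel_measurable ?M" for n
        unfolding bump_def by measurable
    qed (use k in auto)
    moreover have "(\<integral>x. k x * of_real (?t n x) \<partial>?M) = 0" for n
      by (rule zero[OF test_function_bump_ratio]) (use pq in auto)
    ultimately show ?thesis
      by (simp add: LIMSEQ_const_iff)
  qed
  define K where "K = (\<lambda>x. if x \<in> {0<..<a} then k x else 0)"
  have K: "integrable lebesgue K"
    using Lebesgue_Measure.integrable_restrict_UNIV[of "{0<..<a}" k] k by (simp add: K_def)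
  have Kint: "K integrable_on cbox p q" for p q
    using K by (meson integrable_on_lebesgue integrable_on_subcbox subset_UNIV)
  have K0: "integral (cbox p q) K = 0" if pq: "p < q" "0 < p" "q < a" for p q
  proof -
    have "integral (cbox p q) K = integral UNIV (\<lambda>x. if x \<in> {p..q} then K x else 0)"
      using Henstock_Kurzweil_Integration.integral_restrict_UNIV[of "{p..q}" K] by simp
    also have "\<dots> = integral {0<..<a} (\<lambda>x. if x \<in> {p..q} then k x else 0)"
      by (subst (2) Henstock_Kurzweil_Integration.integral_restrict_UNIV[symmetric], rule Henstock_Kurzweil_Integration.integral_cong) (use pq in \<open>auto simp: K_def\<close>)
    also have "\<dots> = integral {0<..<a} (\<lambda>x. of_real (indicator {p<..<q} x) * k x)"
      by (rule integral_spike[of "{p, q}"]) (auto simp: indicator_def)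
    also have "\<dots> = (\<integral>x. of_real (indicator {p<..<q} x) * k x \<partial>?M)"
    proof (rule lebesgue_integral_eq_integral[symmetric])
      have [measurable]: "k \<in> borel_measurable ?M" using k by simp
      show "integrable ?M (\<lambda>x. of_real (indicator {p<..<q} x) * k x)"
        by (rule Bochner_Integration.integrable_bound[OF k]) (auto simp: indicator_def)
    qed auto
    finally show ?thesis using Ioo[OF pq] by simp
  qed
  \<comment> \<open>By Lebesgue's differentiation theorem, \<open>K\<close> is almost everywhere the limit of its means.\<close>
  obtain N where N: "negligible N" and diff: "\<And>x e. x \<notin> N \<Longrightarrow> 0 < e \<Longrightarrow> \<exists>d>0. \<forall>h. 0 < h \<and> h < d \<longrightarrow>
        norm (integral (cbox x (x + h *\<^sub>R One)) K /\<^sub>R h ^ DIM(real) - K x) < e"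
    using integrable_ccontinuous_explicit[OF Kint] by metis
  have "K x = 0" if xN: "x \<notin> N" "x \<in> {0<..<a}" for x
  proof (rule ccontr)
    assume "K x \<noteq> 0"
    then obtain d where d: "d > 0" "\<And>h. 0 < h \<Longrightarrow> h < d \<Longrightarrow>
       norm (integral (cbox x (x + h *\<^sub>R One)) K /\<^sub>R h ^ DIM(real) - K x) < norm (K x)"
      using diff[OF xN(1), of "norm (K x)"] by auto
    define h where "h = min (d/2) ((a - x)/2)"
    have h: "0 < h" "h < d" "x + h < a" using d(1) xN(2) by (auto simp: h_def min_def field_simps)
    then show False 
      using d(2)[OF h(1,2)] K0[of x "x + h"] xN by simp
  qed
  moreover have "AE x in lebesgue. x \<notin> N"
    using N AE_not_in negligible_iff_null_sets by blast
  ultimately show ?thesis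
    by (subst lebesgue_on_AE_iff) (auto elim!: eventually_mono simp: K_def)
qed

lemma continuous_on_deriv_test_function:
  "test_function {0<..<a} \<theta> \<Longrightarrow> continuous_on A (deriv \<theta>)"
  using test_functionE[of a \<theta>] continuous_on_subset by blast

lemma continuous_on_test_function:
  assumes "test_function {0<..<a} \<theta>" shows "continuous_on A \<theta>"
proof -
  obtain "\<And>x. (\<theta> has_real_derivative deriv \<theta> x) (at x)"
    using test_functionE[OF assms] by blast
  then show ?thesis
    by (meson DERIV_isCont continuous_at_imp_continuous_on)
qed

lemma is_primitive_test_function:
  assumes "test_function {0<..<a} \<theta>"
  shows "is_primitive a (\<lambda>x. of_real (\<theta> x)) (\<lambda>x. of_real (deriv \<theta> x))"
proof -
  obtain d: "\<And>x. (\<theta> has_real_derivative deriv \<theta> x) (at x)" and c: "continuous_on UNIV (deriv \<theta>)"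
    using test_functionE[OF assms] by blast
  have cc: "continuous_on {0..a} (\<lambda>x. complex_of_real (deriv \<theta> x))"
    by (intro continuous_intros continuous_on_subset[OF c]) auto
  obtain B where B: "\<And>x. x \<in> {0..a} \<Longrightarrow> norm (complex_of_real (deriv \<theta> x)) \<le> B"
    using continuous_on_bound_interval[OF cc] by blast
  show ?thesis
  proof (rule is_primitive_vector_derivative[of _ _ _ "{}"])
    show "integrable (lebesgue_on {0<..<a}) (\<lambda>x. complex_of_real (deriv \<theta> x))"
      by (rule integrable_bounded_on_interval[OF measurable_continuous_on_interval[OF cc], of B])
        (use B in auto)
    show "continuous_on {0..a} (\<lambda>x. complex_of_real (\<theta> x))"
      by (intro continuous_intros continuous_on_test_function[OF assms])
    show "((\<lambda>x. complex_of_real (\<theta> x)) has_vector_derivative complex_of_real (deriv \<theta> x)) (at x)" for x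
      using d[of x] by (auto intro!: derivative_eq_intros simp: has_real_derivative_iff_has_vector_derivative)
  qed auto
qed

lemma is_primitive_imp_has_weak_deriv:
  assumes F: "is_primitive a F f" and a: "0 < a"
  shows "has_weak_deriv {0<..<a} F f"
  unfolding has_weak_deriv_def
proof (intro allI impI)
  fix \<theta> assume t: "test_function {0<..<a} \<theta>"
  then have "\<theta> 0 = 0" "\<theta> a = 0" 
    using test_functionE[OF t] by auto
  then show "(\<integral>x. F x * complex_of_real (deriv \<theta> x) \<partial>lebesgue_on {0<..<a}) =
       - (\<integral>x. f x * complex_of_real (\<theta> x) \<partial>lebesgue_on {0<..<a})"
    using primitive_by_parts[OF F is_primitive_test_function[OF t]] a
    by (simp add: eq_neg_iff_add_eq_0 add.commute)
qed

text \<open>A function with mean value zero is the derivative of a test function.\<close>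

lemma test_function_antiderivative:
  assumes t: "test_function {0<..<a} \<eta>"
    and zero: "(\<integral>x. complex_of_real (\<eta> x) \<partial>lebesgue_on {0<..<a}) = 0" and a: "0 < a"
  obtains X where "test_function {0<..<a} X" "deriv X = \<eta>"
proof -
  let ?K = "closure {x. \<eta> x \<noteq> 0}"
  have K: "compact ?K" "?K \<subseteq> {0<..<a}" using t by (auto simp: test_function_def)
  obtain p q where pq: "0 < p" "p < q" "q < a" "?K \<subseteq> {p..q}"
  proof (cases "?K = {}")
    case True
    then show ?thesis using that[of "a/3" "a/2"] a by auto
  next
    case False
    obtain x y where xy: "x \<in> ?K" "\<And>z. z \<in> ?K \<Longrightarrow> x \<le> z" "y \<in> ?K" "\<And>z. z \<in> ?K \<Longrightarrow> z \<le> y"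
      using compact_attains_inf[OF K(1) False] compact_attains_sup[OF K(1) False] by blast
    have "0 < x" "x \<le> y" "y < a"
      using subsetD[OF K(2) xy(1)] xy(2)[OF xy(3)] subsetD[OF K(2) xy(3)] by auto
    moreover have "?K \<subseteq> {x..(y + a)/2}"
    proof
      fix z assume "z \<in> ?K"
      then show "z \<in> {x..(y + a)/2}"
        using xy(2)[of z] xy(4)[of z] \<open>y < a\<close> by auto
    qed
    ultimately show ?thesis
      using that[of x "(y + a)/2"] by auto
  qed
  have c: "continuous_on UNIV \<eta>"
    by (rule continuous_on_test_function[OF t])
  have out: "\<eta> x = 0" if "x \<notin> {p..q}" for x
    using that pq(4) closure_subset[of "{x. \<eta> x \<noteq> 0}"] by blast
  have out': "\<eta> x = 0" if "x \<le> p \<or> q \<le> x" for x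
  proof -
    have cl: "closed {x. \<eta> x = 0}"
      using c by (intro closed_Collect_eq) auto
    have "{..<p} \<union> {q<..} \<subseteq> {x. \<eta> x = 0}" using out by auto
    then have "closure ({..<p} \<union> {q<..}) \<subseteq> {x. \<eta> x = 0}"
      using cl by (rule closure_minimal)
    then show ?thesis using that by auto
  qed
  obtain X0 where "\<And>x. (X0 has_vector_derivative \<eta> x) (at x)"
    using einterval_antiderivative[of "-\<infinity>" \<infinity> \<eta>] c by (auto simp: continuous_on_eq_continuous_at)
  define X where "X x = X0 x - X0 0" for x
  have d: "(X has_real_derivative \<eta> x) (at x)" for x
    unfolding X_def[abs_def] has_real_derivative_iff_has_vector_derivative 
    by (auto intro!: derivative_eq_intros \<open>(X0 has_vector_derivative \<eta> x) (at x)\<close>)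
  have left: "X x = 0" if "x \<le> p" for x
  proof -
    have "\<exists>c. \<forall>y\<in>{..p}. X y = c"
      by (rule has_field_derivative_zero_constant) 
        (use has_field_derivative_at_within[OF d] out' in \<open>auto, metis\<close>)
    moreover have "X 0 = 0" by (simp add: X_def)
    ultimately show ?thesis using that pq by force
  qed
  have X: "continuous_on {0..a} X"
    using d by (meson DERIV_isCont continuous_at_imp_continuous_on)
  have P: "is_primitive a (\<lambda>x. complex_of_real (X x)) (\<lambda>x. complex_of_real (\<eta> x))"
  proof (rule is_primitive_vector_derivative[of _ _ _ "{}"])
    have "integrable (lebesgue_on {0<..<a}) (\<lambda>x. 1::complex)"
      using finite_measure_lebesgue_on_interval by (simp add: finite_measure.integrable_const)
    from integrable_mult_continuous[OF this, of "\<lambda>x. complex_of_real (\<eta> x)"]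
    show "integrable (lebesgue_on {0<..<a}) (\<lambda>x. complex_of_real (\<eta> x))"
      using continuous_on_test_function[OF t] by (auto intro!: continuous_intros)
    show "((\<lambda>x. complex_of_real (X x)) has_vector_derivative complex_of_real (\<eta> x)) (at x)" for x
      using d[of x] by (auto intro!: derivative_eq_intros simp: has_real_derivative_iff_has_vector_derivative)
  qed (auto intro!: continuous_intros X)
  have right: "X x = 0" if "x \<ge> q" for x
  proof -
    have "\<exists>c. \<forall>y\<in>{q..}. X y = c"
      by (rule has_field_derivative_zero_constant) 
        (use has_field_derivative_at_within[OF d] out' in \<open>auto, metis\<close>)
    moreover have "X a = 0"
      using is_primitive_integral[OF P] a zero left[of 0] pq by simp
    ultimately show ?thesis using that pq by force
  qed
  have "test_function {0<..<a} X"
    by (rule test_functionI[OF d c, of p q]) (use left right pq in auto)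
  moreover have "deriv X = \<eta>" using d by (intro ext DERIV_imp_deriv)
  ultimately show ?thesis by (rule that)
qed

lemma integrable_mult_test_function:
  assumes "integrable (lebesgue_on {0<..<a}) f" "test_function {0<..<a} \<theta>"
  shows "integrable (lebesgue_on {0<..<a}) (\<lambda>x. f x * complex_of_real (\<theta> x))"
    "integrable (lebesgue_on {0<..<a}) (\<lambda>x. f x * complex_of_real (deriv \<theta> x))"
  by (intro integrable_mult_continuous[OF assms(1)] continuous_on_of_real
      continuous_on_test_function[OF assms(2)] continuous_on_deriv_test_function[OF assms(2)])+

text \<open>The lemma of du Bois-Reymond: the difference of \<open>f\<close> and a primitive of \<open>g\<close> has weak derivative
  0, hence is constant.\<close>

theorem has_weak_deriv_imp_primitive:
  assumes f: "integrable (lebesgue_on {0<..<a}) f" and g: "integrable (lebesgue_on {0<..<a}) g"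
    and w: "has_weak_deriv {0<..<a} f g" and a: "0 < a"
  obtains F where "is_primitive a F g" "AE x in lebesgue_on {0<..<a}. F x = f x"
proof -
  let ?M = "lebesgue_on {0<..<a}"
  define G where "G x = 0 + (\<integral>y. indicator {..<x} y *\<^sub>R g y \<partial>?M)" for x
  have G: "is_primitive a G g"
    unfolding G_def[abs_def] by (rule primitive_exists[OF g])
  have iG: "integrable ?M G"
    using integrable_mult_continuous[of a "\<lambda>_. 1" G] is_primitive_continuous[OF G] finite_measure_lebesgue_on_interval
    by (auto simp: finite_measure.integrable_const)
  define k where "k x = f x - G x" for x
  have k: "integrable ?M k" unfolding k_def[abs_def] using f iG by auto
  have k0: "(\<integral>x. k x * of_real (deriv \<theta> x) \<partial>?M) = 0" if "test_function {0<..<a} \<theta>" for \<theta>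
  proof -
    have "(\<integral>x. k x * of_real (deriv \<theta> x) \<partial>?M) 
      = (\<integral>x. f x * of_real (deriv \<theta> x) \<partial>?M) - (\<integral>x. G x * of_real (deriv \<theta> x) \<partial>?M)"
      unfolding k_def left_diff_distrib
      by (intro Bochner_Integration.integral_diff integrable_mult_test_function f iG that)
    then show ?thesis
      using w is_primitive_imp_has_weak_deriv[OF G a] that by (auto simp: has_weak_deriv_def)
  qed
  define \<psi> where "\<psi> = bump (a/4) (3*a/4)"
  have \<psi>: "test_function {0<..<a} \<psi>" 
    unfolding \<psi>_def by (rule test_function_bump) (use a in auto)
  have one: "integrable ?M (\<lambda>x. 1::complex)"
    using finite_measure_lebesgue_on_interval by (simp add: finite_measure.integrable_const)
  define I where "I \<theta> = (\<integral>x. complex_of_real (\<theta> x) \<partial>?M)" for \<theta>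
  have Ir: "I \<theta> = of_real (\<integral>x. \<theta> x \<partial>?M)" for \<theta>
    by (simp add: I_def)
  have \<psi>int: "integrable ?M \<psi>"
    using integrable_mult_test_function(1)[OF one \<psi>] by (simp add: complex_of_real_integrable_eq)
  have "(\<integral>x. \<psi> x \<partial>?M) \<noteq> 0"
  proof
    assume "(\<integral>x. \<psi> x \<partial>?M) = 0"
    then have "AE x in ?M. \<psi> x = 0"
      using integral_nonneg_eq_0_iff_AE[OF \<psi>int] bump_nonneg by (auto simp: \<psi>_def)
    then have "AE x in ?M. complex_of_real (\<psi> x) = 0" by simp
    from AE_interval_eq_continuous[OF _ _ a this, of "a/2"] 
    have "\<psi> (a/2) = 0" using a by (auto simp: \<psi>_def intro!: continuous_intros continuous_on_bump)
    then show False using bump_pos_iff[of "a/4" "3*a/4" "a/2"] a by (auto simp: \<psi>_def)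
  qed
  then have I\<psi>: "I \<psi> \<noteq> 0" by (simp add: Ir)
  define c where "c = (\<integral>x. k x * of_real (\<psi> x) \<partial>?M) / I \<psi>"
  have "AE x in ?M. k x - c = 0"
  proof (rule AE_zero_if_integral_test_function)
    show "integrable ?M (\<lambda>x. k x - c)" 
      using k finite_measure_lebesgue_on_interval by (simp add: finite_measure.integrable_const)
    fix \<theta> assume t: "test_function {0<..<a} \<theta>"
    \<comment> \<open>Subtracting a multiple of \<open>\<psi>\<close> makes the mean value zero, so that \<open>k0\<close> applies.\<close>
    define s where "s = (\<integral>x. \<theta> x \<partial>?M) / (\<integral>x. \<psi> x \<partial>?M)"
    have s: "of_real s = I \<theta> / I \<psi>" by (simp add: Ir s_def)
    let ?\<eta> = "\<lambda>x. \<theta> x - s * \<psi> x"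
    have \<eta>: "test_function {0<..<a} ?\<eta>"
    proof -
      have sub: "{x. ?\<eta> x \<noteq> 0} \<subseteq> {x. \<theta> x \<noteq> 0} \<union> {x. \<psi> x \<noteq> 0}" by auto
      have cl: "closure {x. ?\<eta> x \<noteq> 0} \<subseteq> closure {x. \<theta> x \<noteq> 0} \<union> closure {x. \<psi> x \<noteq> 0}"
        using closure_mono[OF sub] by (simp add: closure_Un)
      have "compact (closure {x. \<theta> x \<noteq> 0} \<union> closure {x. \<psi> x \<noteq> 0})"
        using t \<psi> by (intro compact_Un) (auto simp: test_function_def)
      then have "compact (closure {x. ?\<eta> x \<noteq> 0})"
        using cl by (meson bounded_subset closed_closure compact_eq_bounded_closed)
      moreover have "closure {x. ?\<eta> x \<noteq> 0} \<subseteq> {0<..<a}"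
        using cl t \<psi> unfolding test_function_def by (meson Un_least order_trans)
      moreover have "?\<eta> C1_differentiable_on UNIV"
        using t \<psi> unfolding test_function_def
        by (intro C1_differentiable_on_diff C1_differentiable_on_mult C1_differentiable_on_const) auto
      ultimately show ?thesis
        by (simp add: test_function_def)
    qed
    have i\<theta>: "integrable ?M (\<lambda>x. complex_of_real (\<theta> x))" and i\<psi>: "integrable ?M (\<lambda>x. complex_of_real (\<psi> x))"
      using integrable_mult_test_function(1)[OF one t] integrable_mult_test_function(1)[OF one \<psi>] by simp_all
    have "(\<integral>x. complex_of_real (?\<eta> x) \<partial>?M) = I \<theta> - of_real s * I \<psi>"
      using i\<theta> i\<psi> by (simp add: I_def)
    also have "\<dots> = 0" using I\<psi> by (simp add: s)
    finally have z: "(\<integral>x. complex_of_real (?\<eta> x) \<partial>?M) = 0" .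
    obtain X where "test_function {0<..<a} X" "deriv X = ?\<eta>"
      using test_function_antiderivative[OF \<eta> z a] by blast
    then have "0 = (\<integral>x. k x * of_real (?\<eta> x) \<partial>?M)"
      using k0 by metis
    also have "\<dots> = (\<integral>x. k x * of_real (\<theta> x) - of_real s * (k x * of_real (\<psi> x)) \<partial>?M)"
      by (rule Bochner_Integration.integral_cong) (auto simp: algebra_simps)
    also have "\<dots> = (\<integral>x. k x * of_real (\<theta> x) \<partial>?M) - c * I \<theta>"
      using integrable_mult_test_function(1)[OF k t] integrable_mult_test_function(1)[OF k \<psi>]
      by (simp add: c_def s)
    also have "\<dots> = (\<integral>x. k x * of_real (\<theta> x) - c * of_real (\<theta> x) \<partial>?M)"
      using integrable_mult_test_function(1)[OF k t] i\<theta> by (simp add: I_def)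
    finally show "(\<integral>x. (k x - c) * of_real (\<theta> x) \<partial>?M) = 0"
      by (simp add: left_diff_distrib)
  qed
  then have "AE x in ?M. c + (\<integral>y. indicator {..<x} y *\<^sub>R g y \<partial>?M) = f x"
    by eventually_elim (auto simp: k_def G_def algebra_simps)
  with primitive_exists[OF g] show ?thesis by (rule that)
qed

section \<open>Sobolev functions and their boundary values\<close>

lemma L2_integrable:
  assumes "f \<in> L2 {0<..<a}"
  shows "integrable (lebesgue_on {0<..<a}) f"
proof -
  interpret finite_measure "lebesgue_on {0<..<a}" by (rule finite_measure_lebesgue_on_interval)
  have "integrable (lebesgue_on {0<..<a}) (\<lambda>x. 1 + (cmod (f x))\<^sup>2)"
    using assms by (auto simp: L2_def)
  then show ?thesis
  proof (rule Bochner_Integration.integrable_bound)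
    show "AE x in lebesgue_on {0<..<a}. norm (f x) \<le> norm (1 + (cmod (f x))\<^sup>2)"
    proof (rule AE_I2)
      fix x
      have "0 \<le> (cmod (f x) - 1)\<^sup>2" by simp
      then have "2 * cmod (f x) \<le> 1 + (cmod (f x))\<^sup>2"
        by (simp add: power2_eq_square algebra_simps)
      then show "norm (f x) \<le> norm (1 + (cmod (f x))\<^sup>2)"
        using norm_ge_zero[of "f x"] unfolding real_norm_def by linarith
    qed
  qed (use assms in \<open>auto simp: L2_def\<close>)
qed

lemma L2_norm_power2: "(L2_norm S f)\<^sup>2 = (\<integral>x. (cmod (f x))\<^sup>2 \<partial>lebesgue_on S)"
  by (simp add: L2_norm_def)

lemma L2_norm_nonneg: "L2_norm S f \<ge> 0"
  by (simp add: L2_norm_def)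

lemma integral_norm_le_L2_norm:
  assumes f: "f \<in> L2 {0<..<a}" and a: "0 < a"
  shows "(\<integral>x. cmod (f x) \<partial>lebesgue_on {0<..<a}) \<le> sqrt a * L2_norm {0<..<a} f"
proof -
  let ?M = "lebesgue_on {0<..<a}"
  interpret finite_measure ?M by (rule finite_measure_lebesgue_on_interval)
  define \<mu> where "\<mu> = (\<integral>x. cmod (f x) \<partial>?M) / a"
  have i: "integrable ?M (\<lambda>x. cmod (f x))" "integrable ?M (\<lambda>x. (cmod (f x))\<^sup>2)"
    using integrable_norm[OF L2_integrable[OF f]] f by (simp_all add: L2_def)
  have meas: "measure ?M (space ?M) = a"
    using a by (simp add: measure_restrict_space)
  have "0 \<le> (\<integral>x. (cmod (f x) - \<mu>)\<^sup>2 \<partial>?M)" by simp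
  also have "\<dots> = (\<integral>x. (cmod (f x))\<^sup>2 - 2 * \<mu> * cmod (f x) + \<mu>\<^sup>2 \<partial>?M)"
    by (simp add: power2_diff algebra_simps)
  also have "\<dots> = (\<integral>x. (cmod (f x))\<^sup>2 \<partial>?M) - 2 * \<mu> * (\<integral>x. cmod (f x) \<partial>?M) + \<mu>\<^sup>2 * a"
    using i meas by simp
  also have "\<dots> = (\<integral>x. (cmod (f x))\<^sup>2 \<partial>?M) - (\<integral>x. cmod (f x) \<partial>?M)\<^sup>2 / a"
    using a by (simp add: \<mu>_def power2_eq_square field_simps)
  finally have "(\<integral>x. cmod (f x) \<partial>?M)\<^sup>2 \<le> a * (L2_norm {0<..<a} f)\<^sup>2"
    using a by (simp add: L2_norm_power2 field_simps)
  also have "\<dots> = (sqrt a * L2_norm {0<..<a} f)\<^sup>2"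
    using a by (simp add: power_mult_distrib)
  finally show ?thesis
    by (rule power2_le_imp_le) (use a L2_norm_nonneg in simp)
qed

lemma L2_diff:
  assumes "f \<in> L2 S" "g \<in> L2 S"
  shows "f - g \<in> L2 S"
proof -
  have [measurable]: "f \<in> borel_measurable (lebesgue_on S)" "g \<in> borel_measurable (lebesgue_on S)"
    using assms by (auto simp: L2_def)
  have "integrable (lebesgue_on S) (\<lambda>x. 2 * (cmod (f x))\<^sup>2 + 2 * (cmod (g x))\<^sup>2)"
    using assms by (auto simp: L2_def)
  then have "integrable (lebesgue_on S) (\<lambda>x. (cmod (f x - g x))\<^sup>2)"
  proof (rule Bochner_Integration.integrable_bound)
    show "AE x in lebesgue_on S. norm ((cmod (f x - g x))\<^sup>2) \<le> norm (2 * (cmod (f x))\<^sup>2 + 2 * (cmod (g x))\<^sup>2)"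
    proof (rule AE_I2)
      fix x
      have "(cmod (f x - g x))\<^sup>2 \<le> (cmod (f x) + cmod (g x))\<^sup>2"
        by (intro power_mono norm_triangle_ineq4) auto
      also have "\<dots> \<le> 2 * (cmod (f x))\<^sup>2 + 2 * (cmod (g x))\<^sup>2"
        using zero_le_power2[of "cmod (f x) - cmod (g x)"] by (simp add: power2_eq_square algebra_simps)
      finally show "norm ((cmod (f x - g x))\<^sup>2) \<le> norm (2 * (cmod (f x))\<^sup>2 + 2 * (cmod (g x))\<^sup>2)"
        by simp
    qed
  qed auto
  then show ?thesis by (simp add: L2_def fun_diff_def)
qed

lemma bounded_in_L2:
  assumes f: "f \<in> borel_measurable (lebesgue_on {0<..<a})"
    and B: "\<And>x. x \<in> {0<..<a} \<Longrightarrow> cmod (f x) \<le> B"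
  shows "f \<in> L2 {0<..<a}"
proof -
  have "integrable (lebesgue_on {0<..<a}) (\<lambda>x. (cmod (f x))\<^sup>2)"
    by (rule integrable_bounded_on_interval[of _ _ "B\<^sup>2"]) 
      (use f B in \<open>auto intro!: power_mono\<close>)
  then show ?thesis using f by (simp add: L2_def)
qed

lemma weak_deriv_works:
  assumes "f \<in> H1 S"
  shows "weak_deriv S f \<in> L2 S" "has_weak_deriv S f (weak_deriv S f)"
proof -
  have "\<exists>g. g \<in> L2 S \<and> has_weak_deriv S f g"
    using assms by (auto simp: H1_def)
  from someI_ex[OF this] show "weak_deriv S f \<in> L2 S" "has_weak_deriv S f (weak_deriv S f)"
    by (auto simp: weak_deriv_def)
qed

lemma H1_imp_L2: "f \<in> H1 S \<Longrightarrow> f \<in> L2 S"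
  by (simp add: H1_def)

lemma weak_deriv_unique:
  assumes f: "f \<in> L2 {0<..<a}" and g: "g \<in> L2 {0<..<a}" and w: "has_weak_deriv {0<..<a} f g"
  shows "AE x in lebesgue_on {0<..<a}. weak_deriv {0<..<a} f x = g x"
proof -
  let ?S = "{0<..<a}" let ?M = "lebesgue_on ?S"
  have H: "f \<in> H1 ?S" using assms by (auto simp: H1_def)
  note wd = weak_deriv_works[OF H]
  have "AE x in ?M. weak_deriv ?S f x - g x = 0"
  proof (rule AE_zero_if_integral_test_function)
    show "integrable ?M (\<lambda>x. weak_deriv ?S f x - g x)"
      using L2_integrable wd(1) g by auto
    fix \<theta> assume t: "test_function ?S \<theta>"
    have "(\<integral>x. weak_deriv ?S f x * of_real (\<theta> x) \<partial>?M) = (\<integral>x. g x * of_real (\<theta> x) \<partial>?M)"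
      using wd(2)[unfolded has_weak_deriv_def, rule_format, OF t] w[unfolded has_weak_deriv_def, rule_format, OF t]
      by simp
    then show "(\<integral>x. (weak_deriv ?S f x - g x) * of_real (\<theta> x) \<partial>?M) = 0"
      unfolding left_diff_distrib
      using integrable_mult_test_function(1)[OF L2_integrable[OF wd(1)] t]
        integrable_mult_test_function(1)[OF L2_integrable[OF g] t] by simp
  qed
  then show ?thesis by eventually_elim simp
qed

lemma H1_diff:
  assumes f: "f \<in> H1 {0<..<a}" and g: "g \<in> H1 {0<..<a}"
  shows "f - g \<in> H1 {0<..<a}"
proof -
  let ?S = "{0<..<a}" let ?M = "lebesgue_on ?S"
  let ?w = "weak_deriv ?S f - weak_deriv ?S g"
  note wf = weak_deriv_works[OF f] and wg = weak_deriv_works[OF g]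
  have "has_weak_deriv ?S (f - g) ?w"
    unfolding has_weak_deriv_def
  proof (intro allI impI)
    fix \<theta> assume t: "test_function ?S \<theta>"
    note i = integrable_mult_test_function[OF L2_integrable t]
    show "(\<integral>x. (f - g) x * of_real (deriv \<theta> x) \<partial>?M) = - (\<integral>x. ?w x * of_real (\<theta> x) \<partial>?M)"
      using wf(2) wg(2) t i f g wf(1) wg(1)
      by (simp add: left_diff_distrib H1_imp_L2 has_weak_deriv_def)
  qed
  then show ?thesis
    using L2_diff f g wf(1) wg(1) by (auto simp: H1_def)
qed

lemma trace_at_eq:
  assumes h: "continuous_on {0..a} h" and ae: "AE x in lebesgue_on {0<..<a}. h x = f x"
    and x: "x \<in> {0..a}" and a: "0 < a"
  shows "trace_at {0<..<a} f x = h x"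
proof -
  have cl: "closure {0<..<a} = {0..a}" using a by simp
  let ?h = "SOME h. continuous_on (closure {0<..<a}) h \<and> (AE x in lebesgue_on {0<..<a}. h x = f x)"
  have "\<exists>h. continuous_on (closure {0<..<a}) h \<and> (AE x in lebesgue_on {0<..<a}. h x = f x)"
    using h ae cl by auto
  from someI_ex[OF this]
  have *: "continuous_on {0..a} ?h" "AE x in lebesgue_on {0<..<a}. ?h x = f x"
    using cl by auto
  have "AE x in lebesgue_on {0<..<a}. ?h x = h x"
    using *(2) ae by eventually_elim simp
  from AE_interval_eq_continuous[OF *(1) h a this x] show ?thesis
    by (simp add: trace_at_def)
qed

lemma H1_representative:
  assumes f: "f \<in> H1 {0<..<a}" and a: "0 < a"
  obtains h where "is_primitive a h (weak_deriv {0<..<a} f)" "AE x in lebesgue_on {0<..<a}. h x = f x"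
    "\<And>x. x \<in> {0..a} \<Longrightarrow> trace_at {0<..<a} f x = h x"
proof -
  note w = weak_deriv_works[OF f]
  obtain h where h: "is_primitive a h (weak_deriv {0<..<a} f)" "AE x in lebesgue_on {0<..<a}. h x = f x"
    using has_weak_deriv_imp_primitive[OF L2_integrable[OF H1_imp_L2[OF f]] L2_integrable[OF w(1)] w(2) a] by blast
  show ?thesis
    by (rule that[OF h trace_at_eq[OF is_primitive_continuous[OF h(1)] h(2)]]) (use a in auto)
qed

lemma trace_at_diff:
  assumes f: "f \<in> H1 {0<..<a}" and g: "g \<in> H1 {0<..<a}" and a: "0 < a" and x: "x \<in> {0..a}"
  shows "trace_at {0<..<a} (f - g) x = trace_at {0<..<a} f x - trace_at {0<..<a} g x"
proof -
  obtain h where h: "is_primitive a h (weak_deriv {0<..<a} f)" "AE x in lebesgue_on {0<..<a}. h x = f x"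
    "\<And>x. x \<in> {0..a} \<Longrightarrow> trace_at {0<..<a} f x = h x"
    using H1_representative[OF f a] by blast
  obtain k where k: "is_primitive a k (weak_deriv {0<..<a} g)" "AE x in lebesgue_on {0<..<a}. k x = g x"
    "\<And>x. x \<in> {0..a} \<Longrightarrow> trace_at {0<..<a} g x = k x"
    using H1_representative[OF g a] by blast
  have "trace_at {0<..<a} (f - g) x = h x - k x"
  proof (rule trace_at_eq[OF _ _ x a])
    show "continuous_on {0..a} (\<lambda>x. h x - k x)"
      using is_primitive_continuous h(1) k(1) by (intro continuous_intros) auto
    show "AE x in lebesgue_on {0<..<a}. h x - k x = (f - g) x"
      using h(2) k(2) by eventually_elim simp
  qed
  then show ?thesis using h(3) k(3) x by simp
qed

text \<open>The trace inequality: \<open>\<bar>h(x)\<bar> \<le> \<bar>h(y)\<bar> + 2 \<integral> \<bar>h'\<bar>\<close> for the continuous representative \<open>h\<close>, averaged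
  over \<open>y\<close>.\<close>

lemma trace_at_bound:
  assumes f: "f \<in> H1 {0<..<a}" and a: "0 < a" and x: "x \<in> {0..a}"
  shows "cmod (trace_at {0<..<a} f x) \<le> (1 / sqrt a + 2 * sqrt a) * H1_norm {0<..<a} f"
proof -
  let ?S = "{0<..<a}" let ?M = "lebesgue_on ?S" let ?g = "weak_deriv ?S f"
  interpret finite_measure ?M by (rule finite_measure_lebesgue_on_interval)
  obtain h where h: "is_primitive a h ?g" "AE x in ?M. h x = f x"
    "\<And>x. x \<in> {0..a} \<Longrightarrow> trace_at ?S f x = h x"
    using H1_representative[OF f a] by blast
  note w = weak_deriv_works[OF f]
  have g: "integrable ?M ?g" using L2_integrable[OF w(1)] .
  let ?G = "\<integral>x. cmod (?g x) \<partial>?M"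
  have inc: "cmod (h y - h 0) \<le> ?G" if "y \<in> {0..a}" for y
  proof -
    have "cmod (h y - h 0) \<le> (\<integral>z. cmod (indicator {..<y} z *\<^sub>R ?g z) \<partial>?M)"
      unfolding is_primitiveD[OF h(1) that, symmetric] by (rule integral_norm_bound)
    also have "\<dots> \<le> ?G"
      by (intro integral_mono integrable_norm integrable_indicator_lessThan g) (auto simp: indicator_def)
    finally show ?thesis .
  qed
  have meas: "measure ?M (space ?M) = a"
    using a by (simp add: measure_restrict_space)
  have pt: "cmod (h x) \<le> cmod (h y) + 2 * ?G" if "y \<in> {0<..<a}" for y
  proof -
    have "cmod (h y - (h y - h 0) + (h x - h 0)) \<le> cmod (h y) + cmod (h y - h 0) + cmod (h x - h 0)"
      by (intro norm_triangle_le add_mono norm_triangle_ineq4 order_refl)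
    then have "cmod (h x) \<le> cmod (h y) + cmod (h y - h 0) + cmod (h x - h 0)"
      by simp
    then show ?thesis using inc[of y] inc[OF x] that by auto
  qed
  have ae: "AE y in ?M. cmod (h x) - 2 * ?G \<le> cmod (f y)"
    using h(2) AE_space
  proof eventually_elim
    case (elim y)
    then show ?case
      using pt[of y] by auto
  qed
  have fi: "integrable ?M f" using L2_integrable[OF H1_imp_L2[OF f]] .
  have "a * (cmod (h x) - 2 * ?G) = (\<integral>y. cmod (h x) - 2 * ?G \<partial>?M)"
    using meas by simp
  also have "\<dots> \<le> (\<integral>y. cmod (f y) \<partial>?M)"
    using ae fi by (intro integral_mono_AE) auto
  also have "\<dots> \<le> sqrt a * L2_norm ?S f"
    by (rule integral_norm_le_L2_norm[OF H1_imp_L2[OF f] a])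
  finally have 1: "cmod (h x) \<le> (sqrt a * L2_norm ?S f) / a + 2 * ?G"
    using a by (simp add: field_simps)
  have "(sqrt a * L2_norm ?S f) / a = L2_norm ?S f / sqrt a"
    using a by (simp add: field_simps flip: real_sqrt_mult)
  moreover have "2 * ?G \<le> 2 * sqrt a * L2_norm ?S ?g"
    using integral_norm_le_L2_norm[OF w(1) a] by simp
  moreover have "L2_norm ?S f \<le> H1_norm ?S f" "L2_norm ?S ?g \<le> H1_norm ?S f"
    unfolding H1_norm_def by (auto intro!: real_le_rsqrt)
  then have "L2_norm ?S f / sqrt a \<le> H1_norm ?S f / sqrt a" 
     "2 * sqrt a * L2_norm ?S ?g \<le> 2 * sqrt a * H1_norm ?S f"
    using a by (auto intro!: divide_right_mono mult_left_mono)
  ultimately have "cmod (h x) \<le> H1_norm ?S f / sqrt a + 2 * sqrt a * H1_norm ?S f"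
    using 1 by linarith
  then show ?thesis
    using h(3)[OF x] by (simp add: algebra_simps)
qed

lemma simple_in_measurable:
  fixes F :: "'v \<Rightarrow> complex"
  assumes "simple_in T V s"
  shows "(\<lambda>t. F (s t)) \<in> borel_measurable (lebesgue_on {0<..<T})"
proof (rule borel_measurable_simple_function)
  have fin: "finite (s ` {0<..<T})" and lev: "\<And>h. {t \<in> {0<..<T}. s t = h} \<in> sets lebesgue"
    using assms by (auto simp: simple_in_def)
  show "simple_function (lebesgue_on {0<..<T}) (\<lambda>t. F (s t))"
    unfolding simple_function_def
  proof (intro conjI ballI)
    show "finite ((\<lambda>t. F (s t)) ` space (lebesgue_on {0<..<T}))"
      using finite_imageI[OF fin, of F] by (simp add: image_image)
    fix c
    have "(\<lambda>t. F (s t)) -` {c} \<inter> {0<..<T} = (\<Union>h\<in>{h \<in> s ` {0<..<T}. F h = c}. {t \<in> {0<..<T}. s t = h})"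
      by auto
    also have "\<dots> \<in> sets lebesgue"
      using fin lev by (intro sets.finite_UN) auto
    finally show "(\<lambda>t. F (s t)) -` {c} \<inter> space (lebesgue_on {0<..<T}) \<in> sets (lebesgue_on {0<..<T})"
      by (simp add: sets_restrict_space_iff)
  qed
qed

text \<open>Traces of a strongly measurable function are measurable, because traces of its simple
  approximations converge.\<close>

lemma trace_at_in_L2:
  assumes u: "bochner_L2 T (H1 {0<..<a}) (H1_norm {0<..<a}) u" and a: "0 < a" and x: "x \<in> {0..a}"
  shows "(\<lambda>t. trace_at {0<..<a} (u t) x) \<in> L2 {0<..<T}"
proof -
  let ?S = "{0<..<a}" let ?M = "lebesgue_on {0<..<T}"
  let ?K = "1 / sqrt a + 2 * sqrt a"
  let ?tr = "\<lambda>f. trace_at ?S f x"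
  have uH: "AE t in ?M. u t \<in> H1 ?S" and uN: "integrable ?M (\<lambda>t. (H1_norm ?S (u t))\<^sup>2)"
    using u by (auto simp: bochner_L2_def)
  obtain s where s: "\<And>n::nat. simple_in T (H1 ?S) (s n)" 
     "AE t in ?M. (\<lambda>n. H1_norm ?S (u t - s n t)) \<longlonglongrightarrow> 0"
    using u by (auto simp: bochner_L2_def)
  have sH: "s n t \<in> H1 ?S" if "t \<in> {0<..<T}" for n t
    using s(1)[of n] that by (auto simp: simple_in_def)
  note [measurable] = simple_in_measurable[OF s(1), of ?tr]
  have "(\<lambda>t. lim (\<lambda>n. ?tr (s n t))) \<in> borel_measurable ?M"
    by (rule borel_measurable_lim_metric) measurable
  moreover have "AE t in ?M. lim (\<lambda>n. ?tr (s n t)) = ?tr (u t)"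
    using s(2) uH AE_space
  proof eventually_elim
    fix t assume t: "(\<lambda>n. H1_norm ?S (u t - s n t)) \<longlonglongrightarrow> 0" "u t \<in> H1 ?S" "t \<in> space ?M"
    have "(\<lambda>n. ?tr (s n t) - ?tr (u t)) \<longlonglongrightarrow> 0"
    proof (rule Lim_null_comparison)
      have "norm (?tr (s n t) - ?tr (u t)) \<le> ?K * H1_norm ?S (u t - s n t)" for n
        using trace_at_bound[OF H1_diff a x] trace_at_diff[OF _ _ a x] t sH
        by (simp add: norm_minus_commute)
      then show "\<forall>\<^sub>F n in sequentially. norm (?tr (s n t) - ?tr (u t)) \<le> ?K * H1_norm ?S (u t - s n t)"
        by simp
      show "(\<lambda>n. ?K * H1_norm ?S (u t - s n t)) \<longlonglongrightarrow> 0"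
        using tendsto_mult_left[OF t(1), of ?K] by simp
    qed
    then show "lim (\<lambda>n. ?tr (s n t)) = ?tr (u t)"
      by (simp add: limI LIM_zero_iff)
  qed
  ultimately have meas [measurable]: "(\<lambda>t. ?tr (u t)) \<in> borel_measurable ?M"
    by (rule borel_measurable_lebesgue_on_AE[rotated]) auto
  have "integrable ?M (\<lambda>t. ?K\<^sup>2 * (H1_norm ?S (u t))\<^sup>2)"
    using uN by simp
  then have "integrable ?M (\<lambda>t. (cmod (?tr (u t)))\<^sup>2)"
  proof (rule Bochner_Integration.integrable_bound)
    show "AE t in ?M. norm ((cmod (?tr (u t)))\<^sup>2) \<le> norm (?K\<^sup>2 * (H1_norm ?S (u t))\<^sup>2)"
      using uH
    proof eventually_elim
      fix t assume "u t \<in> H1 ?S"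
      from power_mono[OF trace_at_bound[OF this a x], of 2]
      show "norm ((cmod (?tr (u t)))\<^sup>2) \<le> norm (?K\<^sup>2 * (H1_norm ?S (u t))\<^sup>2)"
        by (simp add: power_mult_distrib)
    qed
  qed measurable
  then show ?thesis using meas by (simp add: L2_def)
qed

section \<open>Testing the heat equation with exponential solutions\<close>

lemma primitive_in_H1:
  assumes \<phi>: "is_primitive a \<phi> d" and d: "d \<in> L2 {0<..<a}" and a: "0 < a"
  shows "\<phi> \<in> H1 {0<..<a}" "AE x in lebesgue_on {0<..<a}. weak_deriv {0<..<a} \<phi> x = d x"
    "\<And>x. x \<in> {0..a} \<Longrightarrow> trace_at {0<..<a} \<phi> x = \<phi> x"
proof -
  have c: "continuous_on {0..a} \<phi>" by (rule is_primitive_continuous[OF \<phi>])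
  obtain B where B: "B > 0" "\<And>x. x \<in> {0..a} \<Longrightarrow> norm (\<phi> x) \<le> B"
    using continuous_on_bound_interval[OF c] by blast
  have L2: "\<phi> \<in> L2 {0<..<a}"
    by (rule bounded_in_L2[OF measurable_continuous_on_interval[OF c], of B]) (use B in auto)
  have w: "has_weak_deriv {0<..<a} \<phi> d"
    by (rule is_primitive_imp_has_weak_deriv[OF \<phi> a])
  show "\<phi> \<in> H1 {0<..<a}" using L2 d w by (auto simp: H1_def)
  show "AE x in lebesgue_on {0<..<a}. weak_deriv {0<..<a} \<phi> x = d x"
    by (rule weak_deriv_unique[OF L2 d w])
  show "trace_at {0<..<a} \<phi> x = \<phi> x" if "x \<in> {0..a}" for x
    by (rule trace_at_eq[OF c _ that a]) simp
qed

lemma integral_weak_deriv_by_parts: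
  assumes f: "f \<in> H1 {0<..<a}" and q: "is_primitive a q (\<lambda>x. s * \<phi> x)" and a: "0 < a"
  shows "(\<integral>x. weak_deriv {0<..<a} f x * q x \<partial>lebesgue_on {0<..<a})
    = trace_at {0<..<a} f a * q a - trace_at {0<..<a} f 0 * q 0 
      - s * (\<integral>x. f x * \<phi> x \<partial>lebesgue_on {0<..<a})"
proof -
  let ?S = "{0<..<a}" let ?M = "lebesgue_on ?S"
  obtain h where h: "is_primitive a h (weak_deriv ?S f)" "AE x in ?M. h x = f x"
    "\<And>x. x \<in> {0..a} \<Longrightarrow> trace_at ?S f x = h x"
    using H1_representative[OF f a] by blast
  have "(\<integral>x. h x * (s * \<phi> x) \<partial>?M) = (\<integral>x. s * (f x * \<phi> x) \<partial>?M)"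
  proof (rule integral_lebesgue_on_cong_AE)
    show "AE x in ?M. h x * (s * \<phi> x) = s * (f x * \<phi> x)"
      using h(2) by eventually_elim simp
  qed simp
  also have "\<dots> = s * (\<integral>x. f x * \<phi> x \<partial>?M)" by simp
  finally have hs: "(\<integral>x. h x * (s * \<phi> x) \<partial>?M) = s * (\<integral>x. f x * \<phi> x \<partial>?M)" .
  have "(\<integral>x. weak_deriv ?S f x * q x \<partial>?M) + s * (\<integral>x. f x * \<phi> x \<partial>?M) = h a * q a - h 0 * q 0"
    using primitive_by_parts[OF h(1) q] a unfolding hs by simp
  then show ?thesis
    using a h(3)[of a] h(3)[of 0] by (simp add: eq_diff_eq)
qed

lemma is_primitive_exp:
  "is_primitive T (\<lambda>t. exp (- s * complex_of_real t)) (\<lambda>t. - s * exp (- s * complex_of_real t))"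
proof (rule is_primitive_vector_derivative[of _ _ _ "{}"])
  have c: "continuous_on {0..T} (\<lambda>t. - s * exp (- s * complex_of_real t))"
    by (intro continuous_intros)
  obtain B where B: "\<And>x. x \<in> {0..T} \<Longrightarrow> norm (- s * exp (- s * complex_of_real x)) \<le> B"
    using continuous_on_bound_interval[OF c] by blast
  show "integrable (lebesgue_on {0<..<T}) (\<lambda>t. - s * exp (- s * complex_of_real t))"
    by (rule integrable_bounded_on_interval[OF measurable_continuous_on_interval[OF c], of B]) 
      (metis B greaterThanLessThan_subseteq_atLeastAtMost_iff order_refl subsetD)
  show "((\<lambda>t. exp (- s * complex_of_real t)) has_vector_derivative - s * exp (- s * complex_of_real t)) (at t)" for t
  proof -
    have "((\<lambda>y. exp (- s * y)) has_field_derivative - s * exp (- s * of_real t)) (at (complex_of_real t))"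
      by (auto intro!: derivative_eq_intros)
    from has_vector_derivative_real_field[OF this] show ?thesis .
  qed
qed (auto intro!: continuous_intros)

text \<open>The weak formulation, tested with \<open>e\<^sup>-\<^sup>s\<^sup>t \<phi>(x)\<close> where \<open>(k \<phi>')' = s \<phi>\<close> and \<open>q = k \<phi>'\<close>, \<open>k\<close> being
  the conductivity. Both
  integrations by parts move all derivatives to the test function; only boundary terms and the
  value at time \<open>T\<close> remain. The duality pairing \<open>ut t \<phi>\<close> is given almost everywhere by the equation
  itself, so that no estimate in the dual of \<open>H\<^sup>1\<close> is necessary.\<close>

theorem heat_solution_identity:
  fixes T a :: real
  assumes sol: "heat_solution m b \<gamma> a \<rho> T u g0 ga" and a: "0 < a" and T: "0 < T"
  obtains W where "W \<ge> 0"
    "\<And>\<phi> d q s B. \<lbrakk>is_primitive a \<phi> d; d \<in> L2 {0<..<a}; is_primitive a q (\<lambda>x. s * \<phi> x);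
       AE x in lebesgue_on {0<..<a}. of_real (conductivity m b \<gamma> x) * d x = q x;
       \<And>x. x \<in> {0<..<a} \<Longrightarrow> cmod (\<phi> x) \<le> B\<rbrakk> \<Longrightarrow>
     \<exists>Y. cmod Y \<le> W * B \<and>
       exp (- s * of_real T) * Y
       + (q a + of_real \<rho> * \<phi> a) * (\<integral>t. exp (- s * of_real t) * trace_at {0<..<a} (u t) a \<partial>lebesgue_on {0<..<T})
       - q 0 * (\<integral>t. exp (- s * of_real t) * trace_at {0<..<a} (u t) 0 \<partial>lebesgue_on {0<..<T})
       = - of_real (\<gamma> 1) * \<phi> 0 * (\<integral>t. exp (- s * of_real t) * g0 t \<partial>lebesgue_on {0<..<T})"
proof -
  let ?S = "{0<..<a}" let ?M = "lebesgue_on ?S" let ?R = "lebesgue_on {0<..<T}"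
  let ?tr = "\<lambda>x t. trace_at ?S (u t) x"
  have u: "bochner_L2 T (H1 ?S) (H1_norm ?S) u" and g0: "g0 \<in> L2 {0<..<T}"
    and init: "initially_zero ?S T u"
    using sol by (auto simp: heat_solution_def Let_def)
  obtain ut where ut: "has_time_deriv ?S T u ut"
    and weak: "\<And>\<phi>. \<phi> \<in> H1 ?S \<Longrightarrow> AE t in ?R. ut t \<phi>
           + (\<integral>x. of_real (conductivity m b \<gamma> x) * weak_deriv ?S (u t) x * weak_deriv ?S \<phi> x \<partial>?M)
           + of_real \<rho> * trace_at ?S (u t) a * trace_at ?S \<phi> a
           = - of_real (\<gamma> 1) * g0 t * trace_at ?S \<phi> 0"
    using sol by (auto simp: heat_solution_def Let_def)
  have uH: "AE t in ?R. u t \<in> H1 ?S" using u by (auto simp: bochner_L2_def)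
  obtain w where w: "\<And>t. t \<in> {0..T} \<Longrightarrow> w t \<in> L2 ?S"
     "\<And>t. t \<in> {0..T} \<Longrightarrow> ((\<lambda>r. L2_norm ?S (w r - w t)) \<longlongrightarrow> 0) (at t within {0..T})"
     "AE t in ?R. AE x in ?M. w t x = u t x" "AE x in ?M. w 0 x = 0"
    using init unfolding initially_zero_def by blast
  define W where "W = (\<integral>x. cmod (w T x) \<partial>?M)"
  have itr: "integrable ?R (?tr x)" if "x \<in> {0..a}" for x
    by (rule L2_integrable[OF trace_at_in_L2[OF u a that]])
  have ig0: "integrable ?R g0" by (rule L2_integrable[OF g0])
  show ?thesis
  proof (rule that)
    show "W \<ge> 0" by (simp add: W_def)
    fix \<phi> d q s B
    assume \<phi>: "is_primitive a \<phi> d" and d: "d \<in> L2 ?S" and q: "is_primitive a q (\<lambda>x. s * \<phi> x)"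
      and kd: "AE x in ?M. of_real (conductivity m b \<gamma> x) * d x = q x"
      and B: "\<And>x. x \<in> ?S \<Longrightarrow> cmod (\<phi> x) \<le> B"
    note H = primitive_in_H1[OF \<phi> d a]
    have c\<phi>: "continuous_on {0..a} \<phi>" by (rule is_primitive_continuous[OF \<phi>])
    have B0: "0 \<le> B" using B[of "a/2"] a norm_ge_zero[of "\<phi> (a/2)"] by (auto simp del: norm_ge_zero)
    define Y where "Y t = (\<integral>x. w t x * \<phi> x \<partial>?M)" for t
    have iw: "integrable ?M (w t)" if "t \<in> {0..T}" for t
      by (rule L2_integrable[OF w(1)[OF that]])
    have bound: "cmod (\<integral>x. f x * \<phi> x \<partial>?M) \<le> (\<integral>x. cmod (f x) \<partial>?M) * B" if f: "integrable ?M f" for f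
    proof -
      have "cmod (\<integral>x. f x * \<phi> x \<partial>?M) \<le> (\<integral>x. cmod (f x * \<phi> x) \<partial>?M)"
        by (rule integral_norm_bound)
      also have "\<dots> \<le> (\<integral>x. cmod (f x) * B \<partial>?M)"
        using B by (intro integral_mono integrable_norm[OF integrable_mult_continuous[OF f c\<phi>]]
            integrable_mult_left integrable_norm[OF f]) (auto simp: norm_mult intro!: mult_left_mono)
      finally show ?thesis by simp
    qed
    have cY: "continuous_on {0..T} Y"
      unfolding continuous_on_def
    proof
      fix t assume t: "t \<in> {0..T}"
      have "((\<lambda>r. Y r - Y t) \<longlongrightarrow> 0) (at t within {0..T})"
      proof (rule Lim_null_comparison)
        show "((\<lambda>r. sqrt a * L2_norm ?S (w r - w t) * B) \<longlongrightarrow> 0) (at t within {0..T})"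
          using w(2)[OF t] by (auto intro!: tendsto_eq_intros)
        have "norm (Y r - Y t) \<le> sqrt a * L2_norm ?S (w r - w t) * B" if r: "r \<in> {0..T}" for r
        proof -
          have "Y r - Y t = (\<integral>x. (w r - w t) x * \<phi> x \<partial>?M)"
            using integrable_mult_continuous[OF iw c\<phi>] r t by (simp add: Y_def left_diff_distrib)
          also have "cmod \<dots> \<le> (\<integral>x. cmod ((w r - w t) x) \<partial>?M) * B"
            by (rule bound[OF L2_integrable[OF L2_diff[OF w(1) w(1)]]]) (use r t in auto)
          also have "\<dots> \<le> (sqrt a * L2_norm ?S (w r - w t)) * B"
            by (rule mult_right_mono[OF integral_norm_le_L2_norm[OF L2_diff[OF w(1) w(1)] a] B0]) (use r t in auto)
          finally show ?thesis .
        qed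
        then show "\<forall>\<^sub>F r in at t within {0..T}. norm (Y r - Y t) \<le> sqrt a * L2_norm ?S (w r - w t) * B"
          by (auto simp: eventually_at_filter)
      qed
      then show "(Y \<longlongrightarrow> Y t) (at t within {0..T})"
        by (simp add: LIM_zero_iff)
    qed
    have uY: "AE t in ?R. (\<integral>x. u t x * \<phi> x \<partial>?M) = Y t"
      using w(3)
    proof eventually_elim
      case (elim t)
      then show ?case unfolding Y_def
        by (intro integral_lebesgue_on_cong_AE) (auto elim: eventually_mono)
    qed
    \<comment> \<open>\<open>Y\<close> is the continuous representative of \<open>t \<mapsto> \<integral> u(t) \<phi>\<close>, and \<open>L\<close> is its derivative.\<close>
    define L where "L t = - of_real (\<gamma> 1) * \<phi> 0 * g0 t - (q a + of_real \<rho> * \<phi> a) * ?tr a t + q 0 * ?tr 0 t + s * Y t" for t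
    have utL: "AE t in ?R. ut t \<phi> = L t"
      using weak[OF H(1)] uH uY
    proof eventually_elim
      case (elim t)
      have "(\<integral>x. of_real (conductivity m b \<gamma> x) * weak_deriv ?S (u t) x * weak_deriv ?S \<phi> x \<partial>?M)
         = (\<integral>x. weak_deriv ?S (u t) x * q x \<partial>?M)"
      proof (rule integral_lebesgue_on_cong_AE)
        show "AE x in ?M. of_real (conductivity m b \<gamma> x) * weak_deriv ?S (u t) x * weak_deriv ?S \<phi> x 
            = weak_deriv ?S (u t) x * q x"
          using H(2) kd by eventually_elim (auto simp: algebra_simps)
      qed simp
      also have "\<dots> = ?tr a t * q a - ?tr 0 t * q 0 - s * Y t"
        using integral_weak_deriv_by_parts[OF elim(2) q a] elim(3) by simp
      finally have *: "ut t \<phi> + (?tr a t * q a - ?tr 0 t * q 0 - s * Y t) + of_real \<rho> * ?tr a t * \<phi> a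
           = - of_real (\<gamma> 1) * g0 t * \<phi> 0"
        using elim(1) H(3)[of a] H(3)[of 0] a by simp
      have "ut t \<phi> = - of_real (\<gamma> 1) * g0 t * \<phi> 0 - of_real \<rho> * ?tr a t * \<phi> a 
          - (?tr a t * q a - ?tr 0 t * q 0 - s * Y t)"
        unfolding *[symmetric] by simp
      then show ?case
        by (simp add: L_def algebra_simps)
    qed
    obtain BY where BY: "\<And>t. t \<in> {0..T} \<Longrightarrow> norm (Y t) \<le> BY"
      using continuous_on_bound_interval[OF cY] by blast
    have iY: "integrable ?R Y"
      by (rule integrable_bounded_on_interval[OF measurable_continuous_on_interval[OF cY], of BY])
        (use BY in auto)
    have iL: "integrable ?R L"
      unfolding L_def using itr[of a] itr[of 0] a ig0 iY by auto
    have "has_weak_deriv {0<..<T} Y L"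
      unfolding has_weak_deriv_def
    proof (intro allI impI)
      fix \<theta> assume t: "test_function {0<..<T} \<theta>"
      have "(\<integral>t. Y t * of_real (deriv \<theta> t) \<partial>?R) = (\<integral>t. (\<integral>x. u t x * \<phi> x \<partial>?M) * of_real (deriv \<theta> t) \<partial>?R)"
        using uY by (intro integral_lebesgue_on_cong_AE) (auto elim: eventually_mono)
      also have "\<dots> = - (\<integral>t. ut t \<phi> * of_real (\<theta> t) \<partial>?R)"
        using ut H(1) t by (simp add: has_time_deriv_def)
      also have "(\<integral>t. ut t \<phi> * of_real (\<theta> t) \<partial>?R) = (\<integral>t. L t * of_real (\<theta> t) \<partial>?R)"
        using utL by (intro integral_lebesgue_on_cong_AE) (auto elim: eventually_mono)
      finally show "(\<integral>t. Y t * of_real (deriv \<theta> t) \<partial>?R) = - (\<integral>t. L t * of_real (\<theta> t) \<partial>?R)" .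
    qed
    then obtain F where F: "is_primitive T F L" "AE t in ?R. F t = Y t"
      using has_weak_deriv_imp_primitive[OF iY iL _ T] by blast
    have FY: "F t = Y t" if "t \<in> {0..T}" for t
      by (rule AE_interval_eq_continuous[OF is_primitive_continuous[OF F(1)] cY T F(2) that])
    have "Y 0 = (\<integral>x. 0 \<partial>?M)"
      unfolding Y_def using w(4) by (intro integral_lebesgue_on_cong_AE) (auto elim: eventually_mono)
    then have F0: "F 0 = 0" using FY[of 0] T by simp
    let ?E = "\<lambda>t. exp (- s * complex_of_real t)"
    have cE: "continuous_on {0..T} ?E" by (intro continuous_intros)
    note iE = integrable_mult_continuous[OF _ cE]
    have "(\<integral>t. L t * ?E t \<partial>?R) + (\<integral>t. F t * (- s * ?E t) \<partial>?R) = F T * ?E T"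
      using primitive_by_parts[OF F(1) is_primitive_exp[of T s]] T F0 by simp
    moreover have "(\<integral>t. F t * (- s * ?E t) \<partial>?R) = (\<integral>t. - s * (Y t * ?E t) \<partial>?R)"
      by (rule Bochner_Integration.integral_cong) (use FY in auto)
    moreover have "(\<integral>t. L t * ?E t \<partial>?R) = 
       (\<integral>t. - of_real (\<gamma> 1) * \<phi> 0 * (g0 t * ?E t) - (q a + of_real \<rho> * \<phi> a) * (?tr a t * ?E t) 
           + q 0 * (?tr 0 t * ?E t) + s * (Y t * ?E t) \<partial>?R)"
      by (rule Bochner_Integration.integral_cong) (auto simp: L_def algebra_simps)
    moreover have "\<dots> = - of_real (\<gamma> 1) * \<phi> 0 * (\<integral>t. g0 t * ?E t \<partial>?R) - (q a + of_real \<rho> * \<phi> a) * (\<integral>t. ?tr a t * ?E t \<partial>?R) 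
           + q 0 * (\<integral>t. ?tr 0 t * ?E t \<partial>?R) + s * (\<integral>t. Y t * ?E t \<partial>?R)"
      using iE[OF ig0] iE[OF itr[of a]] iE[OF itr[of 0]] iE[OF iY] a by simp
    ultimately have "- of_real (\<gamma> 1) * \<phi> 0 * (\<integral>t. g0 t * ?E t \<partial>?R) - (q a + of_real \<rho> * \<phi> a) * (\<integral>t. ?tr a t * ?E t \<partial>?R) 
           + q 0 * (\<integral>t. ?tr 0 t * ?E t \<partial>?R) = Y T * ?E T"
      using FY[of T] T by simp
    moreover have "cmod (Y T) \<le> W * B"
      unfolding Y_def W_def by (rule bound[OF iw]) (use T in auto)
    ultimately show "\<exists>Y. cmod Y \<le> W * B \<and>
       ?E T * Y + (q a + of_real \<rho> * \<phi> a) * (\<integral>t. ?E t * ?tr a t \<partial>?R) - q 0 * (\<integral>t. ?E t * ?tr 0 t \<partial>?R)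
       = - of_real (\<gamma> 1) * \<phi> 0 * (\<integral>t. ?E t * g0 t \<partial>?R)"
      by (intro exI[of _ "Y T"]) (simp add: mult.commute algebra_simps)
  qed
qed

section \<open>Gluing functions along the layers\<close>

text \<open>The \<open>j\<close>-th layer, \<open>1 \<le> j \<le> m\<close>, is \<open>]b (j - 1), b j[\<close> and has conductivity \<open>\<gamma> j\<close>.\<close>

locale layered_rod =
  fixes m :: nat and b \<gamma> :: "nat \<Rightarrow> real"
  assumes m: "m \<ge> 1" and b0: "b 0 = 0" and b_less: "\<And>j. j < m \<Longrightarrow> b j < b (j + 1)"
    and \<gamma>_pos: "\<And>j. j \<in> {1..m} \<Longrightarrow> \<gamma> j > 0"
begin

lemma b_strict_mono: "i < j \<Longrightarrow> j \<le> m \<Longrightarrow> b i < b j"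
proof (induction j)
  case (Suc j)
  then show ?case
    using b_less[of j] by (cases "i = j") auto
qed simp

lemma b_mono: "i \<le> j \<Longrightarrow> j \<le> m \<Longrightarrow> b i \<le> b j"
  using b_strict_mono[of i j] by (cases "i = j") auto

lemma bm_pos: "0 < b m"
  using b_strict_mono[of 0 m] b0 m by simp

text \<open>The number of the layer that contains \<open>x\<close>; an interface belongs to the layer on its left. The
  first and the last layer are extended to infinity, so that the function is defined on the line.\<close>

definition layer_index :: "real \<Rightarrow> nat" where
  "layer_index x = (LEAST j. 1 \<le> j \<and> (j = m \<or> x \<le> b j))"

lemma layer_index_props:
  shows "layer_index x \<in> {1..m}" "layer_index x = m \<or> x \<le> b (layer_index x)"
    "layer_index x = 1 \<or> b (layer_index x - 1) < x"
proof -
  let ?P = "\<lambda>j. 1 \<le> j \<and> (j = m \<or> x \<le> b j)"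
  have "?P m" using m by simp
  then have "?P (layer_index x)" "layer_index x \<le> m"
    unfolding layer_index_def by (rule LeastI, rule Least_le)
  then show "layer_index x \<in> {1..m}" "layer_index x = m \<or> x \<le> b (layer_index x)" 
    by auto
  have "layer_index x - 1 < layer_index x" using \<open>?P (layer_index x)\<close> by simp
  then have "\<not> ?P (layer_index x - 1)"
    unfolding layer_index_def by (rule not_less_Least)
  then show "layer_index x = 1 \<or> b (layer_index x - 1) < x"
    using \<open>?P (layer_index x)\<close> by auto
qed

lemma layer_index_eqI:
  assumes j: "j \<in> {1..m}" "j = m \<or> x \<le> b j" "j = 1 \<or> b (j - 1) < x"
  shows "layer_index x = j"
proof (rule ccontr)
  assume ne: "layer_index x \<noteq> j"
  note p = layer_index_props[of x]
  show False
  proof (cases "layer_index x < j")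
    case True
    then have "b (layer_index x) \<le> b (j - 1)" using j by (intro b_mono) auto
    then show False using True p j by auto
  next
    case False
    then have "b j \<le> b (layer_index x - 1)" using ne p by (intro b_mono) auto
    then show False using False ne p j by auto
  qed
qed

lemma layer_index_layer: "j \<in> {1..m} \<Longrightarrow> x \<in> layer m b j \<Longrightarrow> layer_index x = j"
  by (rule layer_index_eqI) (auto simp: layer_def)

lemma layer_index_interface: "j \<in> {1..m} \<Longrightarrow> layer_index (b j) = j"
  by (rule layer_index_eqI) (auto intro: b_strict_mono)

lemma layer_index_0: "layer_index 0 = 1"
  using b_strict_mono[of 0 1] b0 m by (intro layer_index_eqI) auto

text \<open>The points between two layers; the end points 0 and \<open>b m\<close> of the rod do not count.\<close>

definition interfaces :: "real set" where "interfaces = b ` {1..<m}"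

lemma finite_interfaces: "finite interfaces"
  by (simp add: interfaces_def)

lemma in_layer_index: "x \<notin> interfaces \<Longrightarrow> x \<in> layer m b (layer_index x)"
proof -
  assume x: "x \<notin> interfaces"
  note p = layer_index_props[of x]
  have "x < b (layer_index x)" if "layer_index x \<noteq> m"
  proof -
    have "layer_index x \<in> {1..<m}" using p(1) that by auto
    then have "x \<noteq> b (layer_index x)" using x unfolding interfaces_def by blast
    then show ?thesis using p(2) that by auto
  qed
  then show ?thesis using p(3) by (auto simp: layer_def)
qed

lemma open_layer: "open (layer m b j)"
proof -
  have "layer m b j = (if j = 1 then UNIV else {b (j - 1)<..}) \<inter> (if j = m then UNIV else {..<b j})"
    by (auto simp: layer_def)
  then show ?thesis by (auto intro: open_Int)
qed

lemma layer_no_interface: 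
  assumes "j \<in> {1..m}" "x \<in> layer m b j"
  shows "x \<notin> interfaces"
proof
  assume "x \<in> interfaces"
  then obtain i where i: "i \<in> {1..<m}" "x = b i" by (auto simp: interfaces_def)
  then have "i = j" using layer_index_layer[OF assms] layer_index_interface[of i] by simp
  then show False using i assms by (auto simp: layer_def)
qed

text \<open>The function on the line that equals \<open>f j\<close> on the \<open>j\<close>-th layer.\<close>

definition glue :: "(nat \<Rightarrow> real \<Rightarrow> complex) \<Rightarrow> real \<Rightarrow> complex" where
  "glue f x = f (layer_index x) x"

lemma glue_layer: "j \<in> {1..m} \<Longrightarrow> x \<in> layer m b j \<Longrightarrow> glue f x = f j x"
  by (simp add: glue_def layer_index_layer)

lemma continuous_on_glue:
  assumes f: "\<And>j. j \<in> {1..m} \<Longrightarrow> continuous_on UNIV (f j)"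
    and match: "\<And>j. j \<in> {1..<m} \<Longrightarrow> f j (b j) = f (j + 1) (b j)"
  shows "continuous_on UNIV (glue f)"
proof -
  let ?C = "\<lambda>j. {x. (j = 1 \<or> b (j - 1) \<le> x) \<and> (j = m \<or> x \<le> b j)}"
  have cl: "closed (?C j)" for j
  proof -
    have "?C j = (if j = 1 then UNIV else {b (j - 1)..}) \<inter> (if j = m then UNIV else {..b j})"
      by auto
    then show ?thesis by (auto intro: closed_Int)
  qed
  have "glue f x = f j x" if j: "j \<in> {1..m}" and x: "x \<in> ?C j" for j x
  proof (cases "j = 1 \<or> b (j - 1) < x")
    case True
    then show ?thesis using layer_index_eqI[OF j _ True] x by (simp add: glue_def)
  next
    case False
    then obtain i where i: "j = i + 1" "i \<in> {1..<m}" "x = b i"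
      using x j by (intro that[of "j - 1"]) auto
    then show ?thesis
      using layer_index_interface[of i] match[of i] by (simp add: glue_def)
  qed
  then have "continuous_on (?C j) (glue f)" if "j \<in> {1..m}" for j
    using continuous_on_subset[OF f[OF that]] that by (subst continuous_on_cong[OF refl, of _ _ "f j"]) auto
  then have "continuous_on (\<Union>j\<in>{1..m}. ?C j) (glue f)"
    using cl by (intro continuous_on_closed_Union) auto
  moreover have "(\<Union>j\<in>{1..m}. ?C j) = UNIV"
  proof -
    have "x \<in> ?C (layer_index x)" for x using layer_index_props[of x] by auto
    then show ?thesis using layer_index_props(1) by blast
  qed
  ultimately show ?thesis by simp
qed

lemma glue_has_vector_derivative:
  assumes x: "x \<notin> interfaces"
    and d: "\<And>j. j \<in> {1..m} \<Longrightarrow> (f j has_vector_derivative f' j x) (at x)"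
  shows "(glue f has_vector_derivative glue f' x) (at x)"
proof -
  note p = layer_index_props(1)[of x]
  show ?thesis
    unfolding glue_def[of f']
    by (rule has_vector_derivative_transform_within_open[OF d[OF p] open_layer in_layer_index[OF x]])
      (simp add: glue_layer[OF p])
qed

lemma conductivity_eq: 
  assumes "x \<in> {0<..<b m}" "x \<notin> interfaces"
  shows "conductivity m b \<gamma> x = \<gamma> (layer_index x)"
proof -
  note p = layer_index_props[of x]
  have ind: "indicator {b (j - 1)<..<b j} x = (if j = layer_index x then 1 else (0::real))" if j: "j \<in> {1..m}" for j
  proof (cases "x \<in> {b (j - 1)<..<b j}")
    case True
    then have "layer_index x = j" using j by (intro layer_index_eqI) auto
    then show ?thesis using True by simp
  next
    case False
    have "layer_index x \<noteq> j"
    proof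
      assume "layer_index x = j"
      then have "x \<in> layer m b j" using in_layer_index[OF assms(2)] by simp
      then show False using False assms(1) b0 by (auto simp: layer_def)
    qed
    then show ?thesis using False by simp
  qed
  have "conductivity m b \<gamma> x = (\<Sum>j=1..m. if j = layer_index x then \<gamma> j else 0)"
    unfolding conductivity_def by (rule sum.cong[OF refl], subst ind) auto
  also have "\<dots> = \<gamma> (layer_index x)" using p by simp
  finally show ?thesis .
qed

lemma conductivity_ext_eq: 
  assumes "x \<notin> interfaces"
  shows "conductivity_ext m b \<gamma> x = \<gamma> (layer_index x)"
proof -
  note p = layer_index_props[of x]
  have ind: "indicator (layer m b j) x = (if j = layer_index x then 1 else (0::real))" if j: "j \<in> {1..m}" for j
  proof (cases "x \<in> layer m b j")
    case True
    then show ?thesis using layer_index_layer[OF j True] by simp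
  next
    case False
    then have "j \<noteq> layer_index x" using in_layer_index[OF assms] by blast
    then show ?thesis using False by simp
  qed
  have "conductivity_ext m b \<gamma> x = (\<Sum>j=1..m. if j = layer_index x then \<gamma> j else 0)"
    unfolding conductivity_ext_def by (rule sum.cong[OF refl], subst ind) auto
  also have "\<dots> = \<gamma> (layer_index x)" using p by simp
  finally show ?thesis .
qed

section \<open>Exponential solutions in the layered rod\<close>

text \<open>On the \<open>j\<close>-th layer, a solution of \<open>(\<gamma> \<phi>')' = z\<^sup>2 \<phi>\<close> and its flux \<open>\<gamma> \<phi>'\<close>.\<close>

definition wave :: "complex \<Rightarrow> (nat \<Rightarrow> complex) \<Rightarrow> (nat \<Rightarrow> complex) \<Rightarrow> nat \<Rightarrow> real \<Rightarrow> complex" where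
  "wave z A B j x = A j * exp (of_real x * (z / of_real (sqrt (\<gamma> j))))
     + B j * exp (- of_real x * (z / of_real (sqrt (\<gamma> j))))"

definition flux :: "complex \<Rightarrow> (nat \<Rightarrow> complex) \<Rightarrow> (nat \<Rightarrow> complex) \<Rightarrow> nat \<Rightarrow> real \<Rightarrow> complex" where
  "flux z A B j x = of_real (sqrt (\<gamma> j)) * z *
     (A j * exp (of_real x * (z / of_real (sqrt (\<gamma> j))))
      - B j * exp (- of_real x * (z / of_real (sqrt (\<gamma> j)))))"

text \<open>The transmission conditions at the interfaces: continuity of the solution and of its flux.\<close>

definition matched :: "complex \<Rightarrow> (nat \<Rightarrow> complex) \<Rightarrow> (nat \<Rightarrow> complex) \<Rightarrow> bool" where
  "matched z A B \<longleftrightarrow> (\<forall>j\<in>{1..<m}. wave z A B j (b j) = wave z A B (j + 1) (b j) \<and>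
     flux z A B j (b j) = flux z A B (j + 1) (b j))"

lemma wave_derivative:
  assumes "j \<in> {1..m}"
  shows "(wave z A B j has_vector_derivative flux z A B j x / of_real (\<gamma> j)) (at x)"
proof -
  let ?k = "complex_of_real (sqrt (\<gamma> j))"
  have k: "?k \<noteq> 0" and k2: "complex_of_real (\<gamma> j) = ?k * ?k"
    using \<gamma>_pos[OF assms] by (auto simp flip: of_real_mult)
  have "((\<lambda>x. A j * exp (x * (z / ?k)) + B j * exp (- x * (z / ?k))) has_field_derivative 
     flux z A B j x / of_real (\<gamma> j)) (at (of_real x))"
    using k by (auto intro!: derivative_eq_intros simp: flux_def k2 field_simps)
  from has_vector_derivative_real_field[OF this] show ?thesis
    by (simp add: wave_def[abs_def])
qed

lemma flux_derivative:
  assumes "j \<in> {1..m}"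
  shows "(flux z A B j has_vector_derivative z\<^sup>2 * wave z A B j x) (at x)"
proof -
  let ?k = "complex_of_real (sqrt (\<gamma> j))"
  have k: "?k \<noteq> 0" 
    using \<gamma>_pos[OF assms] by auto
  have "((\<lambda>x. ?k * z * (A j * exp (x * (z / ?k)) - B j * exp (- x * (z / ?k)))) has_field_derivative 
     z\<^sup>2 * wave z A B j x) (at (of_real x))"
    using k by (auto intro!: derivative_eq_intros simp: wave_def power2_eq_square field_simps)
  from has_vector_derivative_real_field[OF this] show ?thesis
    by (simp add: flux_def[abs_def])
qed

lemma continuous_on_wave: "continuous_on S (wave z A B j)"
  unfolding wave_def[abs_def] by (intro continuous_intros)

lemma continuous_on_flux: "continuous_on S (flux z A B j)"
  unfolding flux_def[abs_def] by (intro continuous_intros)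

lemma continuous_on_glue_wave: "matched z A B \<Longrightarrow> continuous_on UNIV (glue (wave z A B))"
  by (rule continuous_on_glue) (auto simp: matched_def continuous_on_wave)

lemma continuous_on_glue_flux: "matched z A B \<Longrightarrow> continuous_on UNIV (glue (flux z A B))"
  by (rule continuous_on_glue) (auto simp: matched_def continuous_on_flux)

lemma glue_wave_derivative:
  assumes "x \<notin> interfaces"
  shows "(glue (wave z A B) has_vector_derivative glue (flux z A B) x / of_real (\<gamma> (layer_index x))) (at x)"
  using glue_has_vector_derivative[of x "wave z A B" "\<lambda>j x. flux z A B j x / of_real (\<gamma> j)", OF assms wave_derivative]
  by (simp add: glue_def)

lemma glue_flux_derivative:
  assumes "x \<notin> interfaces"
  shows "(glue (flux z A B) has_vector_derivative z\<^sup>2 * glue (wave z A B) x) (at x)"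
  using glue_has_vector_derivative[of x "flux z A B" "\<lambda>j x. z\<^sup>2 * wave z A B j x", OF assms flux_derivative]
  by (simp add: glue_def)

text \<open>Transmission makes \<open>\<phi>\<close> and its flux absolutely continuous across the interfaces, so that the
  layerwise equations hold in the sense needed by \<open>heat_solution_identity\<close>.\<close>

lemma matched_primitives:
  assumes M: "matched z A B"
  defines "d \<equiv> \<lambda>x. glue (flux z A B) x / of_real (conductivity m b \<gamma> x)"
  shows "is_primitive (b m) (glue (wave z A B)) d" "d \<in> L2 {0<..<b m}"
    "is_primitive (b m) (glue (flux z A B)) (\<lambda>x. z\<^sup>2 * glue (wave z A B) x)"
    "AE x in lebesgue_on {0<..<b m}. of_real (conductivity m b \<gamma> x) * d x = glue (flux z A B) x"
proof -
  let ?M = "lebesgue_on {0<..<b m}"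
  have cw: "continuous_on {0..b m} (glue (wave z A B))" and cf: "continuous_on {0..b m} (glue (flux z A B))"
    using continuous_on_glue_wave[OF M] continuous_on_glue_flux[OF M] continuous_on_subset by blast+
  note [measurable] = measurable_continuous_on_interval[OF cf]
  have dm: "d \<in> borel_measurable ?M"
    unfolding d_def conductivity_def by measurable
  obtain Q where Q: "Q > 0" "\<And>x. x \<in> {0..b m} \<Longrightarrow> norm (glue (flux z A B) x) \<le> Q"
    using continuous_on_bound_interval[OF cf] by blast
  define G where "G = (\<Sum>j=1..m. 1 / \<gamma> j)"
  have G: "1 / \<gamma> j \<le> G" if "j \<in> {1..m}" for j
    unfolding G_def by (rule member_le_sum[OF that]) (use \<gamma>_pos in \<open>auto intro: less_imp_le\<close>)
  have G0: "0 \<le> G" unfolding G_def by (rule sum_nonneg) (use \<gamma>_pos in \<open>auto intro: less_imp_le\<close>)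
  define d' where "d' x = (if x \<in> interfaces then 0 else d x)" for x
  have neg: "AE x in ?M. x \<notin> interfaces"
  proof -
    have "AE x in lebesgue. x \<notin> interfaces"
      using finite_interfaces by (intro AE_not_in) (simp add: negligible_finite flip: negligible_iff_null_sets)
    then show ?thesis by (subst lebesgue_on_AE_iff) auto
  qed
  have dd: "d x = glue (flux z A B) x / of_real (\<gamma> (layer_index x))" if "x \<in> {0<..<b m}" "x \<notin> interfaces" for x
    unfolding d_def using conductivity_eq[OF that] by simp
  have ae: "AE x in ?M. d' x = d x"
    using neg by eventually_elim (simp add: d'_def)
  have ae': "AE x in ?M. d x = d' x"
    using neg by eventually_elim (simp add: d'_def)
  have d'L: "d' \<in> L2 {0<..<b m}"
  proof (rule bounded_in_L2)
    show "d' \<in> borel_measurable ?M"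
      using borel_measurable_lebesgue_on_AE[OF _ dm ae'] by simp
    show "cmod (d' x) \<le> Q * G" if x: "x \<in> {0<..<b m}" for x
    proof (cases "x \<in> interfaces")
      case False
      have g: "\<gamma> (layer_index x) > 0" using \<gamma>_pos layer_index_props(1) by blast
      have "cmod (d' x) = norm (glue (flux z A B) x) * (1 / \<gamma> (layer_index x))"
        using False dd[OF x False] g by (simp add: d'_def norm_divide)
      also have "\<dots> \<le> Q * G"
        using x Q g G[OF layer_index_props(1)[of x]] by (intro mult_mono) auto
      finally show ?thesis .
    qed (use Q G0 in \<open>simp add: d'_def\<close>)
  qed
  have "integrable ?M (\<lambda>x. (cmod (d x))\<^sup>2)"
  proof (rule integrable_lebesgue_on_AE)
    show "integrable ?M (\<lambda>x. (cmod (d' x))\<^sup>2)" using d'L by (simp add: L2_def)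
    show "AE x in ?M. (cmod (d' x))\<^sup>2 = (cmod (d x))\<^sup>2" using ae by eventually_elim simp
  qed simp
  then show dL: "d \<in> L2 {0<..<b m}" using dm by (simp add: L2_def)
  show "is_primitive (b m) (glue (wave z A B)) d"
  proof (rule is_primitive_vector_derivative[OF L2_integrable[OF dL] cw finite_interfaces])
    fix x assume "x \<in> {0<..<b m} - interfaces"
    then show "(glue (wave z A B) has_vector_derivative d x) (at x)"
      using glue_wave_derivative[of x z A B] dd[of x] by simp
  qed
  have cz: "continuous_on {0..b m} (\<lambda>x. z\<^sup>2 * glue (wave z A B) x)"
    by (intro continuous_intros cw)
  obtain P where P: "\<And>x. x \<in> {0..b m} \<Longrightarrow> norm (z\<^sup>2 * glue (wave z A B) x) \<le> P"
    using continuous_on_bound_interval[OF cz] by blast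
  have "integrable ?M (\<lambda>x. z\<^sup>2 * glue (wave z A B) x)"
  proof (rule integrable_bounded_on_interval[OF measurable_continuous_on_interval[OF cz]])
    show "norm (z\<^sup>2 * glue (wave z A B) x) \<le> P" if "x \<in> {0<..<b m}" for x
      using P[of x] that by simp
  qed
  then show "is_primitive (b m) (glue (flux z A B)) (\<lambda>x. z\<^sup>2 * glue (wave z A B) x)"
    by (rule is_primitive_vector_derivative[OF _ cf finite_interfaces]) (simp add: glue_flux_derivative)
  show "AE x in ?M. of_real (conductivity m b \<gamma> x) * d x = glue (flux z A B) x"
    using neg AE_space
  proof eventually_elim
    case (elim x)
    have "\<gamma> (layer_index x) > 0" using \<gamma>_pos layer_index_props(1) by blast
    then show ?case using elim dd[of x] conductivity_eq[of x] by simp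
  qed
qed

lemma is_Psi_glue:
  assumes M: "matched z A B" and A1: "A 1 = 1" and Bm: "B m = 0"
  shows "is_Psi m b \<gamma> z (glue (wave z A B))"
  unfolding is_Psi_def
proof (intro conjI ballI)
  show "\<exists>A' B'. A' 1 = 1 \<and> B' m = 0 \<and>
        (\<forall>j\<in>{1..m}. \<forall>x\<in>layer m b j. glue (wave z A B) x =
             A' j * exp (of_real x * (z / of_real (sqrt (\<gamma> j))))
             + B' j * exp (- of_real x * (z / of_real (sqrt (\<gamma> j)))))"
    using A1 Bm by (intro exI[of _ A] exI[of _ B]) (simp add: glue_layer wave_def)
  fix j assume j: "j \<in> {1..<m}"
  show "isCont (glue (wave z A B)) (b j)"
    using continuous_on_glue_wave[OF M] by (simp add: continuous_on_eq_continuous_at)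
  have fl: "(glue (flux z A B) \<longlongrightarrow> glue (flux z A B) (b j)) (at (b j))"
    using continuous_on_glue_flux[OF M] by (simp add: continuous_on_eq_continuous_at isCont_def)
  have "open (- (interfaces - {b j}))"
    using finite_interfaces by (intro open_Compl finite_imp_closed) auto
  then have "\<forall>\<^sub>F x in at (b j). x \<in> - (interfaces - {b j})"
    by (intro eventually_at_in_open') auto
  moreover have "\<forall>\<^sub>F x in at (b j). x \<noteq> b j"
    by (simp add: eventually_at_filter)
  ultimately have "\<forall>\<^sub>F x in at (b j). glue (flux z A B) x =
     of_real (conductivity_ext m b \<gamma> x) * vector_derivative (glue (wave z A B)) (at x)"
  proof eventually_elim
    case (elim x)
    then have x: "x \<notin> interfaces" by auto
    have "\<gamma> (layer_index x) > 0" using \<gamma>_pos layer_index_props(1) by blast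
    then show ?case
      using vector_derivative_at[OF glue_wave_derivative[OF x]] conductivity_ext_eq[OF x] by simp
  qed
  from Lim_transform_eventually[OF fl this]
  show "\<exists>l. ((\<lambda>x. of_real (conductivity_ext m b \<gamma> x) * vector_derivative (glue (wave z A B)) (at x)) \<longlongrightarrow> l) (at (b j))"
    by blast
qed

lemma eventually_layer_left: "j \<in> {1..m} \<Longrightarrow> \<forall>\<^sub>F x in at_left (b j). x \<in> layer m b j"
  unfolding eventually_at_left_field
  by (intro exI[of _ "b (j - 1)"]) (auto simp: layer_def intro: b_strict_mono)

lemma eventually_layer_right: "j \<in> {1..<m} \<Longrightarrow> \<forall>\<^sub>F x in at_right (b j). x \<in> layer m b (j + 1)"
  unfolding eventually_at_right_field
  by (intro exI[of _ "b (j + 1)"]) (use b_less[of j] in \<open>auto simp: layer_def\<close>)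

lemma is_Psi_imp_matched:
  assumes P: "is_Psi m b \<gamma> z \<Psi>"
  obtains A B where "A 1 = 1" "B m = 0" "matched z A B" "\<Psi> = glue (wave z A B)"
proof -
  obtain A B where A1: "A 1 = 1" and Bm: "B m = 0"
    and eq: "\<And>j x. j \<in> {1..m} \<Longrightarrow> x \<in> layer m b j \<Longrightarrow> \<Psi> x = wave z A B j x"
    using P unfolding is_Psi_def wave_def by blast
  have cont: "isCont \<Psi> (b j)" if "j \<in> {1..<m}" for j
    using P that by (auto simp: is_Psi_def)
  have der: "of_real (conductivity_ext m b \<gamma> x) * vector_derivative \<Psi> (at x) = flux z A B j x"
    if j: "j \<in> {1..m}" and x: "x \<in> layer m b j" for j x
  proof -
    have "(\<Psi> has_vector_derivative flux z A B j x / of_real (\<gamma> j)) (at x)"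
      by (rule has_vector_derivative_transform_within_open[OF wave_derivative[OF j] open_layer x])
        (simp add: eq[OF j])
    from vector_derivative_at[OF this] show ?thesis
      using conductivity_ext_eq[OF layer_no_interface[OF j x]] layer_index_layer[OF j x]
        \<gamma>_pos[OF j] by simp
  qed
  have wl: "\<Psi> (b j) = wave z A B j (b j)" and wr: "\<Psi> (b j) = wave z A B (j + 1) (b j)"
    and fl: "flux z A B j (b j) = flux z A B (j + 1) (b j)" if j: "j \<in> {1..<m}" for j
  proof -
    have lim: "(\<Psi> \<longlongrightarrow> \<Psi> (b j)) (at (b j))" using cont[OF j] by (simp add: isCont_def)
    have jm: "j \<in> {1..m}" "j + 1 \<in> {1..m}" using j by auto
    have L: "\<forall>\<^sub>F x in at_left (b j). \<Psi> x = wave z A B j x"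
      using eventually_layer_left[OF jm(1)] by eventually_elim (rule eq[OF jm(1)])
    have R: "\<forall>\<^sub>F x in at_right (b j). \<Psi> x = wave z A B (j + 1) x"
      using eventually_layer_right[OF j] by eventually_elim (rule eq[OF jm(2)])
    have cw: "(wave z A B i \<longlongrightarrow> wave z A B i (b j)) (at (b j) within S)" for i S
      by (rule tendsto_within_subset[OF _ subset_UNIV])
        (use continuous_on_wave[of UNIV z A B i] in \<open>simp add: continuous_on_eq_continuous_at isCont_def\<close>)
    have cf: "(flux z A B i \<longlongrightarrow> flux z A B i (b j)) (at (b j) within S)" for i S
      by (rule tendsto_within_subset[OF _ subset_UNIV])
        (use continuous_on_flux[of UNIV z A B i] in \<open>simp add: continuous_on_eq_continuous_at isCont_def\<close>)
    have "(wave z A B j \<longlongrightarrow> \<Psi> (b j)) (at_left (b j))"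
      by (rule Lim_transform_eventually[OF tendsto_within_subset[OF lim] L]) simp
    then show "\<Psi> (b j) = wave z A B j (b j)"
      by (rule tendsto_unique[OF trivial_limit_at_left_real _ cw])
    have "(wave z A B (j + 1) \<longlongrightarrow> \<Psi> (b j)) (at_right (b j))"
      by (rule Lim_transform_eventually[OF tendsto_within_subset[OF lim] R]) simp
    then show "\<Psi> (b j) = wave z A B (j + 1) (b j)"
      by (rule tendsto_unique[OF trivial_limit_at_right_real _ cw])
    obtain l where l: "((\<lambda>x. of_real (conductivity_ext m b \<gamma> x) * vector_derivative \<Psi> (at x)) \<longlongrightarrow> l) (at (b j))"
      using P j unfolding is_Psi_def by blast
    have "\<forall>\<^sub>F x in at_left (b j). of_real (conductivity_ext m b \<gamma> x) * vector_derivative \<Psi> (at x) = flux z A B j x"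
      using eventually_layer_left[OF jm(1)] by eventually_elim (rule der[OF jm(1)])
    then have "(flux z A B j \<longlongrightarrow> l) (at_left (b j))"
      by (rule Lim_transform_eventually[OF tendsto_within_subset[OF l], rotated]) simp
    then have "l = flux z A B j (b j)"
      by (rule tendsto_unique[OF trivial_limit_at_left_real _ cf])
    moreover have "\<forall>\<^sub>F x in at_right (b j). of_real (conductivity_ext m b \<gamma> x) * vector_derivative \<Psi> (at x) = flux z A B (j + 1) x"
      using eventually_layer_right[OF j] by eventually_elim (rule der[OF jm(2)])
    then have "(flux z A B (j + 1) \<longlongrightarrow> l) (at_right (b j))"
      by (rule Lim_transform_eventually[OF tendsto_within_subset[OF l], rotated]) simp
    then have "l = flux z A B (j + 1) (b j)"
      by (rule tendsto_unique[OF trivial_limit_at_right_real _ cf])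
    ultimately show "flux z A B j (b j) = flux z A B (j + 1) (b j)" by simp
  qed
  have "matched z A B"
    unfolding matched_def
  proof (intro ballI conjI)
    fix j assume j: "j \<in> {1..<m}"
    show "wave z A B j (b j) = wave z A B (j + 1) (b j)"
      using wl[OF j] wr[OF j] by (rule trans[OF sym])
    show "flux z A B j (b j) = flux z A B (j + 1) (b j)"
      by (rule fl[OF j])
  qed
  moreover have "\<Psi> x = glue (wave z A B) x" for x
  proof (cases "x \<in> interfaces")
    case True
    then obtain j where j: "j \<in> {1..<m}" "x = b j" by (auto simp: interfaces_def)
    then show ?thesis using wl layer_index_interface[of j] by (simp add: glue_def)
  next
    case False
    then show ?thesis
      using eq[OF layer_index_props(1) in_layer_index] by (simp add: glue_def)
  qed
  ultimately show ?thesis using A1 Bm that by blast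
qed

end

section \<open>Size of the exponential solutions\<close>

text \<open>The passage through an interface, \<open>r\<close> being the ratio of the square roots of the two
  conductivities: \<open>x\<close> and \<open>y\<close> are the amplitudes on one side, half of the two combinations those on the
  other side. A dominant amplitude stays dominant and changes at most by a factor. The first
  inequality follows from
  \<open>\<bar>(1 + r) x + (1 - r) y\<bar>\<^sup>2 - \<bar>(1 - r) x + (1 + r) y\<bar>\<^sup>2 = 4 r (\<bar>x\<bar>\<^sup>2 - \<bar>y\<bar>\<^sup>2)\<close>.\<close>

lemma transmission_dominance:
  fixes x y :: complex and r :: real
  assumes r: "r > 0" and xy: "cmod y \<le> cmod x"
  shows "cmod (of_real (1 - r) * x + of_real (1 + r) * y) \<le> cmod (of_real (1 + r) * x + of_real (1 - r) * y)"
proof (rule power2_le_imp_le)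
  have "(cmod (of_real (1 + r) * x + of_real (1 - r) * y))\<^sup>2 - (cmod (of_real (1 - r) * x + of_real (1 + r) * y))\<^sup>2 
     = 4 * r * ((cmod x)\<^sup>2 - (cmod y)\<^sup>2)"
    unfolding cmod_power2 by (simp add: power2_eq_square algebra_simps)
  moreover have "(cmod y)\<^sup>2 \<le> (cmod x)\<^sup>2" using xy by (simp add: power_mono)
  then have "0 \<le> 4 * r * ((cmod x)\<^sup>2 - (cmod y)\<^sup>2)" using r by simp
  ultimately show "(cmod (of_real (1 - r) * x + of_real (1 + r) * y))\<^sup>2 \<le> (cmod (of_real (1 + r) * x + of_real (1 - r) * y))\<^sup>2"
    by linarith
qed simp

lemma transmission_bounds:
  fixes x y :: complex and r K :: real
  assumes r: "r > 0" and xy: "cmod y \<le> cmod x" and K: "1 \<le> K" "r \<le> K" "1 / r \<le> K"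
  shows "cmod x \<le> K * cmod ((of_real (1 + r) * x + of_real (1 - r) * y) / 2)"
    "cmod ((of_real (1 + r) * x + of_real (1 - r) * y) / 2) \<le> K * cmod x"
proof -
  have n1: "cmod (of_real (1 + r) * x) = (1 + r) * cmod x" 
    using r by (simp only: norm_mult norm_of_real abs_of_pos add_pos_pos zero_less_one)
  have n2: "cmod (of_real (1 - r) * y) \<le> \<bar>1 - r\<bar> * cmod x"
    using xy by (simp only: norm_mult norm_of_real mult_left_mono abs_ge_zero)
  have lo: "((1 + r) - \<bar>1 - r\<bar>) * cmod x \<le> cmod (of_real (1 + r) * x + of_real (1 - r) * y)"
    using norm_diff_ineq[of "of_real (1 + r) * x" "of_real (1 - r) * y"] n1 n2 unfolding left_diff_distrib by linarith
  have up: "cmod (of_real (1 + r) * x + of_real (1 - r) * y) \<le> ((1 + r) + \<bar>1 - r\<bar>) * cmod x"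
    using norm_triangle_ineq[of "of_real (1 + r) * x" "of_real (1 - r) * y"] n1 n2 unfolding distrib_right by linarith
  have "(1 + r) + \<bar>1 - r\<bar> \<le> 2 * K" using K r by (auto simp: abs_if)
  then have "((1 + r) + \<bar>1 - r\<bar>) * cmod x \<le> 2 * K * cmod x" by (rule mult_right_mono) simp
  then show "cmod ((of_real (1 + r) * x + of_real (1 - r) * y) / 2) \<le> K * cmod x"
    using up unfolding norm_divide by simp
  have "1 \<le> K * r" using K r by (simp add: divide_le_eq)
  then have "2 \<le> K * ((1 + r) - \<bar>1 - r\<bar>)" using K r by (auto simp: abs_if algebra_simps)
  then have "2 * cmod x \<le> K * ((1 + r) - \<bar>1 - r\<bar>) * cmod x" by (rule mult_right_mono) simp
  also have "\<dots> \<le> K * cmod (of_real (1 + r) * x + of_real (1 - r) * y)"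
    using mult_left_mono[OF lo, of K] K by (simp only: mult.assoc)
  finally show "cmod x \<le> K * cmod ((of_real (1 + r) * x + of_real (1 - r) * y) / 2)"
    unfolding norm_divide by simp
qed

context layered_rod
begin

text \<open>For \<open>Re z < 0\<close>, the parts of a wave that decay and grow from left to right.\<close>

definition dec :: "complex \<Rightarrow> (nat \<Rightarrow> complex) \<Rightarrow> nat \<Rightarrow> real \<Rightarrow> complex" where
  "dec z A j x = A j * exp (of_real x * (z / of_real (sqrt (\<gamma> j))))"

definition gro :: "complex \<Rightarrow> (nat \<Rightarrow> complex) \<Rightarrow> nat \<Rightarrow> real \<Rightarrow> complex" where
  "gro z B j x = B j * exp (- of_real x * (z / of_real (sqrt (\<gamma> j))))"

lemma wave_dec_gro: "wave z A B j x = dec z A j x + gro z B j x"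
  by (simp add: wave_def dec_def gro_def)

lemma flux_dec_gro: "flux z A B j x = of_real (sqrt (\<gamma> j)) * z * (dec z A j x - gro z B j x)"
  by (simp add: flux_def dec_def gro_def)

lemma norm_dec_shift:
  "cmod (dec z A j y) = cmod (dec z A j x) * exp (- Re z * ((x - y) / sqrt (\<gamma> j)))"
  by (simp add: dec_def norm_mult algebra_simps diff_divide_distrib flip: exp_add)

lemma norm_gro_shift:
  "cmod (gro z B j y) = cmod (gro z B j x) * exp (- Re z * ((y - x) / sqrt (\<gamma> j)))"
  by (simp add: gro_def norm_mult algebra_simps diff_divide_distrib flip: exp_add)

lemma matched_iff:
  assumes z: "z \<noteq> 0"
  shows "matched z A B \<longleftrightarrow> (\<forall>j\<in>{1..<m}. 
     dec z A j (b j) + gro z B j (b j) = dec z A (j + 1) (b j) + gro z B (j + 1) (b j) \<and>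
     of_real (sqrt (\<gamma> j)) * (dec z A j (b j) - gro z B j (b j)) 
       = of_real (sqrt (\<gamma> (j + 1))) * (dec z A (j + 1) (b j) - gro z B (j + 1) (b j)))"
proof -
  have "(k * z * p = l * z * q) = (k * p = l * q)" for k l p q :: complex
    using z by (metis mult.assoc mult.left_commute mult_left_cancel)
  then show ?thesis
    unfolding matched_def wave_dec_gro flux_dec_gro by simp
qed

lemma sqrt_\<gamma>_pos: "j \<in> {1..m} \<Longrightarrow> sqrt (\<gamma> j) > 0"
  using \<gamma>_pos by simp

lemma matched_transmission:
  assumes M: "matched z A B" and z: "z \<noteq> 0" and j: "j \<in> {1..<m}"
  defines "r \<equiv> sqrt (\<gamma> (j + 1)) / sqrt (\<gamma> j)"
  shows "dec z A j (b j) = (of_real (1 + r) * dec z A (j + 1) (b j) + of_real (1 - r) * gro z B (j + 1) (b j)) / 2"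
    "gro z B j (b j) = (of_real (1 - r) * dec z A (j + 1) (b j) + of_real (1 + r) * gro z B (j + 1) (b j)) / 2"
    "dec z A (j + 1) (b j) = (of_real (1 - 1 / r) * gro z B j (b j) + of_real (1 + 1 / r) * dec z A j (b j)) / 2"
    "gro z B (j + 1) (b j) = (of_real (1 + 1 / r) * gro z B j (b j) + of_real (1 - 1 / r) * dec z A j (b j)) / 2"
proof -
  let ?p = "dec z A j (b j)" and ?q = "gro z B j (b j)" 
  let ?p' = "dec z A (j + 1) (b j)" and ?q' = "gro z B (j + 1) (b j)"
  have k: "sqrt (\<gamma> j) > 0" "sqrt (\<gamma> (j + 1)) > 0" using sqrt_\<gamma>_pos j by auto
  have r: "r > 0" using k by (simp add: r_def)
  have s: "?p + ?q = ?p' + ?q'"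
    and "of_real (sqrt (\<gamma> j)) * (?p - ?q) = of_real (sqrt (\<gamma> (j + 1))) * (?p' - ?q')"
    using M j unfolding matched_iff[OF z] by blast+
  then have d: "?p - ?q = of_real r * (?p' - ?q')"
    using k by (simp add: r_def field_simps)
  then have d': "?p' - ?q' = of_real (1 / r) * (?p - ?q)"
    using r by simp
  have "?p = ((?p + ?q) + (?p - ?q)) / 2" "?q = ((?p + ?q) - (?p - ?q)) / 2" by simp_all
  then show "?p = (of_real (1 + r) * ?p' + of_real (1 - r) * ?q') / 2" "?q = (of_real (1 - r) * ?p' + of_real (1 + r) * ?q') / 2"
    unfolding s d by (simp_all add: algebra_simps)
  have "?p' = ((?p' + ?q') + (?p' - ?q')) / 2" "?q' = ((?p' + ?q') - (?p' - ?q')) / 2" by simp_all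
  then show "?p' = (of_real (1 - 1 / r) * ?q + of_real (1 + 1 / r) * ?p) / 2" "?q' = (of_real (1 + 1 / r) * ?q + of_real (1 - 1 / r) * ?p) / 2"
    unfolding s[symmetric] d' by (simp_all add: algebra_simps)
qed

text \<open>A bound for the ratios of neighbouring \<open>sqrt (\<gamma> j)\<close> and their inverses.\<close>

definition contrast :: real where
  "contrast = 1 + (\<Sum>j=1..<m. sqrt (\<gamma> (j + 1)) / sqrt (\<gamma> j) + sqrt (\<gamma> j) / sqrt (\<gamma> (j + 1)))"

lemma contrast:
  shows "1 \<le> contrast"
    "j \<in> {1..<m} \<Longrightarrow> sqrt (\<gamma> (j + 1)) / sqrt (\<gamma> j) \<le> contrast"
    "j \<in> {1..<m} \<Longrightarrow> sqrt (\<gamma> j) / sqrt (\<gamma> (j + 1)) \<le> contrast"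
proof -
  let ?f = "\<lambda>j. sqrt (\<gamma> (j + 1)) / sqrt (\<gamma> j) + sqrt (\<gamma> j) / sqrt (\<gamma> (j + 1))"
  have pos: "0 \<le> sqrt (\<gamma> (j + 1)) / sqrt (\<gamma> j)" "0 \<le> sqrt (\<gamma> j) / sqrt (\<gamma> (j + 1))" if "j \<in> {1..<m}" for j
    using sqrt_\<gamma>_pos[of j] sqrt_\<gamma>_pos[of "j + 1"] that by (auto intro!: divide_nonneg_nonneg)
  have nn: "0 \<le> ?f j" if "j \<in> {1..<m}" for j
    using pos[OF that] by simp
  show "1 \<le> contrast" unfolding contrast_def using sum_nonneg[of "{1..<m}" ?f] nn by simp
  assume j: "j \<in> {1..<m}"
  have "?f j \<le> (\<Sum>j=1..<m. ?f j)"
    by (rule member_le_sum[OF j]) (use nn in auto)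
  then show "sqrt (\<gamma> (j + 1)) / sqrt (\<gamma> j) \<le> contrast" "sqrt (\<gamma> j) / sqrt (\<gamma> (j + 1)) \<le> contrast"
    unfolding contrast_def using pos[OF j] by linarith+
qed

text \<open>Travel time from \<open>0\<close> to \<open>b j\<close> at speed \<open>sqrt (\<gamma> i)\<close> on the \<open>i\<close>-th layer.\<close>

definition travel :: "nat \<Rightarrow> real" where
  "travel j = (\<Sum>i=1..j. (b i - b (i - 1)) / sqrt (\<gamma> i))"

lemma travel_Suc: "travel (j + 1) = travel j + (b (j + 1) - b j) / sqrt (\<gamma> (j + 1))"
  by (simp add: travel_def)

lemma travel_0: "travel 0 = 0"
  by (simp add: travel_def)

lemma travel_mono: "i \<le> j \<Longrightarrow> j \<le> m \<Longrightarrow> travel i \<le> travel j"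
proof (induction j)
  case (Suc j)
  then have "0 \<le> (b (j + 1) - b j) / sqrt (\<gamma> (j + 1))"
    using b_less[of j] sqrt_\<gamma>_pos[of "j + 1"] by simp
  then show ?case using Suc travel_Suc[of j] by (cases "i = Suc j") auto
qed simp

lemma travel_total:
  "travel m = b 1 / sqrt (\<gamma> 1) + (\<Sum>j=1..m-1. (b (j + 1) - b j) / sqrt (\<gamma> (j + 1)))"
proof -
  obtain n where n: "m = Suc n" using m by (cases m) auto
  have "travel (Suc n) = b 1 / sqrt (\<gamma> 1) + (\<Sum>j=1..n. (b (j + 1) - b j) / sqrt (\<gamma> (j + 1)))"
    by (induction n) (auto simp: travel_def b0)
  then show ?thesis using n by simp
qed

text \<open>From right to left: if the decaying part dominates at \<open>b m\<close>, it dominates at the right end of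
  every layer. Its modulus there is, up to a power of \<open>contrast\<close>, its modulus at \<open>b m\<close> times the
  exponential of \<open>- Re z\<close> times the travel time in between.\<close>

lemma decaying_bounds:
  assumes M: "matched z A B" and z: "Re z < 0" and dom: "cmod (gro z B m (b m)) \<le> cmod (dec z A m (b m))"
  assumes j: "1 \<le> j" "j \<le> m"
  shows "cmod (gro z B j (b j)) \<le> cmod (dec z A j (b j)) \<and>
     cmod (dec z A m (b m)) * exp (- Re z * (travel m - travel j)) \<le> contrast ^ (m - j) * cmod (dec z A j (b j)) \<and>
     cmod (dec z A j (b j)) \<le> contrast ^ (m - j) * (cmod (dec z A m (b m)) * exp (- Re z * (travel m - travel j)))"
  using j(2,1)
proof (induction j rule: inc_induct)
  case base
  then show ?case using dom by simp
next
  case (step j)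
  have j: "j \<in> {1..<m}" using step by auto
  let ?K = "contrast" and ?n = "m - Suc j"
  let ?\<delta> = "(b (j + 1) - b j) / sqrt (\<gamma> (j + 1))"
  have z0: "z \<noteq> 0" using z by auto
  note k = sqrt_\<gamma>_pos[of j] sqrt_\<gamma>_pos[of "j + 1"]
  have \<delta>: "0 \<le> - Re z * ?\<delta>"
    using z b_less[of j] k j by (intro mult_nonneg_nonneg divide_nonneg_nonneg) auto
  define p where "p = dec z A (j + 1) (b j)"
  define q where "q = gro z B (j + 1) (b j)"
  have p: "cmod p = cmod (dec z A (j + 1) (b (j + 1))) * exp (- Re z * ?\<delta>)"
    unfolding p_def by (rule norm_dec_shift)
  have "cmod q = cmod (gro z B (j + 1) (b (j + 1))) * exp (- Re z * ((b j - b (j + 1)) / sqrt (\<gamma> (j + 1))))"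
    unfolding q_def by (rule norm_gro_shift)
  also have "- Re z * ((b j - b (j + 1)) / sqrt (\<gamma> (j + 1))) = - (- Re z * ?\<delta>)"
    by (simp add: algebra_simps diff_divide_distrib)
  also have "cmod (gro z B (j + 1) (b (j + 1))) * exp (- (- Re z * ?\<delta>)) \<le> cmod (dec z A (j + 1) (b (j + 1))) * exp (- Re z * ?\<delta>)"
    using step \<delta> by (intro mult_mono) auto
  finally have pq: "cmod q \<le> cmod p" using p by simp
  let ?r = "sqrt (\<gamma> (j + 1)) / sqrt (\<gamma> j)"
  have r: "?r > 0" using k j by simp
  have Kr: "1 / ?r \<le> ?K" using contrast(3)[OF j] by simp
  note t = matched_transmission(1,2)[OF M z0 j, folded p_def q_def]
  note bd = transmission_bounds[OF r pq contrast(1) contrast(2)[OF j] Kr, folded t(1)]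
  have e: "exp (- Re z * (travel m - travel j)) = exp (- Re z * (travel m - travel (Suc j))) * exp (- Re z * ?\<delta>)"
    using travel_Suc[of j] by (simp add: algebra_simps flip: exp_add)
  have Kn: "?K ^ (m - j) = ?K * ?K ^ ?n"
    using j by (simp add: Suc_diff_Suc flip: power_Suc)
  have K0: "0 \<le> ?K" using contrast(1) by simp
  have "cmod (gro z B j (b j)) \<le> cmod (dec z A j (b j))"
    using transmission_dominance[OF r pq] unfolding t norm_divide by (simp add: divide_right_mono)
  moreover have "cmod (dec z A m (b m)) * exp (- Re z * (travel m - travel j)) \<le> ?K ^ (m - j) * cmod (dec z A j (b j))"
  proof -
    have "cmod (dec z A m (b m)) * exp (- Re z * (travel m - travel j)) 
       \<le> ?K ^ ?n * cmod (dec z A (Suc j) (b (Suc j))) * exp (- Re z * ?\<delta>)"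
      unfolding e using mult_right_mono[of _ _ "exp (- Re z * ?\<delta>)"] step by (simp add: mult.assoc)
    also have "\<dots> = ?K ^ ?n * cmod p" using p by simp
    also have "\<dots> \<le> ?K ^ ?n * (?K * cmod (dec z A j (b j)))"
      using bd(1) K0 by (intro mult_left_mono) auto
    finally show ?thesis unfolding Kn by (simp add: mult_ac)
  qed
  moreover have "cmod (dec z A j (b j)) \<le> ?K ^ (m - j) * (cmod (dec z A m (b m)) * exp (- Re z * (travel m - travel j)))"
  proof -
    have "cmod (dec z A j (b j)) \<le> ?K * cmod p" by (rule bd(2))
    also have "\<dots> = ?K * (cmod (dec z A (Suc j) (b (Suc j))) * exp (- Re z * ?\<delta>))" using p by simp
    also have "\<dots> \<le> ?K * ((?K ^ ?n * (cmod (dec z A m (b m)) * exp (- Re z * (travel m - travel (Suc j))))) * exp (- Re z * ?\<delta>))"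
      using step K0 by (intro mult_left_mono mult_right_mono) auto
    finally show ?thesis unfolding Kn e by (simp add: mult_ac)
  qed
  ultimately show ?case by blast
qed

text \<open>The mirror image, from left to right: if the growing part dominates at 0, it dominates at the
  left end of every layer.\<close>

lemma growing_bounds:
  assumes M: "matched z A B" and z: "Re z < 0" and start: "cmod (A 1) \<le> cmod (B 1)"
  assumes j: "Suc 0 \<le> j" "j \<le> m"
  shows "cmod (dec z A j (b (j - 1))) \<le> cmod (gro z B j (b (j - 1))) \<and>
     cmod (B 1) * exp (- Re z * travel (j - 1)) \<le> contrast ^ (j - 1) * cmod (gro z B j (b (j - 1))) \<and>
     cmod (gro z B j (b (j - 1))) \<le> contrast ^ (j - 1) * (cmod (B 1) * exp (- Re z * travel (j - 1)))"
  using j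
proof (induction j rule: dec_induct)
  case base
  show ?case using start by (simp add: dec_def gro_def b0 travel_0)
next
  case (step j)
  have j: "j \<in> {1..<m}" using step by auto
  let ?K = "contrast" 
  let ?\<delta> = "(b j - b (j - 1)) / sqrt (\<gamma> j)"
  have z0: "z \<noteq> 0" using z by auto
  note k = sqrt_\<gamma>_pos[of j] sqrt_\<gamma>_pos[of "j + 1"]
  have \<delta>: "0 \<le> - Re z * ?\<delta>"
    using z b_mono[of "j - 1" j] k j by (intro mult_nonneg_nonneg divide_nonneg_nonneg) auto
  define p where "p = dec z A j (b j)"
  define q where "q = gro z B j (b j)"
  have q: "cmod q = cmod (gro z B j (b (j - 1))) * exp (- Re z * ?\<delta>)"
    unfolding q_def by (rule norm_gro_shift)
  have "cmod p = cmod (dec z A j (b (j - 1))) * exp (- Re z * ((b (j - 1) - b j) / sqrt (\<gamma> j)))"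
    unfolding p_def by (rule norm_dec_shift)
  also have "- Re z * ((b (j - 1) - b j) / sqrt (\<gamma> j)) = - (- Re z * ?\<delta>)"
    by (simp add: algebra_simps diff_divide_distrib)
  also have "cmod (dec z A j (b (j - 1))) * exp (- (- Re z * ?\<delta>)) \<le> cmod (gro z B j (b (j - 1))) * exp (- Re z * ?\<delta>)"
    using step \<delta> by (intro mult_mono) auto
  finally have pq: "cmod p \<le> cmod q" using q by simp
  define r where "r = 1 / (sqrt (\<gamma> (j + 1)) / sqrt (\<gamma> j))"
  have r: "r > 0" and Kr: "r \<le> ?K" "1 / r \<le> ?K" 
    using k j contrast(2,3)[OF j] by (simp_all add: r_def)
  note t = matched_transmission(3,4)[OF M z0 j, folded p_def q_def]
  have t': "dec z A (j + 1) (b j) = (of_real (1 - r) * q + of_real (1 + r) * p) / 2"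
    "gro z B (j + 1) (b j) = (of_real (1 + r) * q + of_real (1 - r) * p) / 2"
    unfolding t r_def by simp_all
  note bd = transmission_bounds[OF r pq contrast(1) Kr, folded t'(2)]
  have "travel j = travel (j - 1) + ?\<delta>" using travel_Suc[of "j - 1"] j by simp
  then have e: "exp (- Re z * travel j) = exp (- Re z * travel (j - 1)) * exp (- Re z * ?\<delta>)"
    by (simp add: algebra_simps flip: exp_add)
  have Kn: "?K ^ j = ?K * ?K ^ (j - 1)"
    using j by (simp flip: power_Suc)
  have K0: "0 \<le> ?K" using contrast(1) by simp
  have "cmod (dec z A (j + 1) (b j)) \<le> cmod (gro z B (j + 1) (b j))"
    using transmission_dominance[OF r pq] unfolding t' norm_divide by (simp add: divide_right_mono)
  moreover have "cmod (B 1) * exp (- Re z * travel j) \<le> ?K ^ j * cmod (gro z B (j + 1) (b j))"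
  proof -
    have "cmod (B 1) * exp (- Re z * travel j) 
       \<le> ?K ^ (j - 1) * cmod (gro z B j (b (j - 1))) * exp (- Re z * ?\<delta>)"
      unfolding e using mult_right_mono[of _ _ "exp (- Re z * ?\<delta>)"] step by (simp add: mult.assoc)
    also have "\<dots> = ?K ^ (j - 1) * cmod q" using q by simp
    also have "\<dots> \<le> ?K ^ (j - 1) * (?K * cmod (gro z B (j + 1) (b j)))"
      using bd(1) K0 by (intro mult_left_mono) auto
    finally show ?thesis unfolding Kn by (simp add: mult_ac)
  qed
  moreover have "cmod (gro z B (j + 1) (b j)) \<le> ?K ^ j * (cmod (B 1) * exp (- Re z * travel j))"
  proof -
    have "cmod (gro z B (j + 1) (b j)) \<le> ?K * cmod q" by (rule bd(2))
    also have "\<dots> = ?K * (cmod (gro z B j (b (j - 1))) * exp (- Re z * ?\<delta>))" using q by simp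
    also have "\<dots> \<le> ?K * ((?K ^ (j - 1) * (cmod (B 1) * exp (- Re z * travel (j - 1)))) * exp (- Re z * ?\<delta>))"
      using step K0 by (intro mult_left_mono mult_right_mono) auto
    finally show ?thesis unfolding Kn e by (simp add: mult_ac)
  qed
  ultimately show ?case by simp
qed

section \<open>Existence and uniqueness of the solution with one incoming wave\<close>

text \<open>The transmission conditions determine the amplitudes on a layer from those on the layer to its
  left.\<close>

lemma matched_exists:
  assumes z: "z \<noteq> 0"
  obtains A B where "A 1 = \<alpha>" "B 1 = \<beta>" "matched z A B"
proof -
  let ?k = "\<lambda>j. complex_of_real (sqrt (\<gamma> j))"
  define step where "step j p = (
     let w = fst p * exp (of_real (b j) * (z / ?k j)) + snd p * exp (- of_real (b j) * (z / ?k j));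
         f = ?k j / ?k (j + 1) * (fst p * exp (of_real (b j) * (z / ?k j)) - snd p * exp (- of_real (b j) * (z / ?k j)))
     in ((w + f) / 2 / exp (of_real (b j) * (z / ?k (j + 1))), (w - f) / 2 / exp (- of_real (b j) * (z / ?k (j + 1)))))"
    for j and p :: "complex \<times> complex"
  define F where "F = rec_nat (\<alpha>, \<beta>) (\<lambda>n. step (n + 1))"
  define A where "A j = fst (F (j - 1))" for j
  define B where "B j = snd (F (j - 1))" for j
  have "matched z A B"
    unfolding matched_iff[OF z]
  proof
    fix j assume j: "j \<in> {1..<m}"
    have k: "?k j \<noteq> 0" "?k (j + 1) \<noteq> 0" 
      using sqrt_\<gamma>_pos[of j] sqrt_\<gamma>_pos[of "j + 1"] j by auto
    obtain n where n: "j = Suc n" using j by (cases j) auto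
    define w where "w = dec z A j (b j) + gro z B j (b j)"
    define f where "f = ?k j / ?k (j + 1) * (dec z A j (b j) - gro z B j (b j))"
    have F: "F j = step j (F (j - 1))" using n by (simp add: F_def)
    have d: "dec z A (j + 1) (b j) = (w + f) / 2"
      unfolding w_def f_def dec_def gro_def A_def B_def add_diff_cancel_right' F step_def by (simp add: Let_def)
    have g: "gro z B (j + 1) (b j) = (w - f) / 2"
      unfolding w_def f_def dec_def gro_def A_def B_def add_diff_cancel_right' F step_def by (simp add: Let_def)
    have "w = dec z A (j + 1) (b j) + gro z B (j + 1) (b j)" 
      "?k (j + 1) * f = ?k (j + 1) * (dec z A (j + 1) (b j) - gro z B (j + 1) (b j))"
      unfolding d g by (simp_all add: field_simps)
    moreover have "?k j * (dec z A j (b j) - gro z B j (b j)) = ?k (j + 1) * f"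
      using k by (simp add: f_def)
    ultimately show "dec z A j (b j) + gro z B j (b j) = dec z A (j + 1) (b j) + gro z B (j + 1) (b j) \<and>
       ?k j * (dec z A j (b j) - gro z B j (b j)) = ?k (j + 1) * (dec z A (j + 1) (b j) - gro z B (j + 1) (b j))"
      unfolding w_def by (intro conjI) (assumption, erule (1) trans)
  qed
  then show ?thesis using that[of A B] by (simp add: A_def B_def F_def)
qed

lemma wave_linear: "wave z (\<lambda>j. A j + k * A' j) (\<lambda>j. B j + k * B' j) j x = wave z A B j x + k * wave z A' B' j x"
  by (simp add: wave_def algebra_simps)

lemma flux_linear: "flux z (\<lambda>j. A j + k * A' j) (\<lambda>j. B j + k * B' j) j x = flux z A B j x + k * flux z A' B' j x"
  by (simp add: flux_def algebra_simps)

lemma matched_linear: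
  "matched z A B \<Longrightarrow> matched z A' B' \<Longrightarrow> matched z (\<lambda>j. A j + k * A' j) (\<lambda>j. B j + k * B' j)"
  by (simp add: matched_def wave_linear flux_linear)

text \<open>No incoming wave from either side: the solution vanishes.\<close>

lemma matched_zero:
  assumes M: "matched z A B" and z: "Re z < 0" and 0: "A 1 = 0" "B m = 0" and j: "j \<in> {1..m}"
  shows "A j = 0" "B j = 0"
proof -
  have end0: "cmod (gro z B m (b m)) \<le> cmod (dec z A m (b m))" using 0 by (simp add: gro_def)
  note bd = decaying_bounds[OF M z end0]
  have "dec z A 1 (b 1) = 0" using 0 by (simp add: dec_def)
  then have "cmod (dec z A m (b m)) * exp (- Re z * (travel m - travel 1)) \<le> 0" 
    using bd[of 1] m by simp
  then have "dec z A m (b m) = 0" by (simp add: mult_le_0_iff)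
  then have "dec z A j (b j) = 0" "gro z B j (b j) = 0" using bd[of j] j by auto
  then show "A j = 0" "B j = 0" by (auto simp: dec_def gro_def)
qed

text \<open>\<open>\<Psi>\<close> is a combination of the solutions that start with amplitudes \<open>(1, 0)\<close> and \<open>(0, 1)\<close> on the
  first layer; the coefficient \<open>B m\<close> of the second one is not 0 by \<open>matched_zero\<close>.\<close>

theorem Psi_coefficients:
  assumes z: "Re z < 0"
  obtains A B where "A 1 = 1" "B m = 0" "matched z A B" "Psi m b \<gamma> z = glue (wave z A B)"
proof -
  have z0: "z \<noteq> 0" using z by auto
  obtain A1 B1 where 1: "A1 1 = 1" "B1 1 = 0" "matched z A1 B1" 
    using matched_exists[OF z0, of 1 0] by blast
  obtain A2 B2 where 2: "A2 1 = 0" "B2 1 = 1" "matched z A2 B2" 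
    using matched_exists[OF z0, of 0 1] by blast
  have B2m: "B2 m \<noteq> 0"
    using matched_zero(2)[OF 2(3) z 2(1), of 1] 2(2) m by auto
  define A where "A j = A1 j + (- B1 m / B2 m) * A2 j" for j
  define B where "B j = B1 j + (- B1 m / B2 m) * B2 j" for j
  have M: "matched z A B" unfolding A_def B_def by (rule matched_linear[OF 1(3) 2(3)])
  have AB: "A 1 = 1" "B m = 0" using 1 2 B2m by (simp_all add: A_def B_def)
  have "Psi m b \<gamma> z = glue (wave z A B)"
    unfolding Psi_def
  proof (rule the_equality)
    show "is_Psi m b \<gamma> z (glue (wave z A B))" by (rule is_Psi_glue[OF M AB])
    fix \<Psi> assume "is_Psi m b \<gamma> z \<Psi>"
    then obtain A' B' where *: "A' 1 = 1" "B' m = 0" "matched z A' B'" "\<Psi> = glue (wave z A' B')"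
      using is_Psi_imp_matched by blast
    have 0: "A 1 + - 1 * A' 1 = 0" "B m + - 1 * B' m = 0"
      unfolding AB *(1,2) by simp_all
    have "A j = A' j" "B j = B' j" if "j \<in> {1..m}" for j
      using matched_zero[OF matched_linear[OF M *(3), of "-1"] z 0 that] by simp_all
    then have "glue (wave z A' B') x = glue (wave z A B) x" for x
      using layer_index_props(1)[of x] by (simp add: glue_def wave_def)
    then show "\<Psi> = glue (wave z A B)" using *(4) by auto
  qed
  then show ?thesis using that AB M by blast
qed

section \<open>Two special solutions\<close>

lemma glue_0: "glue f 0 = f 1 0"
  by (simp add: glue_def layer_index_0)

lemma glue_end: "glue f (b m) = f m (b m)"
  using layer_index_interface[of m] m by (simp add: glue_def)

lemma zero_notin_interfaces: "0 \<notin> interfaces"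
proof
  assume "0 \<in> interfaces"
  then obtain j where "j \<in> {1..<m}" "0 = b j" unfolding interfaces_def by blast
  then show False using b_strict_mono[of 0 j] b0 by simp
qed

lemma layer_index_bounds:
  assumes "x \<in> {0<..<b m}"
  shows "b (layer_index x - 1) \<le> x" "x \<le> b (layer_index x)"
  using layer_index_props[of x] assms b0 by auto

lemma contrast_power_mono: "i \<le> j \<Longrightarrow> contrast ^ i \<le> contrast ^ j"
  using contrast(1) by (rule power_increasing[rotated])

text \<open>The size of \<open>\<Psi>\<close>: its value \<open>P\<close> at the end of the rod, and a bound on the rod that does not
  depend on \<open>z\<close>.\<close>

lemma decaying_summary:
  assumes M: "matched z A B" and z: "Re z < 0" and A1: "A 1 = 1" and Bm: "B m = 0"
  defines "P \<equiv> dec z A m (b m)"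
  shows "exp (Re z * travel m) \<le> contrast ^ m * cmod P"
    "cmod P \<le> contrast ^ m * exp (Re z * travel m)"
    "glue (flux z A B) (b m) = of_real (sqrt (\<gamma> m)) * z * P"
    "glue (wave z A B) (b m) = P"
    "x \<in> {0<..<b m} \<Longrightarrow> cmod (glue (wave z A B) x) \<le> 2 * contrast ^ m * contrast ^ m"
proof -
  let ?K = "contrast ^ m"
  have K: "1 \<le> ?K" using contrast(1) by (rule one_le_power)
  have g0: "gro z B m (b m) = 0" using Bm by (simp add: gro_def)
  then have end0: "cmod (gro z B m (b m)) \<le> cmod (dec z A m (b m))" by simp
  note bd = decaying_bounds[OF M z end0, folded P_def]
  have t1: "travel 1 = b 1 / sqrt (\<gamma> 1)" by (simp add: travel_def b0)
  have d1: "cmod (dec z A 1 (b 1)) = exp (Re z * travel 1)"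
    unfolding dec_def t1 A1 by (simp add: mult.commute)
  have e1: "exp (- Re z * (travel m - travel 1)) = exp (- Re z * travel m) * exp (Re z * travel 1)"
    by (simp add: algebra_simps flip: exp_add)
  have K1: "contrast ^ (m - 1) \<le> ?K" by (rule contrast_power_mono) simp
  have "cmod P * exp (- Re z * (travel m - travel 1)) \<le> contrast ^ (m - 1) * exp (Re z * travel 1)"
    using bd[of 1] m d1 by simp
  also have "\<dots> \<le> ?K * exp (Re z * travel 1)" using K1 by (intro mult_right_mono) auto
  finally have up: "cmod P * exp (- Re z * travel m) \<le> ?K"
    unfolding e1 by (simp flip: mult.assoc)
  then show "cmod P \<le> ?K * exp (Re z * travel m)"
    by (simp add: exp_minus field_simps)
  have "exp (Re z * travel 1) \<le> contrast ^ (m - 1) * (cmod P * exp (- Re z * (travel m - travel 1)))"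
    using bd[of 1] m d1 by simp
  also have "\<dots> \<le> ?K * (cmod P * exp (- Re z * (travel m - travel 1)))"
    using K1 by (intro mult_right_mono) auto
  finally have "1 \<le> ?K * (cmod P * exp (- Re z * travel m))"
    unfolding e1 by (simp flip: mult.assoc)
  then show "exp (Re z * travel m) \<le> ?K * cmod P"
    by (simp add: exp_minus field_simps)
  show "glue (flux z A B) (b m) = of_real (sqrt (\<gamma> m)) * z * P" "glue (wave z A B) (b m) = P"
    by (simp_all add: glue_end flux_dec_gro wave_dec_gro g0 P_def)
  assume x: "x \<in> {0<..<b m}"
  define j where "j = layer_index x"
  have j: "j \<in> {1..m}" "b (j - 1) \<le> x" "x \<le> b j"
    using layer_index_props(1) layer_index_bounds[OF x] by (auto simp: j_def)
  have k: "sqrt (\<gamma> j) > 0" using sqrt_\<gamma>_pos[OF j(1)] .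
  let ?\<delta> = "(b j - b (j - 1)) / sqrt (\<gamma> j)"
  have bj: "cmod (gro z B j (b j)) \<le> cmod (dec z A j (b j))"
    "cmod (dec z A j (b j)) \<le> contrast ^ (m - j) * (cmod P * exp (- Re z * (travel m - travel j)))"
    using bd[of j] j by auto
  have le\<delta>: "- Re z * ((b j - x) / sqrt (\<gamma> j)) \<le> - Re z * ?\<delta>"
    using z k j by (intro mult_left_mono divide_right_mono) auto
  have "cmod (dec z A j x) = cmod (dec z A j (b j)) * exp (- Re z * ((b j - x) / sqrt (\<gamma> j)))"
    by (rule norm_dec_shift)
  also have "\<dots> \<le> cmod (dec z A j (b j)) * exp (- Re z * ?\<delta>)"
    using le\<delta> by (intro mult_left_mono) auto
  finally have dx: "cmod (dec z A j x) \<le> cmod (dec z A j (b j)) * exp (- Re z * ?\<delta>)" .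
  have neg: "- Re z * ((x - b j) / sqrt (\<gamma> j)) \<le> - Re z * ?\<delta>"
    using z k j by (intro mult_left_mono divide_right_mono) auto
  have "cmod (gro z B j x) = cmod (gro z B j (b j)) * exp (- Re z * ((x - b j) / sqrt (\<gamma> j)))"
    by (rule norm_gro_shift)
  also have "\<dots> \<le> cmod (dec z A j (b j)) * exp (- Re z * ?\<delta>)"
    using neg bj by (intro mult_mono) auto
  finally have "cmod (wave z A B j x) \<le> 2 * (cmod (dec z A j (b j)) * exp (- Re z * ?\<delta>))"
    unfolding wave_dec_gro using dx norm_triangle_ineq[of "dec z A j x" "gro z B j x"] by linarith
  also have "\<dots> \<le> 2 * ((contrast ^ (m - j) * (cmod P * exp (- Re z * (travel m - travel j)))) * exp (- Re z * ?\<delta>))"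
    using bj by (intro mult_left_mono mult_right_mono) auto
  also have "travel j = travel (j - 1) + ?\<delta>" using travel_Suc[of "j - 1"] j by simp
  then have "(contrast ^ (m - j) * (cmod P * exp (- Re z * (travel m - travel j)))) * exp (- Re z * ?\<delta>)
     = contrast ^ (m - j) * (cmod P * exp (- Re z * (travel m - travel (j - 1))))"
    by (simp add: algebra_simps flip: exp_add)
  also have "\<dots> \<le> ?K * (cmod P * exp (- Re z * travel m))"
  proof -
    have "0 \<le> travel (j - 1)" using travel_mono[of 0 "j - 1"] travel_0 j by auto
    then have "- Re z * (travel m - travel (j - 1)) \<le> - Re z * travel m"
      using z by (intro mult_left_mono) auto
    then show ?thesis 
      using contrast_power_mono[of "m - j" m] K by (intro mult_mono) auto
  qed
  also have "\<dots> \<le> ?K * ?K" using up K by (intro mult_left_mono) auto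
  finally show "cmod (glue (wave z A B) x) \<le> 2 * ?K * ?K"
    unfolding glue_def j_def[symmetric] by simp
qed

text \<open>The solution with value 1 and flux 0 at the left end of the rod: its growing part \<open>Q\<close> and its
  decaying part \<open>P\<close> at the right end, and a bound on the rod.\<close>

lemma growing_summary:
  assumes M: "matched z A B" and z: "Re z < 0" and A1: "A 1 = 1 / 2" and B1: "B 1 = 1 / 2"
  defines "P \<equiv> dec z A m (b m)" and "Q \<equiv> gro z B m (b m)"
  shows "exp (- Re z * travel m) \<le> 2 * contrast ^ m * cmod Q"
    "cmod Q \<le> contrast ^ m * exp (- Re z * travel m)"
    "cmod P \<le> cmod Q * exp (Re z * (2 * (b m - b (m - 1)) / sqrt (\<gamma> m)))"
    "x \<in> {0<..<b m} \<Longrightarrow> cmod (glue (wave z A B) x) \<le> contrast ^ m * exp (- Re z * travel m)"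
proof -
  let ?K = "contrast ^ m"
  have K: "1 \<le> ?K" using contrast(1) by (rule one_le_power)
  have start: "cmod (A 1) \<le> cmod (B 1)" unfolding A1 B1 by simp
  note bd = growing_bounds[OF M z start]
  have tr: "travel j = travel (j - 1) + (b j - b (j - 1)) / sqrt (\<gamma> j)" if "j \<in> {1..m}" for j
    using travel_Suc[of "j - 1"] that by simp
  have B1n: "cmod (B 1) = 1 / 2" unfolding B1 by simp
  have e: "exp (- Re z * travel j) = exp (- Re z * travel (j - 1)) * exp (- Re z * ((b j - b (j - 1)) / sqrt (\<gamma> j)))" 
    if "j \<in> {1..m}" for j
    unfolding tr[OF that] by (simp add: algebra_simps flip: exp_add)
  have gr: "cmod (gro z B j (b (j - 1))) * exp (- Re z * ((b j - b (j - 1)) / sqrt (\<gamma> j))) \<le> ?K * (exp (- Re z * travel j) / 2)"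
    if j: "j \<in> {1..m}" for j
  proof -
    have "cmod (gro z B j (b (j - 1))) \<le> contrast ^ (j - 1) * (1 / 2 * exp (- Re z * travel (j - 1)))"
      using bd[of j] j unfolding B1n by simp
    also have "\<dots> \<le> ?K * (1 / 2 * exp (- Re z * travel (j - 1)))"
      using contrast_power_mono[of "j - 1" m] j by (intro mult_right_mono) auto
    finally have "cmod (gro z B j (b (j - 1))) * exp (- Re z * ((b j - b (j - 1)) / sqrt (\<gamma> j)))
       \<le> ?K * (1 / 2 * exp (- Re z * travel (j - 1))) * exp (- Re z * ((b j - b (j - 1)) / sqrt (\<gamma> j)))"
      by (rule mult_right_mono) simp
    then show ?thesis unfolding e[OF j] by simp
  qed
  have mm: "m \<in> {1..m}" using m by simp
  have Q: "cmod Q = cmod (gro z B m (b (m - 1))) * exp (- Re z * ((b m - b (m - 1)) / sqrt (\<gamma> m)))"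
    unfolding Q_def by (rule norm_gro_shift)
  have P: "cmod P = cmod (dec z A m (b (m - 1))) * exp (- Re z * ((b (m - 1) - b m) / sqrt (\<gamma> m)))"
    unfolding P_def by (rule norm_dec_shift)
  have "cmod Q \<le> ?K * (exp (- Re z * travel m) / 2)" unfolding Q by (rule gr[OF mm])
  also have "\<dots> \<le> ?K * exp (- Re z * travel m)" using K by (intro mult_left_mono) auto
  finally show "cmod Q \<le> ?K * exp (- Re z * travel m)" .
  have "1 / 2 * exp (- Re z * travel (m - 1)) \<le> contrast ^ (m - 1) * cmod (gro z B m (b (m - 1)))"
    using bd[of m] m unfolding B1n by simp
  also have "\<dots> \<le> ?K * cmod (gro z B m (b (m - 1)))"
    using contrast_power_mono[of "m - 1" m] by (intro mult_right_mono) auto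
  finally have "1 / 2 * exp (- Re z * travel (m - 1)) * exp (- Re z * ((b m - b (m - 1)) / sqrt (\<gamma> m))) 
     \<le> ?K * cmod (gro z B m (b (m - 1))) * exp (- Re z * ((b m - b (m - 1)) / sqrt (\<gamma> m)))"
    by (rule mult_right_mono) simp
  then show "exp (- Re z * travel m) \<le> 2 * ?K * cmod Q"
    unfolding Q e[OF mm] by simp
  have "cmod P \<le> cmod (gro z B m (b (m - 1))) * exp (- Re z * ((b (m - 1) - b m) / sqrt (\<gamma> m)))"
    unfolding P using bd[of m] m by (intro mult_right_mono) auto
  also have "\<dots> = cmod Q * exp (Re z * (2 * (b m - b (m - 1)) / sqrt (\<gamma> m)))"
    unfolding Q by (simp add: algebra_simps diff_divide_distrib flip: exp_add)
  finally show "cmod P \<le> cmod Q * exp (Re z * (2 * (b m - b (m - 1)) / sqrt (\<gamma> m)))" .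
  assume x: "x \<in> {0<..<b m}"
  define j where "j = layer_index x"
  have j: "j \<in> {1..m}" "b (j - 1) \<le> x" "x \<le> b j"
    using layer_index_props(1) layer_index_bounds[OF x] by (auto simp: j_def)
  have k: "sqrt (\<gamma> j) > 0" using sqrt_\<gamma>_pos[OF j(1)] .
  let ?g = "cmod (gro z B j (b (j - 1))) * exp (- Re z * ((b j - b (j - 1)) / sqrt (\<gamma> j)))"
  have "cmod (gro z B j x) = cmod (gro z B j (b (j - 1))) * exp (- Re z * ((x - b (j - 1)) / sqrt (\<gamma> j)))"
    by (rule norm_gro_shift)
  also have "\<dots> \<le> ?g"
  proof -
    have "- Re z * ((x - b (j - 1)) / sqrt (\<gamma> j)) \<le> - Re z * ((b j - b (j - 1)) / sqrt (\<gamma> j))"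
      using z k j by (intro mult_left_mono divide_right_mono) auto
    then show ?thesis by (intro mult_left_mono) auto
  qed
  finally have gx: "cmod (gro z B j x) \<le> ?g" .
  have "cmod (dec z A j x) = cmod (dec z A j (b (j - 1))) * exp (- Re z * ((b (j - 1) - x) / sqrt (\<gamma> j)))"
    by (rule norm_dec_shift)
  also have "\<dots> \<le> ?g"
  proof -
    have "- Re z * ((b (j - 1) - x) / sqrt (\<gamma> j)) \<le> - Re z * ((b j - b (j - 1)) / sqrt (\<gamma> j))"
      using z k j by (intro mult_left_mono divide_right_mono) auto
    then show ?thesis using bd[of j] j by (intro mult_mono) auto
  qed
  finally have "cmod (wave z A B j x) \<le> 2 * ?g"
    unfolding wave_dec_gro using gx norm_triangle_ineq[of "dec z A j x" "gro z B j x"] by linarith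
  also have "\<dots> \<le> ?K * exp (- Re z * travel j)" using gr[OF j(1)] by simp
  also have "\<dots> \<le> ?K * exp (- Re z * travel m)"
  proof -
    have "- Re z * travel j \<le> - Re z * travel m"
      using z travel_mono[of j m] j by (intro mult_left_mono) auto
    then show ?thesis using K by (intro mult_left_mono) auto
  qed
  finally show "cmod (glue (wave z A B) x) \<le> ?K * exp (- Re z * travel m)"
    unfolding glue_def j_def[symmetric] .
qed

end

section \<open>The asymptotics of the indicator function\<close>

lemma z_of_props:
  assumes c: "c > 0" and \<tau>: "\<tau> > 1 / c\<^sup>2"
  shows "\<tau> > 0" "Re (z_of c \<tau>) = - (c * \<tau>)" "cmod (z_of c \<tau>) \<le> 2 * (c * \<tau>)"
    "Re ((z_of c \<tau>)\<^sup>2) = \<tau>" "\<tau> \<ge> 2 / c\<^sup>2 \<Longrightarrow> c * \<tau> / 2 \<le> \<bar>Im (z_of c \<tau>)\<bar>"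
proof -
  have "0 < 1 / c\<^sup>2" using c by simp
  then show pos: "\<tau> > 0" using \<tau> by linarith
  define s where "s = sqrt (1 - 1 / (c\<^sup>2 * \<tau>))"
  have z: "z_of c \<tau> = - of_real (c * \<tau>) * (1 + \<i> * of_real s)"
    by (simp add: z_of_def s_def)
  have le: "0 \<le> 1 / (c\<^sup>2 * \<tau>)" "1 / (c\<^sup>2 * \<tau>) \<le> 1"
    using c pos \<tau> by (simp_all add: divide_simps mult.commute)
  have s: "0 \<le> s" "s \<le> 1" "s\<^sup>2 = 1 - 1 / (c\<^sup>2 * \<tau>)"
    unfolding s_def using le by simp_all
  show re: "Re (z_of c \<tau>) = - (c * \<tau>)" unfolding z by simp
  have im: "Im (z_of c \<tau>) = - (c * \<tau> * s)" unfolding z by simp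
  have "cmod (z_of c \<tau>) \<le> \<bar>Re (z_of c \<tau>)\<bar> + \<bar>Im (z_of c \<tau>)\<bar>"
    by (rule cmod_le)
  also have "\<dots> = c * \<tau> + c * \<tau> * s"
    unfolding re im using c pos s by simp
  also have "\<dots> \<le> 2 * (c * \<tau>)"
    using mult_left_mono[OF s(2), of "c * \<tau>"] c pos by simp
  finally show "cmod (z_of c \<tau>) \<le> 2 * (c * \<tau>)" .
  have "Re ((z_of c \<tau>)\<^sup>2) = (c * \<tau>)\<^sup>2 - (c * \<tau> * s)\<^sup>2"
    using re im by (simp add: power2_eq_square)
  also have "\<dots> = (c * \<tau>)\<^sup>2 * (1 - s\<^sup>2)"
    by (simp add: power_mult_distrib algebra_simps)
  also have "\<dots> = \<tau>"
    unfolding s(3) using c pos by (simp add: power2_eq_square field_simps)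
  finally show "Re ((z_of c \<tau>)\<^sup>2) = \<tau>" .
  assume "\<tau> \<ge> 2 / c\<^sup>2"
  then have "1 / (c\<^sup>2 * \<tau>) \<le> 1 / 2"
    using c pos by (simp add: divide_simps mult.commute)
  then have "(1 / 2)\<^sup>2 \<le> s\<^sup>2" unfolding s(3) by (simp add: power2_eq_square)
  then have "1 / 2 \<le> s" using s(1) by (rule power2_le_imp_le)
  then show "c * \<tau> / 2 \<le> \<bar>Im (z_of c \<tau>)\<bar>"
    unfolding im using mult_left_mono[of "1/2" s "c * \<tau>"] c pos s by (simp add: abs_mult)
qed

lemma log_asymptotics:
  fixes f :: "real \<Rightarrow> real"
  assumes c1: "c1 > 0" and c2: "c2 > 0"
    and lo: "\<forall>\<^sub>F \<tau> in at_top. c1 * \<tau> powr \<mu> * exp (- l * \<tau>) \<le> f \<tau>"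
    and up: "\<forall>\<^sub>F \<tau> in at_top. f \<tau> \<le> c2 * exp (- l * \<tau>)"
  shows "((\<lambda>\<tau>. ln (f \<tau>) / \<tau>) \<longlongrightarrow> - l) at_top"
proof (rule tendsto_sandwich)
  show "\<forall>\<^sub>F \<tau> in at_top. (ln c1 + \<mu> * ln \<tau>) / \<tau> - l \<le> ln (f \<tau>) / \<tau>"
    using lo eventually_gt_at_top[of "0::real"]
  proof eventually_elim
    case (elim \<tau>)
    have "ln (c1 * \<tau> powr \<mu> * exp (- l * \<tau>)) \<le> ln (f \<tau>)"
      using elim c1 by (intro ln_mono) auto
    moreover have "ln (c1 * \<tau> powr \<mu> * exp (- l * \<tau>)) = ln c1 + \<mu> * ln \<tau> - l * \<tau>"
      using elim c1 by (simp add: ln_mult ln_powr)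
    ultimately have "(ln c1 + \<mu> * ln \<tau> - l * \<tau>) / \<tau> \<le> ln (f \<tau>) / \<tau>"
      using elim by (intro divide_right_mono) auto
    then show ?case using elim by (simp add: diff_divide_distrib)
  qed
  show "\<forall>\<^sub>F \<tau> in at_top. ln (f \<tau>) / \<tau> \<le> ln c2 / \<tau> - l"
    using lo up eventually_gt_at_top[of "0::real"]
  proof eventually_elim
    case (elim \<tau>)
    have "0 < c1 * \<tau> powr \<mu> * exp (- l * \<tau>)" using elim c1 by simp
    then have "0 < f \<tau>" using elim by linarith
    then have "ln (f \<tau>) \<le> ln (c2 * exp (- l * \<tau>))"
      using elim c2 by (intro ln_mono) auto
    moreover have "ln (c2 * exp (- l * \<tau>)) = ln c2 - l * \<tau>"
      using c2 by (simp add: ln_mult)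
    ultimately have "ln (f \<tau>) / \<tau> \<le> (ln c2 - l * \<tau>) / \<tau>"
      using elim by (intro divide_right_mono) auto
    then show ?case using elim by (simp add: diff_divide_distrib)
  qed
  show "((\<lambda>\<tau>. (ln c1 + \<mu> * ln \<tau>) / \<tau> - l) \<longlongrightarrow> - l) at_top" by real_asymp
  show "((\<lambda>\<tau>. ln c2 / \<tau> - l) \<longlongrightarrow> - l) at_top" by real_asymp
qed

lemma eventually_exp_le_powr:
  fixes K \<delta> C \<mu> :: real
  assumes \<delta>: "\<delta> > 0" and C: "C > 0"
  shows "\<forall>\<^sub>F \<tau> in at_top. K * exp (- \<delta> * \<tau>) \<le> C * \<tau> powr \<mu>"
proof -
  have "((\<lambda>\<tau>. K * exp (- \<delta> * \<tau>) / \<tau> powr \<mu>) \<longlongrightarrow> 0) at_top"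
    using \<delta> by real_asymp
  then have "\<forall>\<^sub>F \<tau> in at_top. K * exp (- \<delta> * \<tau>) / \<tau> powr \<mu> < C"
    using C by (rule order_tendstoD)
  then show ?thesis
    using eventually_gt_at_top[of "0::real"]
    by eventually_elim (simp add: divide_less_eq)
qed

context layered_rod
begin

lemma heat_solution_matched_identity:
  assumes sol: "heat_solution m b \<gamma> (b m) \<rho> T u g0 ga" and T: "0 < T"
  obtains W where "W \<ge> 0"
    "\<And>z A B K. \<lbrakk>matched z A B; \<And>x. x \<in> {0<..<b m} \<Longrightarrow> cmod (glue (wave z A B) x) \<le> K\<rbrakk> \<Longrightarrow>
     \<exists>Y. cmod Y \<le> W * K \<and>
       exp (- z\<^sup>2 * of_real T) * Y
       + (glue (flux z A B) (b m) + of_real \<rho> * glue (wave z A B) (b m))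
           * (\<integral>t. exp (- z\<^sup>2 * of_real t) * trace_at {0<..<b m} (u t) (b m) \<partial>lebesgue_on {0<..<T})
       - flux z A B 1 0 * (\<integral>t. exp (- z\<^sup>2 * of_real t) * trace_at {0<..<b m} (u t) 0 \<partial>lebesgue_on {0<..<T})
       = - of_real (\<gamma> 1) * wave z A B 1 0 * (\<integral>t. exp (- z\<^sup>2 * of_real t) * g0 t \<partial>lebesgue_on {0<..<T})"
proof -
  obtain W where W: "W \<ge> 0"
    "\<And>\<phi> d q s B. \<lbrakk>is_primitive (b m) \<phi> d; d \<in> L2 {0<..<b m}; is_primitive (b m) q (\<lambda>x. s * \<phi> x);
       AE x in lebesgue_on {0<..<b m}. of_real (conductivity m b \<gamma> x) * d x = q x;
       \<And>x. x \<in> {0<..<b m} \<Longrightarrow> cmod (\<phi> x) \<le> B\<rbrakk> \<Longrightarrow>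
     \<exists>Y. cmod Y \<le> W * B \<and>
       exp (- s * of_real T) * Y
       + (q (b m) + of_real \<rho> * \<phi> (b m)) * (\<integral>t. exp (- s * of_real t) * trace_at {0<..<b m} (u t) (b m) \<partial>lebesgue_on {0<..<T})
       - q 0 * (\<integral>t. exp (- s * of_real t) * trace_at {0<..<b m} (u t) 0 \<partial>lebesgue_on {0<..<T})
       = - of_real (\<gamma> 1) * \<phi> 0 * (\<integral>t. exp (- s * of_real t) * g0 t \<partial>lebesgue_on {0<..<T})"
    using heat_solution_identity[OF sol bm_pos T] by blast
  show ?thesis
    by (rule that[OF W(1)]) (use W(2)[OF matched_primitives(1,2,3,4)] in \<open>simp only: glue_0\<close>)
qed

theorem indicator_function_asymptotics:
  assumes sol: "heat_solution m b \<gamma> (b m) \<rho> T u g0 ga" and T: "0 < T" and \<rho>: "0 \<le> \<rho>"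
    and c: "0 < c" and cT: "2 * travel m * c < T"
    and C: "0 < C"
    and G: "\<And>\<tau>. \<tau> > \<tau>0 \<Longrightarrow> C * \<tau> powr \<mu> \<le>
              cmod (\<integral>t. exp (- (z_of c \<tau>)\<^sup>2 * of_real t) * g0 t \<partial>lebesgue_on {0<..<T})"
  shows "((\<lambda>\<tau>. ln (cmod (indicator_function m b \<gamma> (b m) T u g0 c \<tau>)) / \<tau>) \<longlongrightarrow> - (2 * c * travel m)) at_top"
proof -
  let ?R = "lebesgue_on {0<..<T}" let ?S = "{0<..<b m}"
  define k where "k = sqrt (\<gamma> m)"
  define K where "K = contrast ^ m"
  define L where "L = travel m"
  define g where "g = \<gamma> 1"
  have k: "k > 0" using sqrt_\<gamma>_pos[of m] m by (simp add: k_def)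
  have K: "K \<ge> 1" unfolding K_def using contrast(1) by (rule one_le_power)
  have L: "0 \<le> L" using travel_mono[of 0 m] travel_0 by (simp add: L_def)
  have g: "g > 0" using \<gamma>_pos[of 1] m by (simp add: g_def)
  have g0: "g0 \<in> L2 {0<..<T}" and u: "bochner_L2 T (H1 ?S) (H1_norm ?S) u"
    using sol by (auto simp: heat_solution_def Let_def)
  define G0 where "G0 = (\<integral>t. cmod (g0 t) \<partial>?R)"
  obtain W where W: "W \<ge> 0" and ident:
    "\<And>z A B K. \<lbrakk>matched z A B; \<And>x. x \<in> ?S \<Longrightarrow> cmod (glue (wave z A B) x) \<le> K\<rbrakk> \<Longrightarrow>
     \<exists>Y. cmod Y \<le> W * K \<and>
       exp (- z\<^sup>2 * of_real T) * Y
       + (glue (flux z A B) (b m) + of_real \<rho> * glue (wave z A B) (b m))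
           * (\<integral>t. exp (- z\<^sup>2 * of_real t) * trace_at ?S (u t) (b m) \<partial>?R)
       - flux z A B 1 0 * (\<integral>t. exp (- z\<^sup>2 * of_real t) * trace_at ?S (u t) 0 \<partial>?R)
       = - of_real (\<gamma> 1) * wave z A B 1 0 * (\<integral>t. exp (- z\<^sup>2 * of_real t) * g0 t \<partial>?R)"
    using heat_solution_matched_identity[OF sol T] by blast
  let ?I = "indicator_function m b \<gamma> (b m) T u g0 c"
  define GG where "GG \<tau> = (\<integral>t. exp (- (z_of c \<tau>)\<^sup>2 * of_real t) * g0 t \<partial>?R)" for \<tau>
  define Ua where "Ua \<tau> = (\<integral>t. exp (- (z_of c \<tau>)\<^sup>2 * of_real t) * trace_at ?S (u t) (b m) \<partial>?R)" for \<tau>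
  define U0 where "U0 \<tau> = (\<integral>t. exp (- (z_of c \<tau>)\<^sup>2 * of_real t) * trace_at ?S (u t) 0 \<partial>?R)" for \<tau>
  define ET where "ET \<tau> = exp (- (z_of c \<tau>)\<^sup>2 * of_real T)" for \<tau>
  have expn: "cmod (exp (- (z_of c \<tau>)\<^sup>2 * of_real t)) = exp (- \<tau> * t)" if "\<tau> > 1 / c\<^sup>2" for \<tau> t
    using z_of_props(4)[OF c that] by (simp add: norm_exp_eq_Re)
  have Gup: "cmod (GG \<tau>) \<le> G0" if \<tau>: "\<tau> > 1 / c\<^sup>2" for \<tau>
    unfolding GG_def G0_def
  proof (rule order_trans[OF integral_norm_bound integral_mono])
    show "integrable ?R (\<lambda>t. cmod (exp (- (z_of c \<tau>)\<^sup>2 * of_real t) * g0 t))"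
      using integrable_norm[OF integrable_mult_continuous[OF L2_integrable[OF g0], of "\<lambda>t. exp (- (z_of c \<tau>)\<^sup>2 * of_real t)"]]
      by (simp add: mult.commute continuous_intros)
    show "integrable ?R (\<lambda>t. cmod (g0 t))" by (rule integrable_norm[OF L2_integrable[OF g0]])
    fix t assume "t \<in> space ?R"
    then have "exp (- \<tau> * t) \<le> 1" using z_of_props(1)[OF c \<tau>] by simp
    then show "cmod (exp (- (z_of c \<tau>)\<^sup>2 * of_real t) * g0 t) \<le> cmod (g0 t)"
      unfolding norm_mult expn[OF \<tau>] by (simp add: mult_left_le_one_le)
  qed
  \<comment> \<open>Testing with the solution that satisfies the Neumann condition at \<open>0\<close> determines the boundary
    value at \<open>b m\<close>.\<close>
  have growing: "\<exists>Y D. cmod Y \<le> W * (K * exp (c * L * \<tau>)) \<and> ET \<tau> * Y + D * Ua \<tau> = - of_real g * GG \<tau> \<and>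
      cmod D \<le> 2 * (\<rho> + 2 * k * c) * K * \<tau> * exp (c * L * \<tau>) \<and>
      k * c / (4 * K) * \<tau> * exp (c * L * \<tau>) \<le> cmod D"
    if \<tau>: "\<tau> > 1 / c\<^sup>2" "\<tau> \<ge> 1" and large: "exp (- (c * \<tau>) * (2 * (b m - b (m - 1)) / k)) \<le> 1 / 2" for \<tau>
  proof -
    define z where "z = z_of c \<tau>"
    note zp = z_of_props[OF c \<tau>(1), folded z_def]
    have zn: "Re z < 0" "z \<noteq> 0" using zp(1,2) c by auto
    obtain A B where AB: "A 1 = 1 / 2" "B 1 = 1 / 2" "matched z A B"
      using matched_exists[OF zn(2), of "1/2" "1/2"] by blast
    define P where "P = dec z A m (b m)"
    define Q where "Q = gro z B m (b m)"
    have eL: "exp (- Re z * travel m) = exp (c * L * \<tau>)" by (simp add: zp(2) L_def mult_ac)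
    note gs = growing_summary[OF AB(3) zn(1) AB(1,2), folded P_def Q_def K_def, unfolded eL]
    have w10: "wave z A B 1 0 = 1" "flux z A B 1 0 = 0"
      unfolding wave_def flux_def AB(1,2) by simp_all
    define D where "D = glue (flux z A B) (b m) + of_real \<rho> * glue (wave z A B) (b m)"
    have D: "D = (of_real k * z + of_real \<rho>) * P - (of_real k * z - of_real \<rho>) * Q"
      by (simp add: D_def glue_end flux_dec_gro wave_dec_gro P_def Q_def k_def algebra_simps)
    obtain Y where Y: "cmod Y \<le> W * (K * exp (c * L * \<tau>))" "ET \<tau> * Y + D * Ua \<tau> = - of_real g * GG \<tau>"
      using ident[OF AB(3) gs(4)] unfolding w10 
      by (auto simp: ET_def Ua_def GG_def g_def D_def z_def)
    let ?n = "cmod (of_real k * z - of_real \<rho>)"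
    \<comment> \<open>Since \<open>Re z < 0 \<le> \<rho>\<close>, the factor of the growing part is the larger one.\<close>
    have n1: "cmod (of_real k * z + of_real \<rho>) \<le> ?n"
    proof (rule power2_le_imp_le)
      have "?n\<^sup>2 - (cmod (of_real k * z + of_real \<rho>))\<^sup>2 = 4 * (k * (c * \<tau>)) * \<rho>"
        unfolding cmod_power2 using zp(2) by (simp add: power2_eq_square algebra_simps)
      moreover have "0 \<le> 4 * (k * (c * \<tau>)) * \<rho>" using k c zp(1) \<rho> by simp
      ultimately show "(cmod (of_real k * z + of_real \<rho>))\<^sup>2 \<le> ?n\<^sup>2" by linarith
    qed simp
    have n2: "k * c * \<tau> \<le> ?n"
      using abs_Re_le_cmod[of "of_real k * z - of_real \<rho>"] zp(1,2) k c \<rho> by simp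
    have n3: "?n \<le> (\<rho> + 2 * k * c) * \<tau>"
    proof -
      have "?n \<le> cmod (of_real k * z) + cmod (of_real \<rho>)" by (rule norm_triangle_ineq4)
      also have "\<dots> = k * cmod z + \<rho>" using k \<rho> by (simp add: norm_mult)
      also have "\<dots> \<le> k * (2 * (c * \<tau>)) + \<rho> * \<tau>"
        using zp(3) k \<rho> \<tau>(2) mult_left_mono[of 1 \<tau> \<rho>] by (intro add_mono mult_left_mono) auto
      finally show ?thesis by (simp add: algebra_simps)
    qed
    have PQ: "cmod P \<le> cmod Q / 2"
    proof -
      have "cmod P \<le> cmod Q * exp (- (c * \<tau>) * (2 * (b m - b (m - 1)) / k))"
        using gs(3) by (simp add: zp(2) k_def)
      also have "\<dots> \<le> cmod Q * (1 / 2)" using large by (intro mult_left_mono) auto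
      finally show ?thesis by simp
    qed
    have p: "cmod ((of_real k * z + of_real \<rho>) * P) \<le> ?n * (cmod Q / 2)"
      unfolding norm_mult using n1 PQ by (intro mult_mono) auto
    have q: "cmod ((of_real k * z - of_real \<rho>) * Q) = ?n * cmod Q" by (rule norm_mult)
    have "cmod D \<le> ?n * (cmod Q / 2) + ?n * cmod Q"
      unfolding D using norm_triangle_ineq4[of "(of_real k * z + of_real \<rho>) * P" "(of_real k * z - of_real \<rho>) * Q"] p q
      by linarith
    also have "\<dots> \<le> 2 * (?n * cmod Q)" by simp
    also have "\<dots> \<le> 2 * (((\<rho> + 2 * k * c) * \<tau>) * (K * exp (c * L * \<tau>)))"
      using n3 gs(2) k c \<rho> zp(1) by (intro mult_left_mono mult_mono) auto
    finally have up: "cmod D \<le> 2 * (\<rho> + 2 * k * c) * K * \<tau> * exp (c * L * \<tau>)" by (simp add: algebra_simps)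
    have "exp (c * L * \<tau>) / (2 * K) \<le> cmod Q" using gs(1) K by (simp add: divide_le_eq mult_ac)
    then have "(k * c * \<tau>) * (exp (c * L * \<tau>) / (2 * K)) \<le> ?n * cmod Q"
      using n2 K by (intro mult_mono) auto
    also have "?n * cmod Q \<le> 2 * cmod D"
    proof -
      have "?n * cmod Q - ?n * (cmod Q / 2) \<le> cmod D"
        unfolding D norm_minus_commute[of "(of_real k * z + of_real \<rho>) * P"]
        using norm_triangle_ineq2[of "(of_real k * z - of_real \<rho>) * Q" "(of_real k * z + of_real \<rho>) * P"] p q
        by linarith
      then show ?thesis by linarith
    qed
    finally have "k * c / (4 * K) * \<tau> * exp (c * L * \<tau>) \<le> cmod D" using K by (simp add: field_simps)
    then show ?thesis using Y up by blast
  qed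
  \<comment> \<open>Testing with \<open>\<Psi>\<close> expresses the indicator function by the boundary value at \<open>b m\<close>.\<close>
  have decaying: "\<exists>Y E. cmod Y \<le> W * (2 * K * K) \<and> ?I \<tau> = - (ET \<tau> * Y + E * Ua \<tau>) \<and>
      cmod E \<le> (\<rho> + 2 * k * c) * K * \<tau> * exp (- c * L * \<tau>) \<and>
      k * c / (2 * K) * \<tau> * exp (- c * L * \<tau>) \<le> cmod E"
    if \<tau>: "\<tau> > 1 / c\<^sup>2" "\<tau> \<ge> 1" "\<tau> \<ge> 2 / c\<^sup>2" for \<tau>
  proof -
    define z where "z = z_of c \<tau>"
    note zp = z_of_props[OF c \<tau>(1), folded z_def]
    have zn: "Re z < 0" using zp(1,2) c by auto
    obtain A B where AB: "A 1 = 1" "B m = 0" "matched z A B" and Psi: "Psi m b \<gamma> z = glue (wave z A B)"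
      using Psi_coefficients[OF zn] by blast
    define P where "P = dec z A m (b m)"
    have eL: "exp (Re z * travel m) = exp (- c * L * \<tau>)" by (simp add: zp(2) L_def mult_ac)
    note ds = decaying_summary[OF AB(3) zn AB(1,2), folded P_def K_def, unfolded eL]
    define E where "E = glue (flux z A B) (b m) + of_real \<rho> * glue (wave z A B) (b m)"
    have E: "E = (of_real k * z + of_real \<rho>) * P"
      unfolding E_def ds(3,4) k_def by (simp add: algebra_simps)
    obtain Y where Y: "cmod Y \<le> W * (2 * K * K)" 
      "ET \<tau> * Y + E * Ua \<tau> - flux z A B 1 0 * U0 \<tau> = - of_real g * wave z A B 1 0 * GG \<tau>"
      using ident[OF AB(3) ds(5)] by (auto simp: ET_def Ua_def U0_def GG_def g_def E_def z_def)
    let ?e = "\<lambda>t. exp (- z\<^sup>2 * complex_of_real t)"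
    have v0: "v_fun m b \<gamma> z 0 t = wave z A B 1 0 * ?e t" for t
      by (simp add: v_fun_def Psi glue_0)
    have dv0: "of_real (\<gamma> 1) * vector_derivative (\<lambda>x. v_fun m b \<gamma> z x t) (at 0) = flux z A B 1 0 * ?e t" for t
    proof -
      have g1: "complex_of_real (\<gamma> 1) \<noteq> 0" using g by (simp add: g_def)
      have "((\<lambda>x. ?e t * glue (wave z A B) x) has_vector_derivative ?e t * (flux z A B 1 0 / of_real (\<gamma> 1))) (at 0)"
        using glue_wave_derivative[OF zero_notin_interfaces, of z A B]
        unfolding layer_index_0 glue_0 by (rule has_vector_derivative_mult_right)
      then have "vector_derivative (\<lambda>x. v_fun m b \<gamma> z x t) (at 0) = ?e t * (flux z A B 1 0 / of_real (\<gamma> 1))"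
        unfolding v_fun_def Psi by (rule vector_derivative_at)
      then show ?thesis using g1 by (simp add: mult.commute)
    qed
    have ce: "continuous_on {0..T} ?e" by (intro continuous_intros)
    have i0: "integrable ?R (\<lambda>t. trace_at ?S (u t) 0 * ?e t)"
      by (rule integrable_mult_continuous[OF L2_integrable[OF trace_at_in_L2[OF u bm_pos]] ce]) (use bm_pos in auto)
    have ig: "integrable ?R (\<lambda>t. g0 t * ?e t)"
      by (rule integrable_mult_continuous[OF L2_integrable[OF g0] ce])
    have "?I \<tau> = (\<integral>t. - (flux z A B 1 0 * (trace_at ?S (u t) 0 * ?e t)) 
        + of_real g * wave z A B 1 0 * (g0 t * ?e t) \<partial>?R)"
      unfolding indicator_function_def Let_def z_def[symmetric] v0 mult_minus_left dv0
      by (simp add: g_def mult_ac)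
    also have "\<dots> = - (flux z A B 1 0 * U0 \<tau>) + of_real g * wave z A B 1 0 * GG \<tau>"
      using i0 ig by (simp add: U0_def GG_def z_def mult.commute)
    also have "\<dots> = - (ET \<tau> * Y + E * Ua \<tau>)"
      using Y(2) by (simp add: algebra_simps)
    finally have I: "?I \<tau> = - (ET \<tau> * Y + E * Ua \<tau>)" .
    let ?n = "cmod (of_real k * z + of_real \<rho>)"
    have n3: "?n \<le> (\<rho> + 2 * k * c) * \<tau>"
    proof -
      have "?n \<le> cmod (of_real k * z) + cmod (of_real \<rho>)" by (rule norm_triangle_ineq)
      also have "\<dots> = k * cmod z + \<rho>" using k \<rho> by (simp add: norm_mult)
      also have "\<dots> \<le> k * (2 * (c * \<tau>)) + \<rho> * \<tau>"
        using zp(3) k \<rho> \<tau>(2) mult_left_mono[of 1 \<tau> \<rho>] by (intro add_mono mult_left_mono) auto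
      finally show ?thesis by (simp add: algebra_simps)
    qed
    \<comment> \<open>The real parts of \<open>k z\<close> and \<open>\<rho>\<close> have opposite signs; the imaginary part gives the bound.\<close>
    have n2: "k * (c * \<tau> / 2) \<le> ?n"
    proof -
      have "k * (c * \<tau> / 2) \<le> k * \<bar>Im z\<bar>" using zp(5)[OF \<tau>(3)] k by (intro mult_left_mono) auto
      also have "\<dots> = \<bar>Im (of_real k * z + of_real \<rho>)\<bar>" using k by (simp add: abs_mult)
      also have "\<dots> \<le> ?n" by (rule abs_Im_le_cmod)
      finally show ?thesis .
    qed
    have "cmod E \<le> ((\<rho> + 2 * k * c) * \<tau>) * (K * exp (- c * L * \<tau>))"
      unfolding E norm_mult using n3 ds(2) k c \<rho> zp(1) by (intro mult_mono) auto
    then have up: "cmod E \<le> (\<rho> + 2 * k * c) * K * \<tau> * exp (- c * L * \<tau>)" by (simp add: mult_ac)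
    have "exp (- c * L * \<tau>) / K \<le> cmod P" using ds(1) K by (simp add: divide_le_eq mult_ac)
    then have "(k * (c * \<tau> / 2)) * (exp (- c * L * \<tau>) / K) \<le> cmod E"
      unfolding E norm_mult using n2 K by (intro mult_mono) auto
    then have "k * c / (2 * K) * \<tau> * exp (- c * L * \<tau>) \<le> cmod E" by (simp add: field_simps)
    then show ?thesis using Y(1) I up by blast
  qed
  \<comment> \<open>In the products below, \<open>x = exp (c * L * \<tau>)\<close>; \<open>N\<close> bounds \<open>D * Ua\<close>, and \<open>d1\<close>, \<open>d2\<close>, \<open>e1\<close>, \<open>e2\<close> are the constants
    in the bounds for \<open>D\<close> and \<open>E\<close>. The halves in \<open>c1\<close> absorb the two terms with \<open>ET\<close>.\<close>
  define N where "N = g * G0 + W * K"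
  define d1 where "d1 = k * c / (4 * K)"
  define d2 where "d2 = 2 * (\<rho> + 2 * k * c) * K"
  define e1 where "e1 = k * c / (2 * K)"
  define e2 where "e2 = (\<rho> + 2 * k * c) * K"
  have pos: "d1 > 0" "d2 > 0" "e1 > 0" "e2 > 0"
    using k c K \<rho> by (auto simp: d1_def d2_def e1_def e2_def intro!: mult_pos_pos add_nonneg_pos)
  have G0: "G0 \<ge> 0" by (simp add: G0_def)
  have N: "N \<ge> 0" using g G0 W K by (simp add: N_def)
  have \<delta>: "T - 2 * c * L > 0" using cT by (simp add: L_def mult_ac)
  have \<delta>': "T - c * L > 0" using \<delta> c L mult_nonneg_nonneg[of c L] by linarith
  define c1 where "c1 = e1 / d2 * (g * C / 2) / 2"
  define c2 where "c2 = e2 / d1 * N + W * (2 * K * K) + 1"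
  have c1: "c1 > 0" using pos g C by (simp add: c1_def)
  have c2: "c2 > 0" using pos N W K by (simp add: c2_def add_nonneg_pos)
  have ev1: "\<forall>\<^sub>F \<tau> in at_top. W * K * exp (- (T - c * L) * \<tau>) \<le> g * C / 2 * \<tau> powr \<mu>"
    by (rule eventually_exp_le_powr) (use \<delta>' g C in auto)
  have ev2: "\<forall>\<^sub>F \<tau> in at_top. W * (2 * K * K) * exp (- (T - 2 * c * L) * \<tau>) \<le> c1 * \<tau> powr \<mu>"
    by (rule eventually_exp_le_powr) (use \<delta> c1 in auto)
  have ev3: "\<forall>\<^sub>F \<tau> in at_top. exp (- (c * \<tau>) * (2 * (b m - b (m - 1)) / k)) \<le> 1 / 2"
  proof -
    have "b (m - 1) < b m" using b_strict_mono[of "m - 1" m] m by simp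
    then have pos: "c * (2 * (b m - b (m - 1)) / k) > 0" using c k by simp
    have "\<forall>\<^sub>F \<tau> in at_top. 1 * exp (- (c * (2 * (b m - b (m - 1)) / k)) * \<tau>) \<le> 1 / 2 * \<tau> powr 0"
      by (rule eventually_exp_le_powr[OF pos]) simp
    then show ?thesis
      using eventually_gt_at_top[of "0::real"] by eventually_elim (simp add: mult_ac)
  qed
  have main: "\<forall>\<^sub>F \<tau> in at_top. c1 * \<tau> powr \<mu> * exp (- (2 * c * L) * \<tau>) \<le> cmod (?I \<tau>) \<and>
     cmod (?I \<tau>) \<le> c2 * exp (- (2 * c * L) * \<tau>)"
    using ev1 ev2 ev3 eventually_gt_at_top[of "1 / c\<^sup>2"] eventually_ge_at_top[of "1::real"] 
      eventually_ge_at_top[of "2 / c\<^sup>2"] eventually_gt_at_top[of \<tau>0]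
  proof eventually_elim
    case (elim \<tau>)
    obtain Y D where Y: "cmod Y \<le> W * (K * exp (c * L * \<tau>))" "ET \<tau> * Y + D * Ua \<tau> = - of_real g * GG \<tau>"
      and D: "cmod D \<le> d2 * \<tau> * exp (c * L * \<tau>)" "d1 * \<tau> * exp (c * L * \<tau>) \<le> cmod D"
      using growing[OF elim(4,5,3)] unfolding d1_def d2_def by blast
    obtain Y' E where Y': "cmod Y' \<le> W * (2 * K * K)" "?I \<tau> = - (ET \<tau> * Y' + E * Ua \<tau>)"
      and E: "cmod E \<le> e2 * \<tau> * exp (- c * L * \<tau>)" "e1 * \<tau> * exp (- c * L * \<tau>) \<le> cmod E"
      using decaying[OF elim(4,5,6)] unfolding e1_def e2_def by blast
    have \<tau>: "\<tau> > 0" using elim by simp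
    have ETn: "cmod (ET \<tau>) = exp (- \<tau> * T)" unfolding ET_def by (rule expn[OF elim(4)])
    have "cmod (ET \<tau> * Y) \<le> exp (- \<tau> * T) * (W * (K * exp (c * L * \<tau>)))"
      unfolding norm_mult ETn using Y(1) by (rule mult_left_mono) simp
    also have "\<dots> = W * K * exp (- (T - c * L) * \<tau>)"
      by (simp add: algebra_simps flip: exp_add)
    finally have r1: "cmod (ET \<tau> * Y) \<le> W * K * exp (- (T - c * L) * \<tau>)" .
    have "0 \<le> (T - c * L) * \<tau>" using \<delta>' \<tau> by (intro mult_nonneg_nonneg) auto
    then have "exp (- (T - c * L) * \<tau>) \<le> 1" by (simp only: exp_le_one_iff mult_minus_left neg_le_0_iff_le)
    then have "W * K * exp (- (T - c * L) * \<tau>) \<le> W * K" using W K by (simp add: mult_left_le)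
    then have r1': "cmod (ET \<tau> * Y) \<le> W * K" using r1 by linarith
    have gG: "cmod (- of_real g * GG \<tau>) = g * cmod (GG \<tau>)" using g by (simp add: norm_mult)
    have DU: "D * Ua \<tau> = - of_real g * GG \<tau> - ET \<tau> * Y" using Y(2) by (simp add: eq_diff_eq add.commute)
    have "cmod (D * Ua \<tau>) \<le> g * cmod (GG \<tau>) + W * K"
      unfolding DU using norm_triangle_ineq4[of "- of_real g * GG \<tau>" "ET \<tau> * Y"] r1' gG by linarith
    also have "\<dots> \<le> N"
      unfolding N_def using Gup[OF elim(4)] g by simp
    finally have DUup: "cmod D * cmod (Ua \<tau>) \<le> N" by (simp add: norm_mult)
    have "g * (C * \<tau> powr \<mu>) \<le> g * cmod (GG \<tau>)"
      unfolding GG_def using G[OF elim(7)] g by (intro mult_left_mono) auto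
    then have "g * C / 2 * \<tau> powr \<mu> \<le> cmod (D * Ua \<tau>)"
      unfolding DU using norm_triangle_ineq2[of "- of_real g * GG \<tau>" "ET \<tau> * Y"] gG r1 elim(1) by (simp add: field_simps)
    then have DUlo: "g * C / 2 * \<tau> powr \<mu> \<le> cmod D * cmod (Ua \<tau>)" by (simp add: norm_mult)
    define x where "x = exp (c * L * \<tau>)"
    have x: "x > 0" "exp (- c * L * \<tau>) = 1 / x" "exp (- (2 * c * L) * \<tau>) = 1 / (x * x)"
      by (simp_all add: x_def exp_minus field_simps flip: exp_add)
    have "d1 * \<tau> * x * cmod (Ua \<tau>) \<le> N"
      using mult_right_mono[OF D(2), of "cmod (Ua \<tau>)"] DUup by (simp add: x_def)
    then have Uup: "cmod (Ua \<tau>) \<le> N / (d1 * \<tau> * x)"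
      using pos \<tau> x by (simp add: pos_le_divide_eq mult_ac)
    have "g * C / 2 * \<tau> powr \<mu> \<le> d2 * \<tau> * x * cmod (Ua \<tau>)"
      using mult_right_mono[OF D(1), of "cmod (Ua \<tau>)"] DUlo by (simp add: x_def)
    then have Ulo: "g * C / 2 * \<tau> powr \<mu> / (d2 * \<tau> * x) \<le> cmod (Ua \<tau>)"
      using pos \<tau> x by (simp add: pos_divide_le_eq mult_ac)
    have "cmod (E * Ua \<tau>) \<le> (e2 * \<tau> * (1 / x)) * (N / (d1 * \<tau> * x))"
      unfolding norm_mult using E(1) Uup pos \<tau> x N by (intro mult_mono) auto
    also have "\<dots> = e2 / d1 * N * (1 / (x * x))"
      using pos \<tau> x by (simp add: field_simps)
    finally have EUup: "cmod (E * Ua \<tau>) \<le> e2 / d1 * N * (1 / (x * x))" .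
    have "2 * c1 * \<tau> powr \<mu> * (1 / (x * x)) = (e1 * \<tau> * (1 / x)) * (g * C / 2 * \<tau> powr \<mu> / (d2 * \<tau> * x))"
      unfolding c1_def using pos \<tau> x by (simp add: field_simps)
    also have "\<dots> \<le> cmod (E * Ua \<tau>)"
      unfolding norm_mult using E(2) Ulo pos \<tau> x g C by (intro mult_mono) auto
    finally have EUlo: "2 * c1 * \<tau> powr \<mu> * (1 / (x * x)) \<le> cmod (E * Ua \<tau>)" .
    have "cmod (ET \<tau> * Y') \<le> exp (- \<tau> * T) * (W * (2 * K * K))"
      unfolding norm_mult ETn using Y'(1) by (rule mult_left_mono) simp
    also have "exp (- \<tau> * T) = exp (- (T - 2 * c * L) * \<tau>) * (1 / (x * x))"
      unfolding x(3)[symmetric] by (simp add: algebra_simps flip: exp_add)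
    also have "exp (- (T - 2 * c * L) * \<tau>) * (1 / (x * x)) * (W * (2 * K * K)) 
        = (W * (2 * K * K) * exp (- (T - 2 * c * L) * \<tau>)) * (1 / (x * x))" by simp
    finally have r2: "cmod (ET \<tau> * Y') \<le> (W * (2 * K * K) * exp (- (T - 2 * c * L) * \<tau>)) * (1 / (x * x))" .
    have "\<dots> \<le> (c1 * \<tau> powr \<mu>) * (1 / (x * x))"
      using elim(2) x by (intro mult_right_mono) auto
    then have r2lo: "cmod (ET \<tau> * Y') \<le> c1 * \<tau> powr \<mu> * (1 / (x * x))" using r2 by linarith
    have "0 \<le> (T - 2 * c * L) * \<tau>" using \<delta> \<tau> by (intro mult_nonneg_nonneg) auto
    then have "exp (- (T - 2 * c * L) * \<tau>) \<le> 1" by (simp only: exp_le_one_iff mult_minus_left neg_le_0_iff_le)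
    then have "W * (2 * K * K) * exp (- (T - 2 * c * L) * \<tau>) \<le> W * (2 * K * K)" 
      using W K by (simp add: mult_left_le)
    then have "(W * (2 * K * K) * exp (- (T - 2 * c * L) * \<tau>)) * (1 / (x * x)) \<le> W * (2 * K * K) * (1 / (x * x))"
      using x by (intro mult_right_mono) auto
    then have r2up: "cmod (ET \<tau> * Y') \<le> W * (2 * K * K) * (1 / (x * x))" using r2 by linarith
    have In: "cmod (?I \<tau>) = cmod (ET \<tau> * Y' + E * Ua \<tau>)" unfolding Y'(2) by (rule norm_minus_cancel)
    have "cmod (?I \<tau>) \<le> W * (2 * K * K) * (1 / (x * x)) + e2 / d1 * N * (1 / (x * x))"
      unfolding In using norm_triangle_ineq[of "ET \<tau> * Y'" "E * Ua \<tau>"] r2up EUup by linarith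
    also have "\<dots> = (c2 - 1) * (1 / (x * x))" by (simp add: c2_def algebra_simps)
    also have "\<dots> \<le> c2 * (1 / (x * x))" using x by (intro mult_right_mono) auto
    finally have "cmod (?I \<tau>) \<le> c2 * (1 / (x * x))" .
    moreover have "c1 * \<tau> powr \<mu> * (1 / (x * x)) \<le> cmod (?I \<tau>)"
      unfolding In add.commute[of "ET \<tau> * Y'"]
      using norm_diff_ineq[of "E * Ua \<tau>" "ET \<tau> * Y'"] r2lo EUlo by linarith
    ultimately show ?case unfolding x(3) by blast
  qed
  have "((\<lambda>\<tau>. ln (cmod (?I \<tau>)) / \<tau>) \<longlongrightarrow> - (2 * c * L)) at_top"
    by (rule log_asymptotics[OF c1 c2]) (use main in \<open>auto elim: eventually_mono\<close>)
  then show ?thesis by (simp add: L_def)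
qed

end

theorem theorem2p3:
  fixes m :: nat and b \<gamma> :: "nat \<Rightarrow> real" and a T \<rho> M c :: real
    and u :: "real \<Rightarrow> real \<Rightarrow> complex" and g0 ga :: "real \<Rightarrow> complex"
  assumes "m \<ge> 1" and "b 0 = 0" and "\<forall>j<m. b j < b (j + 1)" and "b m = a"
    and "T > 0" and "\<rho> \<ge> 0" and "\<forall>j\<in>{1..m}. \<gamma> j > 0"
    and "heat_solution m b \<gamma> a \<rho> T u g0 ga"
    and "M > 0"
    and "M \<ge> 2 * (b 1 / sqrt (\<gamma> 1) + (\<Sum>j=1..m-1. (b (j + 1) - b j) / sqrt (\<gamma> (j + 1))))"
    and "c > 0" and "M * c < T"
    and "\<exists>C \<tau>0 \<mu>. C > 0 \<and> \<tau>0 > 0 \<and> \<tau>0 > 1 / c\<^sup>2 \<and>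
           (\<forall>\<tau>>\<tau>0. C * \<tau> powr \<mu> \<le>
              cmod (\<integral>t. exp (- (z_of c \<tau>)\<^sup>2 * of_real t) * g0 t \<partial>lebesgue_on {0<..<T}))"
  shows "((\<lambda>\<tau>. ln (cmod (indicator_function m b \<gamma> a T u g0 c \<tau>)) / \<tau>) \<longlongrightarrow>
           - 2 * c * (b 1 / sqrt (\<gamma> 1) + (\<Sum>j=1..m-1. (b (j + 1) - b j) / sqrt (\<gamma> (j + 1)))))
         at_top"
proof -
  interpret layered_rod m b \<gamma>
    by unfold_locales (use assms(1,2,3,7) in auto)
  obtain C \<tau>0 \<mu> where C: "C > 0" "\<And>\<tau>. \<tau> > \<tau>0 \<Longrightarrow> C * \<tau> powr \<mu> \<le>
      cmod (\<integral>t. exp (- (z_of c \<tau>)\<^sup>2 * of_real t) * g0 t \<partial>lebesgue_on {0<..<T})"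
    using assms(13) by blast
  have "2 * travel m * c \<le> M * c"
    using assms(10,11) unfolding travel_total by (intro mult_right_mono) auto
  then have "2 * travel m * c < T" using assms(12) by linarith
  from indicator_function_asymptotics[OF _ assms(5,6,11) this C] assms(4,8)
  show ?thesis unfolding travel_total by simp
qed

end
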